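(* Let $\mathcal{U}$ be a finite set, $p(y\mid u)$ a kernel, $m$ the true density of the i.i.d. data $Y_1,Y_2,\ldots$, $f_n$ the predictive recursion (PR) estimates computed from $Y_1,\ldots,Y_n$ with weights $\{w_n\}\subset(0,1)$ and initial density $f_0\in\mathbb{F}$, and $m_n=m_{f_n}$. Assume: (1) $u\mapsto p(y\mid u)$ is continuous for each $y\in\mathcal{Y}$; (2) $f\mapsto m_f$ is one-to-one on $\mathbb{F}$; (3) $\sum_n w_n=\infty$ and $\sum_n w_n^{1+\varepsilon}<\infty$ for some $\varepsilon\in(0,1]$; (4) $w_{n+1}^{-1}-w_n^{-1}\to 0$ as $n\to\infty$; (5) $K(m,m_f)<\infty$ for all $f\in\mathbb{F}$, and the unique minimizer $f^\star$ of $f\mapsto K(m,m_f)$ over $\mathbb{F}$ lies in the interior of $\mathbb{F}$ (i.e. $f^\star(u)>0$ for all $u\in\mathcal{U}$). Let $K^\star=\inf\{K(m,m_f):f\in\mathbb{F}\}$. Then for $\delta\in(0,(1-\varepsilon)/2]$, with $\varepsilon$ as in (3), almost surely as $n\to\infty$, $$\int|m_n(y)-m_{f^\star}(y)|\,dy=o(w_n^\delta)\qquad\text{and}\qquad K(m,m_n)-K^\star=o(w_n^{2\delta}).$$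
   Context: Setting. $\mathcal{U}$ is a finite set of size $s$; $\mathbb{F}=\{f\in\mathbb{R}^{\mathcal{U}}: f(u)\ge 0,\ \sum_u f(u)=1\}$ is the $(s-1)$-dimensional probability simplex, i.e. the set of all densities with respect to counting measure on $\mathcal{U}$. For each $u\in\mathcal{U}$, $p(\cdot\mid u)$ is a known probability density on $\mathcal{Y}$ with respect to a fixed dominating measure $dy$. For $f\in\mathbb{F}$, $m_f(y)=\sum_{u\in\mathcal{U}}p(y\mid u)f(u)$. The data $Y_1,Y_2,\ldots$ are i.i.d. with density $m$ on $\mathcal{Y}$, where $m$ need not be of the form $m_f$ (the model may be misspecified). Kullback–Leibler divergence: $K(m,m')=\int \log\{m(y)/m'(y)\}\,m(y)\,dy$. PR algorithm: given $f_0\in\mathbb{F}$ and weights $w_i\in(0,1)$, for $i\ge1$ set $$f_i(u)=(1-w_i)f_{i-1}(u)+w_i\,\frac{p(Y_i\mid u)f_{i-1}(u)}{m_{f_{i-1}}(Y_i)},\qquad u\in\mathcal{U}.$$ The existence and uniqueness of the minimizer $f^\star$ of $K(m,m_f)$ are part of the setting (in the source they are consequences of (1) and (2)).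
   Formalization: The initial density is additionally assumed to satisfy f_0(u)>0 for all u; without this the claim fails, since f_0(u)=0 forces f_n(u)=0 for all n, so f_n stays bounded away from the interior minimizer f*. *)

theory Defs
  imports "HOL-Probability.Probability" "HOL-Library.Landau_Symbols"
begin

definition simplex_densities :: "('u::finite \<Rightarrow> real) set" where
  "simplex_densities = {f. (\<forall>u. 0 \<le> f u) \<and> (\<Sum>u\<in>UNIV. f u) = 1}"

definition prob_density :: "'y measure \<Rightarrow> ('y \<Rightarrow> real) \<Rightarrow> bool" where
  "prob_density N g \<longleftrightarrow> (\<forall>y\<in>space N. 0 \<le> g y) \<and> has_bochner_integral N g 1"

text \<open>The kernel takes its parameter first: \<open>p u y\<close> is \<open>p(y | u)\<close>.\<close>

definition mixture :: "('u::finite \<Rightarrow> 'y \<Rightarrow> real) \<Rightarrow> ('u \<Rightarrow> real) \<Rightarrow> 'y \<Rightarrow> real" where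
  "mixture p f y = (\<Sum>u\<in>UNIV. p u y * f u)"

text \<open>
  Predictive recursion. Weights and data are indexed from 1; \<open>w 0\<close> and \<open>Y 0\<close> are never used.
  A zero denominator is a null event whenever the mixtures have finite divergence from the
  density of the data.
\<close>

primrec pred_recursion ::
  "('u::finite \<Rightarrow> 'y \<Rightarrow> real) \<Rightarrow> ('u \<Rightarrow> real) \<Rightarrow> (nat \<Rightarrow> real) \<Rightarrow> (nat \<Rightarrow> 'y) \<Rightarrow> nat \<Rightarrow> 'u \<Rightarrow> real"
where
  "pred_recursion p f0 w Y 0 = f0"
| "pred_recursion p f0 w Y (Suc i) =
    (let f = pred_recursion p f0 w Y i in
      (\<lambda>u. (1 - w (Suc i)) * f u
         + w (Suc i) * (p u (Y (Suc i)) * f u / mixture p f (Y (Suc i)))))"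

text \<open>
  The integrand \<open>log(m / m') m\<close> with the usual conventions \<open>0 log(0 / x) = 0\<close> and
  \<open>x log(x / 0) = \<infinity>\<close> for \<open>x > 0\<close>; real division and \<open>ln\<close> alone would give \<open>0\<close> in the latter case.
\<close>

definition kl_integrand :: "('y \<Rightarrow> real) \<Rightarrow> ('y \<Rightarrow> real) \<Rightarrow> 'y \<Rightarrow> ereal" where
  "kl_integrand m m' y =
    (if m y = 0 then 0 else if m' y = 0 then \<infinity> else ereal (ln (m y / m' y) * m y))"

text \<open>
  The integral is taken as an extended real, positive part minus negative part. For two
  probability densities the negative part has a finite integral, so \<open>\<infinity> - \<infinity>\<close> does not occur.
  The library's \<open>KL_divergence\<close> is real-valued and cannot express divergence to \<open>\<infinity>\<close>.
\<close>

definition kullback_leibler :: "'y measure \<Rightarrow> ('y \<Rightarrow> real) \<Rightarrow> ('y \<Rightarrow> real) \<Rightarrow> ereal" where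
  "kullback_leibler N m m' =
    enn2ereal (\<integral>\<^sup>+ y. e2ennreal (kl_integrand m m' y) \<partial>N)
    - enn2ereal (\<integral>\<^sup>+ y. e2ennreal (- kl_integrand m m' y) \<partial>N)"

end

theory Submission
  imports Defs
begin

text \<open>
  Let \<open>\<mu>\<close> have density \<open>m\<close>, \<open>q = fstar\<close> and \<open>x = m\<^sub>f / m\<^sub>q\<close>. Finite divergence at the vertices of
  the simplex makes every \<open>p u\<close> positive \<open>\<mu>\<close>-almost everywhere. As \<open>q\<close> is interior,
  \<open>\<integral> p u / m\<^sub>q d\<mu> = 1\<close> for all \<open>u\<close>, so that \<open>\<integral> x d\<mu> = 1\<close>, and \<open>x\<close> is bounded by
  \<open>B = max\<^sub>u 1 / q u\<close>. The form \<open>Q v = \<integral> (m\<^sub>v / m\<^sub>q)\<^sup>2 d\<mu>\<close> is positive definite on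
  vectors of sum zero because the minimizer is unique.

  Convergence: along the recursion, the divergence \<open>V f = \<Sum>u. q u * ln (q u / f u)\<close> changes by at
  most \<open>- w (1 - x + (x - 1)\<^sup>2 / B) + O(w\<^sup>2)\<close>, with \<open>x\<close> evaluated at the new observation. This has
  mean \<open>- w Q (f - q) / B + O(w\<^sup>2)\<close>, and its fluctuation is a bounded martingale difference,
  summable against the square-summable weights. Hence \<open>V\<close> tends to 0.

  Rate: the recursion is a stochastic approximation scheme with bounded noise, whose linearised drift
  at \<open>q\<close> is \<open>- Q\<close> in the inner product weighted by \<open>1 / q\<close>. Since the noise is almost surely summable
  against \<open>w powr (1 - \<delta>)\<close> and \<open>1 / w\<close> has vanishing increments, \<open>f - q = o(w powr \<delta>)\<close>. The
  \<open>L\<^sup>1\<close> distance is linear and the excess divergence quadratic in \<open>f - q\<close>.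
\<close>

text \<open>Relative entropy suits as Lyapunov function because the recursion multiplies each
  coordinate by a factor, so \<open>V\<close> changes by a weighted sum of logarithms. Its mean
  decrease is available on the whole interior of the simplex, whereas the linearised contraction
  holds only near \<open>q\<close>; consistency therefore has to precede the rate.

  First-order optimality is what survives misspecification: it makes \<open>q\<close> a fixed point
  of the mean update, and it removes the linear term of the excess divergence, whose exponent is
  thus twice that of the distance.

  Rescaling the error by \<open>w powr \<delta>\<close> turns the noise weights into
  \<open>w powr (1 - \<delta>)\<close>. The range of \<open>\<delta>\<close> says that
  \<open>2 * (1 - \<delta>)\<close> is at least \<open>1 + \<epsilon>\<close>, so these weights are
  square-summable. Rescaling also brings in the ratio of consecutive weights; the vanishing
  increments of \<open>1 / w\<close> make it \<open>1 + o(w)\<close>, which the drift dominates. The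
  noise series converge only conditionally, so the deterministic lemmas work with tails of the noise
  and never with its absolute sum.\<close>

section \<open>Series of bounded martingale differences\<close>

text \<open>\<open>stopped_sum l x\<close> follows the partial sums of \<open>x\<close> until they leave \<open>{-l<..<l}\<close> and then stays
  put: it turns a bound on second moments into a maximal inequality.\<close>

primrec stopped_sum :: "real \<Rightarrow> (nat \<Rightarrow> real) \<Rightarrow> nat \<Rightarrow> real" where
  "stopped_sum l x 0 = 0"
| "stopped_sum l x (Suc n) =
    stopped_sum l x n + (if \<bar>stopped_sum l x n\<bar> < l then x n else 0)"

lemma stopped_sum_eq:
  assumes "\<And>j. j < n \<Longrightarrow> \<bar>\<Sum>i<j. x i\<bar> < l"
  shows "stopped_sum l x n = (\<Sum>i<n. x i)"
  using assms by (induction n) (auto simp: less_Suc_eq)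

text \<open>At the first exit index the stopped sum still agrees with the partial sum, and from
  there on it is frozen outside the interval.\<close>

lemma stopped_sum_ge:
  assumes "j \<le> n" "l \<le> \<bar>\<Sum>i<j. x i\<bar>"
  shows "l \<le> \<bar>stopped_sum l x n\<bar>"
proof -
  define j0 where "j0 = (LEAST j. l \<le> \<bar>\<Sum>i<j. x i\<bar>)"
  have 1: "l \<le> \<bar>\<Sum>i<j0. x i\<bar>" unfolding j0_def by (rule LeastI[of _ j]) (fact assms(2))
  have 2: "j0 \<le> j" unfolding j0_def by (rule Least_le) (fact assms(2))
  have "\<And>j'. j' < j0 \<Longrightarrow> \<bar>\<Sum>i<j'. x i\<bar> < l"
    unfolding j0_def using not_less_Least by (metis not_le)
  then have 3: "l \<le> \<bar>stopped_sum l x j0\<bar>" using stopped_sum_eq[of j0 x l] 1 by simp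
  have "j0 \<le> n" using 2 assms(1) by simp
  then show ?thesis using 3 by (induction n rule: dec_induct) auto
qed

lemma stopped_sum_cong:
  assumes "\<And>i. i < n \<Longrightarrow> x i = y i"
  shows "stopped_sum l x n = stopped_sum l y n"
  using assms by (induction n) auto

lemma borel_measurable_stopped_sum [measurable (raw)]:
  assumes "\<And>i. i < n \<Longrightarrow> (\<lambda>\<omega>. f \<omega> i) \<in> borel_measurable M"
  shows "(\<lambda>\<omega>. stopped_sum l (f \<omega>) n) \<in> borel_measurable M"
  using assms
proof (induction n)
  case (Suc n)
  have [measurable]: "(\<lambda>\<omega>. stopped_sum l (f \<omega>) n) \<in> borel_measurable M" using Suc by simp
  have [measurable]: "(\<lambda>\<omega>. f \<omega> n) \<in> borel_measurable M" using Suc by simp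
  show ?case by simp
qed simp

lemma abs_stopped_sum_le:
  assumes "\<And>i. i < n \<Longrightarrow> \<bar>x i\<bar> \<le> c i"
  shows "\<bar>stopped_sum l x n\<bar> \<le> (\<Sum>i<n. c i)"
  using assms
proof (induction n)
  case (Suc n)
  have "\<bar>stopped_sum l x n\<bar> \<le> (\<Sum>i<n. c i)" using Suc by simp
  moreover have "\<bar>x n\<bar> \<le> c n" using Suc by simp
  ultimately show ?case by auto
qed simp

text \<open>\<open>D_orthogonal\<close> expresses a vanishing conditional mean by testing against
  bounded Borel functions of the earlier differences, without filtrations or conditional
  expectations. Such test functions suffice because stopped partial sums depend on nothing
  else.\<close>

locale bounded_martingale_differences = prob_space M for M :: "'a measure" +
  fixes D :: "nat \<Rightarrow> 'a \<Rightarrow> real" and C :: real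
  assumes D_measurable [measurable]: "\<And>n. D n \<in> borel_measurable M"
    and D_bounded: "\<And>n \<omega>. \<omega> \<in> space M \<Longrightarrow> \<bar>D n \<omega>\<bar> \<le> C"
    and D_orthogonal: "\<And>n g b. g \<in> borel_measurable (Pi\<^sub>M {..<n} (\<lambda>_. borel)) \<Longrightarrow> (\<And>x. \<bar>g x\<bar> \<le> b) \<Longrightarrow>
      (\<integral>\<omega>. g (\<lambda>i\<in>{..<n}. D i \<omega>) * D n \<omega> \<partial>M) = 0"
begin

lemma C_nonneg: "0 \<le> C"
proof -
  obtain \<omega> where "\<omega> \<in> space M" using not_empty by blast
  from D_bounded[OF this, of 0] show ?thesis by linarith
qed

text \<open>Whether the next term is added, and to what, is decided by earlier differences. The
  cross term therefore integrates to zero and second moments add up as for independent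
  summands.\<close>

lemma stopped_second_moment:
  assumes l: "0 < l"
  shows "(\<integral>\<omega>. (stopped_sum l (\<lambda>i. a (k + i) * D (k + i) \<omega>) n)\<^sup>2 \<partial>M) \<le> C\<^sup>2 * (\<Sum>i<n. (a (k + i))\<^sup>2)"
proof (induction n)
  case (Suc n)
  define T where "T \<omega> = stopped_sum l (\<lambda>i. a (k + i) * D (k + i) \<omega>) n" for \<omega>
  define I where "I \<omega> = (if \<bar>T \<omega>\<bar> < l then a (k + n) else 0)" for \<omega>
  have [measurable]: "T \<in> borel_measurable M" unfolding T_def by measurable
  have [measurable]: "I \<in> borel_measurable M" unfolding I_def by measurable
  define b where "b = (\<Sum>i<n. \<bar>a (k + i)\<bar> * C)"
  have Tb: "\<bar>T \<omega>\<bar> \<le> b" if "\<omega> \<in> space M" for \<omega>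
    unfolding T_def b_def
    by (rule abs_stopped_sum_le) (auto simp: abs_mult intro!: mult_left_mono D_bounded that)
  have Ib: "\<bar>I \<omega>\<bar> \<le> \<bar>a (k + n)\<bar>" for \<omega> by (auto simp: I_def)
  have Db: "\<bar>D j \<omega>\<bar> \<le> C" if "\<omega> \<in> space M" for \<omega> j using D_bounded that by blast
  have b0: "0 \<le> b" unfolding b_def by (intro sum_nonneg mult_nonneg_nonneg C_nonneg) auto
  have i1: "integrable M (\<lambda>\<omega>. (T \<omega>)\<^sup>2)"
    by (rule integrable_const_bound[where B="b\<^sup>2"])
       (use Tb b0 in \<open>auto simp: abs_le_square_iff[symmetric] intro!: AE_I2\<close>)
  have i2: "integrable M (\<lambda>\<omega>. 2 * (T \<omega> * I \<omega> * D (k+n) \<omega>))"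
    by (rule integrable_const_bound[where B="2 * (b * \<bar>a (k+n)\<bar> * C)"])
       (use Tb Ib Db b0 in \<open>auto simp: abs_mult intro!: AE_I2 mult_mono mult_nonneg_nonneg\<close>)
  have i3b: "(I \<omega> * D (k+n) \<omega>)\<^sup>2 \<le> C\<^sup>2 * (a (k+n))\<^sup>2" if "\<omega> \<in> space M" for \<omega>
  proof -
    have "\<bar>I \<omega> * D (k+n) \<omega>\<bar> \<le> \<bar>a (k+n) * C\<bar>"
      using Ib[of \<omega>] Db[OF that, of "k+n"] C_nonneg by (auto simp: abs_mult intro!: mult_mono)
    then show ?thesis by (simp add: abs_le_square_iff power_mult_distrib mult.commute)
  qed
  have i3: "integrable M (\<lambda>\<omega>. (I \<omega> * D (k+n) \<omega>)\<^sup>2)"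
    by (rule integrable_const_bound[where B="C\<^sup>2 * (a (k+n))\<^sup>2"])
       (use i3b in \<open>auto intro!: AE_I2\<close>)
  have cross: "(\<integral>\<omega>. T \<omega> * I \<omega> * D (k+n) \<omega> \<partial>M) = 0"
  proof -
    \<comment> \<open>The orthogonality property asks for a bound at every argument, also at
      sequences that no sample point produces. Since \<open>g\<close> vanishes once the stopped sum
      has left the interval, \<open>l * \<bar>a (k+n)\<bar>\<close> is such a bound.\<close>
    define g where "g x = (let t = stopped_sum l (\<lambda>i. a (k + i) * x (k + i)) n in
      if \<bar>t\<bar> < l then t * a (k + n) else 0)" for x
    have gm: "g \<in> borel_measurable (Pi\<^sub>M {..<k+n} (\<lambda>_. borel))"
      unfolding g_def Let_def by measurable
    have gb: "\<bar>g x\<bar> \<le> l * \<bar>a (k+n)\<bar>" for x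
      using l by (auto simp: g_def Let_def abs_mult intro!: mult_right_mono)
    have "g (\<lambda>i\<in>{..<k+n}. D i \<omega>) = T \<omega> * I \<omega>" for \<omega>
    proof -
      have "stopped_sum l (\<lambda>i. a (k + i) * (\<lambda>i\<in>{..<k+n}. D i \<omega>) (k + i)) n = T \<omega>"
        unfolding T_def by (rule stopped_sum_cong) simp
      then show ?thesis by (simp add: g_def I_def)
    qed
    then show ?thesis using D_orthogonal[OF gm gb] by simp
  qed
  have "(stopped_sum l (\<lambda>i. a (k + i) * D (k + i) \<omega>) (Suc n))\<^sup>2 =
      (T \<omega>)\<^sup>2 + 2 * (T \<omega> * I \<omega> * D (k+n) \<omega>) + (I \<omega> * D (k+n) \<omega>)\<^sup>2" for \<omega>
    by (simp only: stopped_sum.simps T_def[symmetric])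
       (simp add: I_def power2_eq_square algebra_simps)
  then have "(\<integral>\<omega>. (stopped_sum l (\<lambda>i. a (k + i) * D (k + i) \<omega>) (Suc n))\<^sup>2 \<partial>M) =
     (\<integral>\<omega>. (T \<omega>)\<^sup>2 \<partial>M) + 2 * (\<integral>\<omega>. T \<omega> * I \<omega> * D (k+n) \<omega> \<partial>M) + (\<integral>\<omega>. (I \<omega> * D (k+n) \<omega>)\<^sup>2 \<partial>M)"
    using i1 i2 i3 by simp
  also have "\<dots> \<le> C\<^sup>2 * (\<Sum>i<n. (a (k + i))\<^sup>2) + C\<^sup>2 * (a (k+n))\<^sup>2"
  proof -
    have "(\<integral>\<omega>. (I \<omega> * D (k+n) \<omega>)\<^sup>2 \<partial>M) \<le> (\<integral>\<omega>. C\<^sup>2 * (a (k+n))\<^sup>2 \<partial>M)"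
      by (rule integral_mono) (use i3 i3b in auto)
    also have "\<dots> = C\<^sup>2 * (a (k+n))\<^sup>2" by (simp add: prob_space)
    finally show ?thesis using Suc cross unfolding T_def by simp
  qed
  finally show ?case by (simp add: algebra_simps)
qed simp

text \<open>Kolmogorov's inequality: stopping converts the exit of some partial sum into a large
  final value, to which Markov's inequality for the square applies.\<close>

lemma maximal_inequality:
  assumes l: "0 < l"
  shows "prob {\<omega> \<in> space M. \<exists>j\<le>n. l \<le> \<bar>\<Sum>i<j. a (k + i) * D (k + i) \<omega>\<bar>}
    \<le> C\<^sup>2 * (\<Sum>i<n. (a (k + i))\<^sup>2) / l\<^sup>2"
proof -
  define T where "T \<omega> = stopped_sum l (\<lambda>i. a (k + i) * D (k + i) \<omega>) n" for \<omega>
  have [measurable]: "T \<in> borel_measurable M" unfolding T_def by measurable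
  have Tb: "\<bar>T \<omega>\<bar> \<le> (\<Sum>i<n. \<bar>a (k + i)\<bar> * C)" if "\<omega> \<in> space M" for \<omega>
    unfolding T_def
    by (rule abs_stopped_sum_le) (auto simp: abs_mult intro!: mult_left_mono D_bounded that)
  have i1: "integrable M (\<lambda>\<omega>. (T \<omega>)\<^sup>2)"
    by (rule integrable_const_bound[where B="(\<Sum>i<n. \<bar>a (k + i)\<bar> * C)\<^sup>2"])
       (use Tb in \<open>fastforce simp: abs_le_square_iff[symmetric] intro!: AE_I2\<close>)+
  have "prob {\<omega> \<in> space M. \<exists>j\<le>n. l \<le> \<bar>\<Sum>i<j. a (k + i) * D (k + i) \<omega>\<bar>}
     \<le> prob {\<omega> \<in> space M. l\<^sup>2 \<le> (T \<omega>)\<^sup>2}"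
  proof (rule finite_measure_mono)
    show "{\<omega> \<in> space M. \<exists>j\<le>n. l \<le> \<bar>\<Sum>i<j. a (k + i) * D (k + i) \<omega>\<bar>}
        \<subseteq> {\<omega> \<in> space M. l\<^sup>2 \<le> (T \<omega>)\<^sup>2}"
    proof safe
      fix \<omega> j assume "j \<le> n" "l \<le> \<bar>\<Sum>i<j. a (k + i) * D (k + i) \<omega>\<bar>"
      then have "l \<le> \<bar>T \<omega>\<bar>" unfolding T_def by (rule stopped_sum_ge)
      then show "l\<^sup>2 \<le> (T \<omega>)\<^sup>2" using l by (simp add: abs_le_square_iff[symmetric])
    qed
  qed simp
  also have "\<dots> \<le> (\<integral>\<omega>. (T \<omega>)\<^sup>2 \<partial>M) / l\<^sup>2"
    using integral_Markov_inequality_measure[OF i1, of "space M" "l\<^sup>2"] l by simp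
  also have "\<dots> \<le> (C\<^sup>2 * (\<Sum>i<n. (a (k + i))\<^sup>2)) / l\<^sup>2"
    by (rule divide_right_mono) (use stopped_second_moment[OF l, of a k n] in \<open>simp_all add: T_def\<close>)
  finally show ?thesis by simp
qed

text \<open>By the maximal inequality, started at \<open>k\<close> and with \<open>n\<close> tending
  to infinity, the probability of ever leaving the interval is at most a multiple of the tail of the
  square sum. It tends to zero in \<open>k\<close>, so exits for every starting index form a null
  event.\<close>

lemma AE_tail_small:
  assumes a: "summable (\<lambda>n. (a n)\<^sup>2)" and l: "0 < l"
  shows "AE \<omega> in M. \<exists>k. \<forall>n. \<bar>\<Sum>i<n. a (k + i) * D (k + i) \<omega>\<bar> < l"
proof -
  define E where "E k n = {\<omega> \<in> space M. \<exists>j\<le>n. l \<le> \<bar>\<Sum>i<j. a (k + i) * D (k + i) \<omega>\<bar>}" for k n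
  have [measurable]: "E k n \<in> sets M" for k n unfolding E_def by measurable
  define r where "r k = C\<^sup>2 * (\<Sum>i. (a (i + k))\<^sup>2) / l\<^sup>2" for k
  have le: "prob (\<Union>n. E k n) \<le> r k" for k
  proof (rule LIMSEQ_le_const2)
    show "(\<lambda>n. prob (E k n)) \<longlonglongrightarrow> prob (\<Union>n. E k n)"
      by (rule finite_Lim_measure_incseq)
         (auto simp: E_def incseq_def intro: order_trans)
    have "prob (E k n) \<le> r k" for n
    proof -
      have "(\<Sum>i<n. (a (i + k))\<^sup>2) \<le> (\<Sum>i. (a (i + k))\<^sup>2)"
        by (rule sum_le_suminf) (auto simp: summable_iff_shift[of "\<lambda>n. (a n)\<^sup>2"] a)
      then have "C\<^sup>2 * (\<Sum>i<n. (a (k + i))\<^sup>2) / l\<^sup>2 \<le> r k"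
        unfolding r_def by (intro divide_right_mono mult_left_mono) (auto simp: add.commute)
      then show ?thesis using maximal_inequality[OF l, of n a k] unfolding E_def by linarith
    qed
    then show "\<exists>N. \<forall>n\<ge>N. prob (E k n) \<le> r k" by blast
  qed
  have r0: "r \<longlonglongrightarrow> 0"
    unfolding r_def using suminf_exist_split2[OF a] l by (auto intro!: tendsto_eq_intros)
  have "prob (\<Inter>k. \<Union>n. E k n) \<le> r k" for k
  proof -
    have "prob (\<Inter>k. \<Union>n. E k n) \<le> prob (\<Union>n. E k n)"
      by (rule finite_measure_mono) auto
    then show ?thesis using le[of k] by linarith
  qed
  then have "prob (\<Inter>k. \<Union>n. E k n) \<le> 0"
    by (intro LIMSEQ_le_const[OF r0]) auto
  then have "prob (\<Inter>k. \<Union>n. E k n) = 0" using measure_nonneg[of M] by (simp add: antisym)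
  then have "AE \<omega> in M. \<omega> \<notin> (\<Inter>k. \<Union>n. E k n)"
    by (subst (asm) prob_eq_0) auto
  with AE_space show ?thesis
  proof eventually_elim
    case (elim \<omega>)
    from elim(2) obtain k where k: "\<omega> \<notin> E k n" for n by blast
    have "\<bar>\<Sum>i<n. a (k + i) * D (k + i) \<omega>\<bar> < l" for n
      using k[of n] elim(1) by (auto simp: E_def not_le)
    then show ?case by blast
  qed
qed

text \<open>Cauchy's criterion along the thresholds \<open>1 / real (Suc j)\<close>: a block beyond
  \<open>k\<close> is the difference of two sums that both start at \<open>k\<close>, hence twice
  the threshold bounds it.\<close>

theorem AE_summable:
  assumes a: "summable (\<lambda>n. (a n)\<^sup>2)"
  shows "AE \<omega> in M. summable (\<lambda>n. a n * D n \<omega>)"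
proof -
  have "AE \<omega> in M. \<forall>j. \<exists>k. \<forall>n. \<bar>\<Sum>i<n. a (k + i) * D (k + i) \<omega>\<bar> < 1 / real (Suc j)"
    unfolding AE_all_countable by (intro allI AE_tail_small[OF a]) simp
  then show ?thesis
  proof eventually_elim
    case (elim \<omega>)
    let ?f = "\<lambda>n. a n * D n \<omega>"
    show ?case unfolding summable_Cauchy
    proof (intro allI impI)
      fix e :: real assume "0 < e"
      then obtain j where j: "1 / real (Suc j) < e / 2"
        using nat_approx_posE[of "e/2"] by (auto simp: field_simps)
      from elim obtain k where k: "\<And>n. \<bar>\<Sum>i<n. ?f (k + i)\<bar> < 1 / real (Suc j)" by blast
      have s: "\<bar>sum ?f {k..<k+n}\<bar> < e / 2" for n
        using k[of n] j sum.shift_bounds_nat_ivl[of ?f 0 k n] 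
        by (simp add: atLeast0LessThan add.commute)
      have "norm (sum ?f {m..<n}) < e" if "m \<ge> k" for m n
      proof (cases "m \<le> n")
        case True
        then have "sum ?f {m..<n} = sum ?f {k..<n} - sum ?f {k..<m}"
          using sum.atLeastLessThan_concat[of k m n ?f] that by simp
        then show ?thesis using s[of "n-k"] s[of "m-k"] that True by simp
      qed (use \<open>0 < e\<close> in simp)
      then show "\<exists>N. \<forall>m\<ge>N. \<forall>n. norm (sum ?f {m..<n}) < e" by blast
    qed
  qed
qed

end


section \<open>Deterministic recursions\<close>

text \<open>As soon as \<open>\<tau>\<close> is below \<open>\<kappa> * (\<eta> / 2)\<close>, the
  excess of \<open>a\<close> over \<open>\<eta> / 2\<close> is multiplied by at most
  \<open>1 - \<kappa> * w n \<le> exp (- \<kappa> * w n)\<close>. Divergence of the weight sum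
  drives the product of these factors to zero.\<close>

lemma recursion_tendsto_0:
  fixes a w \<tau> :: "nat \<Rightarrow> real"
  assumes a: "\<And>n. 0 \<le> a n" and \<kappa>: "0 < \<kappa>"
    and w: "\<forall>\<^sub>F n in sequentially. 0 \<le> w n \<and> \<kappa> * w n \<le> 1"
    and div: "filterlim (\<lambda>n. \<Sum>i<n. w i) at_top sequentially"
    and \<tau>: "\<tau> \<longlonglongrightarrow> 0"
    and rec: "\<forall>\<^sub>F n in sequentially. a (Suc n) \<le> (1 - \<kappa> * w n) * a n + w n * \<tau> n"
  shows "a \<longlonglongrightarrow> 0"
proof (rule LIMSEQ_I)
  fix \<eta> :: real assume \<eta>: "0 < \<eta>"
  have "\<forall>\<^sub>F n in sequentially. \<tau> n < \<kappa> * (\<eta> / 2)"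
    using order_tendstoD(2)[OF \<tau>, of "\<kappa> * (\<eta> / 2)"] \<kappa> \<eta> by simp
  from eventually_conj[OF this eventually_conj[OF w rec]] obtain N where
    N: "\<And>n. n \<ge> N \<Longrightarrow> \<tau> n < \<kappa> * (\<eta> / 2) \<and> (0 \<le> w n \<and> \<kappa> * w n \<le> 1) \<and>
      a (Suc n) \<le> (1 - \<kappa> * w n) * a n + w n * \<tau> n"
    unfolding eventually_sequentially by blast
  define s where "s n = (\<Sum>i<n. w i)" for n
  \<comment> \<open>The absolute value keeps the right side nonnegative even if \<open>a N\<close>
    already lies below \<open>\<eta> / 2\<close>; the comparison with the exponential needs that
    sign.\<close>
  have bound: "a n - \<eta> / 2 \<le> \<bar>a N - \<eta> / 2\<bar> * exp (- \<kappa> * (s n - s N))" if "N \<le> n" for n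
    using that
  proof (induction n rule: dec_induct)
    case (step n)
    have Nn: "\<tau> n < \<kappa> * (\<eta> / 2)" "0 \<le> w n" "\<kappa> * w n \<le> 1"
      "a (Suc n) \<le> (1 - \<kappa> * w n) * a n + w n * \<tau> n" using N step by auto
    have "a (Suc n) - \<eta> / 2 \<le> (1 - \<kappa> * w n) * (a n - \<eta> / 2)"
      using Nn mult_left_mono[of "\<tau> n" "\<kappa> * (\<eta> / 2)" "w n"] by (simp add: algebra_simps)
    also have "\<dots> \<le> (1 - \<kappa> * w n) * (\<bar>a N - \<eta> / 2\<bar> * exp (- \<kappa> * (s n - s N)))"
      using step Nn by (intro mult_left_mono) auto
    also have "\<dots> \<le> exp (- \<kappa> * w n) * (\<bar>a N - \<eta> / 2\<bar> * exp (- \<kappa> * (s n - s N)))"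
      using exp_ge_add_one_self[of "- \<kappa> * w n"] by (intro mult_right_mono) auto
    also have "\<dots> = \<bar>a N - \<eta> / 2\<bar> * exp (- \<kappa> * (s (Suc n) - s N))"
      by (simp add: s_def algebra_simps flip: exp_add)
    finally show ?case .
  qed auto
  have "filterlim (\<lambda>n. s n - s N) at_top sequentially"
    using filterlim_tendsto_add_at_top[OF tendsto_const[of "- s N"] div[folded s_def]]
    by (simp add: add.commute)
  then have "filterlim (\<lambda>n. - \<kappa> * (s n - s N)) at_bot sequentially"
    by (rule filterlim_tendsto_neg_mult_at_bot[OF tendsto_const, rotated]) (simp add: \<kappa>)
  then have "(\<lambda>n. exp (- \<kappa> * (s n - s N))) \<longlonglongrightarrow> 0"
    by (rule filterlim_compose[OF exp_at_bot])
  then have "(\<lambda>n. \<bar>a N - \<eta> / 2\<bar> * exp (- \<kappa> * (s n - s N))) \<longlonglongrightarrow> 0"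
    by (rule tendsto_mult_right_zero)
  from order_tendstoD(2)[OF this, of "\<eta> / 2"] \<eta>
  have "\<forall>\<^sub>F n in sequentially. \<bar>a N - \<eta> / 2\<bar> * exp (- \<kappa> * (s n - s N)) < \<eta> / 2" by simp
  with eventually_ge_at_top[of N] have "\<forall>\<^sub>F n in sequentially. norm (a n - 0) < \<eta>"
  proof eventually_elim
    case (elim n)
    then show ?case using bound[of n] a[of n] by simp
  qed
  then show "\<exists>no. \<forall>n\<ge>no. norm (a n - 0) < \<eta>" by (simp add: eventually_sequentially)
qed

lemma summable_bounded_sums:
  fixes e :: "nat \<Rightarrow> real"
  assumes "summable e" "0 < \<eta>"
  obtains N where "\<And>m n. N \<le> m \<Longrightarrow> \<bar>\<Sum>i=m..<n. e i\<bar> < \<eta>"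
proof -
  from assms obtain N where "\<forall>m\<ge>N. \<forall>n. norm (\<Sum>i=m..<n. e i) < \<eta>"
    unfolding summable_Cauchy by blast
  then show thesis by (intro that[of N]) auto
qed

text \<open>\<open>Q\<close> cannot stay above \<open>\<eta>\<close>, for then the diverging weight
  sum would push \<open>V\<close> below zero. So at some late time \<open>Q\<close>, and with it
  \<open>V\<close>, is small; afterwards \<open>V\<close> can rise only by sums of \<open>e\<close>
  over late blocks. Only conditional convergence of \<open>e\<close> is used.\<close>

lemma lyapunov_tendsto_0:
  fixes V Q w e :: "nat \<Rightarrow> real"
  assumes V: "\<And>n. 0 \<le> V n" and Q: "\<And>n. 0 \<le> Q n" and w: "\<And>n. 0 \<le> w n"
    and div: "filterlim (\<lambda>n. \<Sum>i<n. w i) at_top sequentially"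
    and e: "summable e"
    and rec: "\<forall>\<^sub>F n in sequentially. V (Suc n) \<le> V n - w n * Q n + e n"
    and VQ: "\<And>r. 0 < r \<Longrightarrow> \<exists>\<eta>>0. \<forall>n. Q n < \<eta> \<longrightarrow> V n < r"
  shows "V \<longlonglongrightarrow> 0"
proof (rule LIMSEQ_I)
  fix r :: real assume r: "0 < r"
  obtain \<eta> where \<eta>: "0 < \<eta>" "\<And>n. Q n < \<eta> \<Longrightarrow> V n < r / 2" using VQ[of "r/2"] r by auto
  obtain N1 where N1: "\<And>n. n \<ge> N1 \<Longrightarrow> V (Suc n) \<le> V n - w n * Q n + e n"
    using rec unfolding eventually_sequentially by blast
  obtain N2 where N2: "\<And>m n. N2 \<le> m \<Longrightarrow> \<bar>\<Sum>i=m..<n. e i\<bar> < r / 2"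
    using summable_bounded_sums[OF e, of "r/2"] r by auto
  define N where "N = max N1 N2"
  have iter: "V n \<le> V m - (\<Sum>i=m..<n. w i * Q i) + (\<Sum>i=m..<n. e i)" if "N \<le> m" "m \<le> n" for m n
    using \<open>m \<le> n\<close>
  proof (induction n rule: dec_induct)
    case (step n)
    then show ?case using N1[of n] that by (simp add: N_def)
  qed simp
  have "\<exists>m\<ge>N. Q m < \<eta>"
  proof (rule ccontr)
    assume "\<not> ?thesis"
    then have big: "\<And>i. i \<ge> N \<Longrightarrow> \<eta> \<le> Q i" by force
    have "(\<Sum>i<n. w i) \<le> (\<Sum>i<N. w i) + (V N + r / 2) / \<eta>" if "n \<ge> N" for n
    proof -
      have "\<eta> * (\<Sum>i=N..<n. w i) \<le> (\<Sum>i=N..<n. w i * Q i)"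
        unfolding sum_distrib_left using big w
        by (intro sum_mono) (auto simp: mult.commute intro!: mult_right_mono)
      also have "\<dots> \<le> V N + r / 2"
        using iter[of N n] N2[of N n] V[of n] that by (simp add: N_def)
      finally have "(\<Sum>i=N..<n. w i) \<le> (V N + r / 2) / \<eta>" using \<eta> by (simp add: field_simps)
      moreover have "(\<Sum>i<n. w i) = (\<Sum>i<N. w i) + (\<Sum>i=N..<n. w i)"
        using sum.atLeastLessThan_concat[of 0 N n w] that by (simp add: atLeast0LessThan)
      ultimately show ?thesis by simp
    qed
    moreover from div have "\<forall>\<^sub>F n in sequentially. (\<Sum>i<N. w i) + (V N + r / 2) / \<eta> < (\<Sum>i<n. w i)"
      by (simp add: filterlim_at_top_dense)
    then obtain n where "n \<ge> N" "(\<Sum>i<N. w i) + (V N + r / 2) / \<eta> < (\<Sum>i<n. w i)"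
      by (metis (mono_tags, lifting) eventually_sequentially nle_le)
    ultimately show False by force
  qed
  then obtain m where m: "m \<ge> N" "Q m < \<eta>" by blast
  have "norm (V n - 0) < r" if "n \<ge> m" for n
  proof -
    have "0 \<le> (\<Sum>i=m..<n. w i * Q i)" by (intro sum_nonneg mult_nonneg_nonneg w Q)
    then show ?thesis
      using iter[OF m(1) that] N2[of m n] m \<eta>(2)[OF m(2)] V[of n] by (simp add: N_def)
  qed
  then show "\<exists>no. \<forall>n\<ge>no. norm (V n - 0) < r" by blast
qed

section \<open>Rates for noisy contractions\<close>

lemma powr_near_1:
  fixes t \<delta> :: real
  assumes "0 < t" "0 \<le> \<delta>" "\<delta> \<le> 1"
  shows "\<bar>t powr \<delta> - 1\<bar> \<le> \<bar>t - 1\<bar>"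
proof (cases "1 \<le> t")
  case True
  have "1 \<le> t powr \<delta>" using True assms by (simp add: ge_one_powr_ge_zero)
  moreover have "t powr \<delta> \<le> t powr 1" using True assms by (intro powr_mono) auto
  ultimately show ?thesis using True by simp
next
  case False
  have "t powr \<delta> \<le> 1" using False assms by (simp add: powr_le1)
  moreover have "t powr 1 \<le> t powr \<delta>" using False assms by (intro powr_mono') auto
  ultimately show ?thesis using False assms by simp
qed

text \<open>The drift contracts \<open>\<Delta>\<close> while the recursion moves
  \<open>X = \<Delta> + T\<close>; the mismatch is paid for by a multiple of the squared norm of
  \<open>T\<close>. Half of the contraction in \<open>\<Delta> \<bullet> g\<close> is lost to
  \<open>k - g\<close>. The remaining \<open>- c * D\<^sup>2\<close> in the doubled inner product
  gives up a quarter of \<open>c\<close> to the cross term with \<open>T\<close> and a quarter to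
  the second-order term, and passing from \<open>D\<close> to \<open>norm X\<close> halves what is
  left. The factor \<open>2 * C + 1\<close> is \<open>(C + 1) + C\<close>, a bound for
  \<open>norm k\<close> relative to \<open>D\<close>.\<close>

lemma perturbed_contraction_step:
  fixes X T g k :: "'b::real_inner" and c C \<eta> w :: real
  defines "\<Delta> \<equiv> X - T"
  assumes c: "0 < c" and C: "0 \<le> C" and w: "0 < w" "w \<le> 1" "w * (2 * C + 1)\<^sup>2 \<le> c / 4"
    and inner: "\<Delta> \<bullet> g \<le> - c * (norm \<Delta>)\<^sup>2" and norm: "norm g \<le> C * norm \<Delta>"
    and k: "norm (k - g) \<le> \<eta> * norm \<Delta>" and \<eta>: "\<eta> \<le> c / 2" "\<eta> \<le> C + 1"
  shows "(norm (X + w *\<^sub>R k))\<^sup>2 \<le>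
    (1 - c / 4 * w) * (norm X)\<^sup>2 + w * ((4 * (2 * C + 1)\<^sup>2 / c + c / 2) * (norm T)\<^sup>2)"
proof -
  define C' where "C' = 2 * C + 1"
  define D where "D = norm \<Delta>"
  have D0: "0 \<le> D" by (simp add: D_def)
  have kn: "norm k \<le> C' * D"
  proof -
    have "norm k \<le> norm (k - g) + norm g" by (metis norm_triangle_sub add.commute)
    also have "\<dots> \<le> \<eta> * D + C * D" using k norm by (simp add: D_def)
    also have "\<dots> \<le> (C + 1) * D + C * D" using \<eta> D0 by (intro add_mono mult_right_mono) auto
    finally show ?thesis by (simp add: C'_def algebra_simps)
  qed
  have "\<Delta> \<bullet> k = \<Delta> \<bullet> g + \<Delta> \<bullet> (k - g)" by (simp add: inner_diff_right)
  also have "\<dots> \<le> - c * D\<^sup>2 + D * (\<eta> * D)"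
    using inner Cauchy_Schwarz_ineq2[of \<Delta> "k - g"] mult_left_mono[OF k D0] by (simp add: D_def)
  also have "\<dots> \<le> - c * D\<^sup>2 + c / 2 * D\<^sup>2"
    using mult_right_mono[OF \<eta>(1), of "D\<^sup>2"] by (simp add: power2_eq_square algebra_simps)
  finally have dk: "\<Delta> \<bullet> k \<le> - (c / 2) * D\<^sup>2" by (simp add: algebra_simps)
  have tk: "T \<bullet> k \<le> norm T * (C' * D)"
    using Cauchy_Schwarz_ineq2[of T k] mult_left_mono[OF kn norm_ge_zero, of T] by simp
  have Xk: "X \<bullet> k = \<Delta> \<bullet> k + T \<bullet> k" by (simp add: \<Delta>_def inner_diff_left)
  have k2: "w * (norm k)\<^sup>2 \<le> c / 4 * D\<^sup>2"
  proof -
    have "w * (norm k)\<^sup>2 \<le> w * (C' * D)\<^sup>2" using kn w by (intro mult_left_mono power_mono) auto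
    also have "\<dots> = w * C'\<^sup>2 * D\<^sup>2" by (simp add: power_mult_distrib)
    also have "\<dots> \<le> c / 4 * D\<^sup>2" using w by (intro mult_right_mono) (auto simp: C'_def)
    finally show ?thesis .
  qed
  have amgm: "2 * (norm T * (C' * D)) \<le> c / 4 * D\<^sup>2 + 4 * C'\<^sup>2 / c * (norm T)\<^sup>2"
  proof -
    have "0 \<le> (c / 2 * D - 2 * C' * norm T)\<^sup>2 / c" using c by simp
    also have "\<dots> = c / 4 * D\<^sup>2 + 4 * C'\<^sup>2 / c * (norm T)\<^sup>2 - 2 * (norm T * (C' * D))"
      using c by (simp add: power2_eq_square field_simps)
    finally show ?thesis by simp
  qed
  have par: "- (c / 2) * D\<^sup>2 \<le> - (c / 4) * (norm X)\<^sup>2 + c / 2 * (norm T)\<^sup>2"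
  proof -
    have "(norm X)\<^sup>2 \<le> (D + norm T)\<^sup>2"
      using norm_triangle_ineq[of \<Delta> T] by (intro power_mono) (auto simp: \<Delta>_def D_def)
    also have "\<dots> \<le> 2 * D\<^sup>2 + 2 * (norm T)\<^sup>2"
      using zero_le_power2[of "D - norm T"] by (simp add: power2_eq_square algebra_simps)
    finally have "c / 4 * (norm X)\<^sup>2 \<le> c / 4 * (2 * D\<^sup>2 + 2 * (norm T)\<^sup>2)"
      using c by (intro mult_left_mono) auto
    then show ?thesis by (simp add: algebra_simps)
  qed
  have "(norm (X + w *\<^sub>R k))\<^sup>2 = (norm X)\<^sup>2 + w * (2 * (X \<bullet> k) + w * (norm k)\<^sup>2)"
    by (simp add: power2_norm_eq_inner inner_add_left inner_add_right inner_commute algebra_simps)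
  also have "\<dots> \<le> (norm X)\<^sup>2 + w * (- (c / 4) * (norm X)\<^sup>2 + c / 2 * (norm T)\<^sup>2 + 4 * C'\<^sup>2 / c * (norm T)\<^sup>2)"
    using Xk dk tk k2 amgm par w by (intro add_left_mono mult_left_mono) auto
  finally show ?thesis by (simp add: C'_def algebra_simps)
qed

text \<open>Adding the tail \<open>T\<close> of the convergent noise series to the rescaled error turns the noisy
  recursion into a contraction with vanishing perturbation.\<close>

theorem stochastic_approximation_rate:
  fixes d h e :: "nat \<Rightarrow> 'b::{real_inner, banach}" and w :: "nat \<Rightarrow> real" and c C \<delta> :: real
  assumes w: "\<And>n. 1 \<le> n \<Longrightarrow> 0 < w n" and w0: "w \<longlonglongrightarrow> 0"
    and div: "filterlim (\<lambda>n. \<Sum>i<n. w (Suc i)) at_top sequentially"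
    and reg: "(\<lambda>n. inverse (w (Suc n)) - inverse (w n)) \<longlonglongrightarrow> 0"
    and \<delta>: "0 \<le> \<delta>" "\<delta> \<le> 1" and c: "0 < c" and C: "0 \<le> C"
    and rec: "\<And>n. d (Suc n) = d n + w (Suc n) *\<^sub>R (h n + e n)"
    and inner: "\<forall>\<^sub>F n in sequentially. d n \<bullet> h n \<le> - c * (norm (d n))\<^sup>2"
    and norm: "\<forall>\<^sub>F n in sequentially. norm (h n) \<le> C * norm (d n)"
    and noise: "summable (\<lambda>n. w (Suc n) powr (1 - \<delta>) *\<^sub>R e n)"
  shows "(\<lambda>n. norm (d n) / w n powr \<delta>) \<longlonglongrightarrow> 0"
proof -
  define \<Delta> where "\<Delta> n = (1 / w n powr \<delta>) *\<^sub>R d n" for n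
  define g where "g n = (1 / w n powr \<delta>) *\<^sub>R h n" for n
  define u where "u n = w (Suc n) powr (1 - \<delta>) *\<^sub>R e n" for n
  define T where "T n = (\<Sum>i. u (i + n))" for n
  define X where "X n = \<Delta> n + T n" for n
  define \<rho> where "\<rho> n = (w n / w (Suc n)) powr \<delta>" for n
  define s where "s n = inverse (w (Suc n)) - inverse (w n)" for n
  \<comment> \<open>Besides the scaled drift, \<open>k\<close> contains the change of the scaling
    factor from \<open>n\<close> to \<open>Suc n\<close>, divided by the step size so that both
    appear in the form \<open>w (Suc n) *\<^sub>R k n\<close>.\<close>
  define k where "k n = g n + ((\<rho> n - 1) / w (Suc n)) *\<^sub>R (\<Delta> n + w (Suc n) *\<^sub>R g n)" for n
  have u: "summable u" using noise by (simp add: u_def[abs_def])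
  have T0: "T \<longlonglongrightarrow> 0" unfolding T_def by (rule suminf_exist_split2[OF u])
  \<comment> \<open>The tail absorbs the current noise term, so that the recursion for
    \<open>X\<close> contains no noise at all.\<close>
  have T_Suc: "u n + T (Suc n) = T n" for n
    unfolding T_def using suminf_split_head[of "\<lambda>i. u (i + n)"] summable_iff_shift[of u n] u by simp
  have ws: "0 < w (Suc n)" for n using w by simp
  have step: "X (Suc n) = X n + w (Suc n) *\<^sub>R k n" if "1 \<le> n" for n
  proof -
    have wn: "0 < w n" using w that by simp
    have "\<Delta> (Suc n) = (1 / w (Suc n) powr \<delta>) *\<^sub>R d n + (w (Suc n) / w (Suc n) powr \<delta>) *\<^sub>R h n
        + (w (Suc n) / w (Suc n) powr \<delta>) *\<^sub>R e n"
      by (simp add: \<Delta>_def rec algebra_simps)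
    moreover have 1: "w (Suc n) / w (Suc n) powr \<delta> = w (Suc n) powr (1 - \<delta>)"
      using ws[of n] by (simp add: powr_diff)
    moreover have 2: "1 / w (Suc n) powr \<delta> = \<rho> n * (1 / w n powr \<delta>)"
      using ws[of n] wn by (simp add: \<rho>_def powr_divide)
    moreover have "w (Suc n) powr (1 - \<delta>) = w (Suc n) * \<rho> n * (1 / w n powr \<delta>)"
      using 2 unfolding 1[symmetric] by (simp add: divide_inverse)
    ultimately have "\<Delta> (Suc n) = \<rho> n *\<^sub>R \<Delta> n + (w (Suc n) * \<rho> n) *\<^sub>R g n + u n"
      by (simp only: \<Delta>_def g_def u_def scaleR_scaleR)
    then have "X (Suc n) = \<rho> n *\<^sub>R \<Delta> n + (w (Suc n) * \<rho> n) *\<^sub>R g n + T n"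
      by (simp add: X_def T_Suc[of n, symmetric] add.assoc)
    also have "\<dots> = X n + w (Suc n) *\<^sub>R k n"
    proof -
      have "w (Suc n) *\<^sub>R k n = w (Suc n) *\<^sub>R g n + (\<rho> n - 1) *\<^sub>R (\<Delta> n + w (Suc n) *\<^sub>R g n)"
        using ws[of n] by (simp add: k_def scaleR_add_right)
      then show ?thesis by (simp add: X_def algebra_simps)
    qed
    finally show ?thesis .
  qed
  \<comment> \<open>Here the regularity of the weights enters: consecutive weights have ratio
    \<open>1 + w n * s n\<close> with \<open>s\<close> tending to zero, hence the rescaling error
    per step is of smaller order than the weight.\<close>
  have sw: "w n / w (Suc n) - 1 = w n * s n" if "1 \<le> n" for n
    using w[OF that] by (simp add: s_def field_simps)
  have s0: "s \<longlonglongrightarrow> 0" using reg by (simp add: s_def[abs_def])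
  have ev1: "\<forall>\<^sub>F n in sequentially. w n < 1"
    using order_tendstoD(2)[OF w0, of 1] by simp
  have ev2: "\<forall>\<^sub>F n in sequentially. \<bar>s n\<bar> < 1"
    using order_tendstoD(2)[OF tendsto_rabs_zero[OF s0], of 1] by simp
  have rho: "\<forall>\<^sub>F n in sequentially. \<bar>\<rho> n - 1\<bar> / w (Suc n) \<le> 2 * \<bar>s n\<bar>"
    using ev1 ev2 eventually_ge_at_top[of 1]
  proof eventually_elim
    case (elim n)
    have wn: "0 < w n" using w elim by simp
    have "\<bar>\<rho> n - 1\<bar> \<le> \<bar>w n / w (Suc n) - 1\<bar>"
      unfolding \<rho>_def using wn ws[of n] \<delta> by (intro powr_near_1) auto
    also have "\<dots> = w n * \<bar>s n\<bar>" using wn by (simp only: sw[OF elim(3)] abs_mult)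
    finally have 1: "\<bar>\<rho> n - 1\<bar> \<le> w n * \<bar>s n\<bar>" .
    have "w n * \<bar>s n\<bar> \<le> 1 * 1" using elim wn by (intro mult_mono) auto
    moreover have "w n * s n \<le> w n * \<bar>s n\<bar>" using wn by simp
    ultimately have "w n * s n \<le> 1" by simp
    then have "w n / w (Suc n) \<le> 2" using sw[OF elim(3)] by linarith
    then have "w n \<le> 2 * w (Suc n)" using ws[of n] by (simp add: field_simps)
    then have "w n * \<bar>s n\<bar> \<le> 2 * w (Suc n) * \<bar>s n\<bar>" by (intro mult_right_mono) auto
    with 1 show ?case using ws[of n] by (simp add: field_simps)
  qed
  define \<eta> where "\<eta> n = 2 * \<bar>s n\<bar> * (1 + C)" for n
  have "\<eta> \<longlonglongrightarrow> 0" unfolding \<eta>_def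
    by (intro tendsto_mult_left_zero tendsto_mult_right_zero tendsto_rabs_zero s0)
  then have ev3: "\<forall>\<^sub>F n in sequentially. \<eta> n < c / 2" "\<forall>\<^sub>F n in sequentially. \<eta> n < C + 1"
    using order_tendstoD(2)[of \<eta> 0 _ "c / 2"] order_tendstoD(2)[of \<eta> 0 _ "C + 1"] c C by auto
  have w0': "(\<lambda>n. w (Suc n)) \<longlonglongrightarrow> 0" using w0 by (rule LIMSEQ_Suc)
  have "(\<lambda>n. w (Suc n) * (2 * C + 1)\<^sup>2) \<longlonglongrightarrow> 0" using w0' by (rule tendsto_mult_left_zero)
  then have ev4: "\<forall>\<^sub>F n in sequentially. w (Suc n) * (2 * C + 1)\<^sup>2 < c / 4"
    using order_tendstoD(2)[of _ 0 _ "c / 4"] c by auto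
  have ev5: "\<forall>\<^sub>F n in sequentially. w (Suc n) < 1"
    using order_tendstoD(2)[OF w0', of 1] by simp
  have "(\<lambda>n. c / 4 * w (Suc n)) \<longlonglongrightarrow> 0" using w0' by (rule tendsto_mult_right_zero)
  then have ev6: "\<forall>\<^sub>F n in sequentially. c / 4 * w (Suc n) < 1"
    by (rule order_tendstoD(2)) simp
  have "(\<lambda>n. (norm (X n))\<^sup>2) \<longlonglongrightarrow> 0"
  proof (rule recursion_tendsto_0[where \<kappa>="c / 4" and w="\<lambda>n. w (Suc n)"
        and \<tau>="\<lambda>n. (4 * (2 * C + 1)\<^sup>2 / c + c / 2) * (norm (T n))\<^sup>2"])
    show "\<forall>\<^sub>F n in sequentially. 0 \<le> w (Suc n) \<and> c / 4 * w (Suc n) \<le> 1"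
      using ev6 by eventually_elim (use ws in \<open>auto intro: less_imp_le\<close>)
    show "(\<lambda>n. (4 * (2 * C + 1)\<^sup>2 / c + c / 2) * (norm (T n))\<^sup>2) \<longlonglongrightarrow> 0"
      using tendsto_power[OF tendsto_norm_zero[OF T0], of 2] by (intro tendsto_mult_right_zero) simp
    show "\<forall>\<^sub>F n in sequentially. (norm (X (Suc n)))\<^sup>2 \<le> (1 - c / 4 * w (Suc n)) * (norm (X n))\<^sup>2
        + w (Suc n) * ((4 * (2 * C + 1)\<^sup>2 / c + c / 2) * (norm (T n))\<^sup>2)"
      using inner norm rho ev3 ev4 ev5 eventually_ge_at_top[of 1]
    proof eventually_elim
      case (elim n)
      have XT: "X n - T n = \<Delta> n" by (simp add: X_def)
      have wn: "0 < w n" using w elim by simp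
      have nD: "norm (\<Delta> n) = norm (d n) / w n powr \<delta>" by (simp add: \<Delta>_def)
      have 1: "\<Delta> n \<bullet> g n \<le> - c * (norm (\<Delta> n))\<^sup>2"
      proof -
        have "\<Delta> n \<bullet> g n = (1 / w n powr \<delta>)\<^sup>2 * (d n \<bullet> h n)"
          by (simp add: \<Delta>_def g_def power2_eq_square)
        also have "\<dots> \<le> (1 / w n powr \<delta>)\<^sup>2 * (- c * (norm (d n))\<^sup>2)"
          using elim by (intro mult_left_mono) auto
        finally show ?thesis by (simp add: nD power_divide)
      qed
      have 2: "norm (g n) \<le> C * norm (\<Delta> n)"
        using elim divide_right_mono[of "norm (h n)" "C * norm (d n)" "w n powr \<delta>"]
        by (simp add: g_def nD)
      have 3: "norm (k n - g n) \<le> \<eta> n * norm (\<Delta> n)"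
      proof -
        have "norm (\<Delta> n + w (Suc n) *\<^sub>R g n) \<le> norm (\<Delta> n) + w (Suc n) * norm (g n)"
          using norm_triangle_ineq[of "\<Delta> n" "w (Suc n) *\<^sub>R g n"] ws[of n] by simp
        also have "\<dots> \<le> norm (\<Delta> n) + 1 * (C * norm (\<Delta> n))"
          using elim ws[of n] 2 by (intro add_left_mono mult_mono) auto
        finally have 4: "norm (\<Delta> n + w (Suc n) *\<^sub>R g n) \<le> (1 + C) * norm (\<Delta> n)"
          by (simp add: algebra_simps)
        have "norm (k n - g n) = \<bar>\<rho> n - 1\<bar> / w (Suc n) * norm (\<Delta> n + w (Suc n) *\<^sub>R g n)"
          using ws[of n] by (simp add: k_def)
        also have "\<dots> \<le> 2 * \<bar>s n\<bar> * ((1 + C) * norm (\<Delta> n))"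
          using elim 4 ws[of n] by (intro mult_mono) auto
        finally show ?thesis by (simp add: \<eta>_def mult.assoc)
      qed
      have "(norm (X n + w (Suc n) *\<^sub>R k n))\<^sup>2 \<le> (1 - c / 4 * w (Suc n)) * (norm (X n))\<^sup>2
        + w (Suc n) * ((4 * (2 * C + 1)\<^sup>2 / c + c / 2) * (norm (T n))\<^sup>2)"
        by (rule perturbed_contraction_step[where g="g n" and \<eta>="\<eta> n"])
           (use c C ws[of n] elim 1 2 3 XT in auto)
      then show ?case using step elim by simp
    qed
  qed (use c div in auto)
  then have "X \<longlonglongrightarrow> 0" by (simp add: tendsto_norm_zero_iff)
  from tendsto_diff[OF this T0] have "\<Delta> \<longlonglongrightarrow> 0" by (simp add: X_def)
  then show ?thesis using tendsto_norm_zero by (force simp: \<Delta>_def)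
qed


section \<open>Martingale differences from i.i.d. data\<close>

text \<open>\<open>F n\<close> is a state computed from the first \<open>n\<close> observations. The
  next observation is independent of it and has law \<open>\<mu>\<close>, so subtracting the
  \<open>\<mu>\<close>-mean leaves a bounded martingale difference. \<open>F_restrict\<close>
  mediates between total data sequences and points of the product space, which carry information on
  \<open>{1..n}\<close> only.\<close>

lemma (in prob_space) iid_martingale_series:
  fixes N :: "'y measure" and S :: "'s measure" and Y :: "nat \<Rightarrow> 'a \<Rightarrow> 'y"
    and F :: "nat \<Rightarrow> (nat \<Rightarrow> 'y) \<Rightarrow> 's" and \<psi> :: "'s \<Rightarrow> 'y \<Rightarrow> real" and C :: real
  notes One_nat_def [simp del]
  assumes indep: "indep_vars (\<lambda>_. N) Y {1..}"
    and ident: "\<And>i. 1 \<le> i \<Longrightarrow> distr M N (Y i) = \<mu>"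
    and F: "\<And>n. F n \<in> measurable (Pi\<^sub>M {1..n} (\<lambda>_. N)) S"
    and F_restrict: "\<And>n y. F n (restrict y {1..n}) = F n y"
    and \<psi>: "case_prod \<psi> \<in> borel_measurable (S \<Otimes>\<^sub>M N)"
    and bound: "\<And>n y z. y \<in> space (Pi\<^sub>M {1..n} (\<lambda>_. N)) \<Longrightarrow> z \<in> space N \<Longrightarrow> \<bar>\<psi> (F n y) z\<bar> \<le> C"
    and a: "summable (\<lambda>n. (a n)\<^sup>2)"
  shows "AE \<omega> in M. summable (\<lambda>n. a n *
    (\<psi> (F n (\<lambda>i. Y i \<omega>)) (Y (Suc n) \<omega>) - (\<integral>z. \<psi> (F n (\<lambda>i. Y i \<omega>)) z \<partial>\<mu>)))"
proof -
  have rv: "Y i \<in> measurable M N" if "1 \<le> i" for i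
    using indep that by (auto simp: indep_vars_def)
  have sets_\<mu> [measurable_cong]: "sets \<mu> = sets N" using sets_distr[of M N "Y 1"] unfolding ident[OF order_refl] .
  have space_\<mu>: "space \<mu> = space N" using sets_\<mu> by (rule sets_eq_imp_space_eq)
  interpret \<mu>: prob_space \<mu> using prob_space_distr[OF rv[OF order_refl]] unfolding ident[OF order_refl] .
  interpret P: product_sigma_finite "\<lambda>_::nat. \<mu>" by standard
  have sets_P: "sets (Pi\<^sub>M I (\<lambda>_. \<mu>)) = sets (Pi\<^sub>M I (\<lambda>_. N))" for I :: "nat set"
    by (intro sets_PiM_cong refl sets_\<mu>)
  have space_P: "space (Pi\<^sub>M I (\<lambda>_. \<mu>)) = space (Pi\<^sub>M I (\<lambda>_. N))" for I :: "nat set"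
    using sets_P by (rule sets_eq_imp_space_eq)
  have F_le: "F n \<in> measurable (Pi\<^sub>M {1..k} (\<lambda>_. N)) S" if "n \<le> k" for n k
  proof -
    have "(\<lambda>y. F n (restrict y {1..n})) \<in> measurable (Pi\<^sub>M {1..k} (\<lambda>_. N)) S"
      by (rule measurable_compose[OF measurable_restrict_subset F]) (use that in auto)
    then show ?thesis by (simp only: F_restrict)
  qed
  define \<phi> where "\<phi> n y = \<psi> (F n y) (y (Suc n)) - (\<integral>z. \<psi> (F n y) z \<partial>\<mu>)" for n y
  have mean_meas: "(\<lambda>s. \<integral>z. \<psi> s z \<partial>\<mu>) \<in> borel_measurable S"
  proof (rule \<mu>.borel_measurable_lebesgue_integral)
    show "case_prod \<psi> \<in> borel_measurable (S \<Otimes>\<^sub>M \<mu>)"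
      unfolding measurable_cong_sets[OF sets_pair_measure_cong[OF refl sets_\<mu>] refl] by (fact \<psi>)
  qed
  have \<phi>_meas: "\<phi> n \<in> borel_measurable (Pi\<^sub>M {1..k} (\<lambda>_. N))" if "Suc n \<le> k" for n k
  proof -
    have [measurable]: "F n \<in> measurable (Pi\<^sub>M {1..k} (\<lambda>_. N)) S" using F_le that by simp
    have 1: "(\<lambda>y. y (Suc n)) \<in> measurable (Pi\<^sub>M {1..k} (\<lambda>_. N)) N"
      by (rule measurable_component_singleton) (use that in auto)
    have "(\<lambda>y. case_prod \<psi> (F n y, y (Suc n))) \<in> borel_measurable (Pi\<^sub>M {1..k} (\<lambda>_. N))"
      by (rule measurable_compose[OF measurable_Pair \<psi>]) (use 1 in measurable)
    then have [measurable]: "(\<lambda>y. \<psi> (F n y) (y (Suc n))) \<in> borel_measurable (Pi\<^sub>M {1..k} (\<lambda>_. N))"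
      by simp
    have [measurable]: "(\<lambda>y. \<integral>z. \<psi> (F n y) z \<partial>\<mu>) \<in> borel_measurable (Pi\<^sub>M {1..k} (\<lambda>_. N))"
      by (rule measurable_compose[OF _ mean_meas]) measurable
    show ?thesis unfolding \<phi>_def by measurable
  qed
  have \<phi>_restrict: "\<phi> n (restrict y {1..k}) = \<phi> n y" if "Suc n \<le> k" for n k y
  proof -
    have "F n (restrict y {1..k}) = F n (restrict (restrict y {1..k}) {1..n})"
      by (simp only: F_restrict)
    also have "restrict (restrict y {1..k}) {1..n} = restrict y {1..n}"
      using that by (auto simp: fun_eq_iff restrict_def)
    finally have "F n (restrict y {1..k}) = F n y" by (simp only: F_restrict)
    then show ?thesis using that by (simp add: \<phi>_def)
  qed
  have mean_le: "\<bar>\<integral>z. \<psi> (F n y) z \<partial>\<mu>\<bar> \<le> C" if "y \<in> space (Pi\<^sub>M {1..n} (\<lambda>_. N))" for n y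
  proof -
    have C0: "0 \<le> C" using bound[OF that] \<mu>.not_empty space_\<mu> by fastforce
    have "norm (\<integral>z. \<psi> (F n y) z \<partial>\<mu>) \<le> (\<integral>z. norm (\<psi> (F n y) z) \<partial>\<mu>)"
      by (rule integral_norm_bound)
    also have "\<dots> \<le> (\<integral>z. C \<partial>\<mu>)"
      by (rule integral_mono') (use bound[OF that] C0 space_\<mu> in auto)
    finally show ?thesis by (simp add: \<mu>.prob_space)
  qed
  have in_space: "restrict y {1..n} \<in> space (Pi\<^sub>M {1..n} (\<lambda>_. N))"
    if "\<And>i. 1 \<le> i \<Longrightarrow> i \<le> n \<Longrightarrow> y i \<in> space N" for y n
    using that by (auto simp: space_PiM)
  have \<phi>_le: "\<bar>\<phi> n y\<bar> \<le> 2 * C" if "\<And>i. 1 \<le> i \<Longrightarrow> i \<le> Suc n \<Longrightarrow> y i \<in> space N" for n y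
  proof -
    have "restrict y {1..n} \<in> space (Pi\<^sub>M {1..n} (\<lambda>_. N))" "y (Suc n) \<in> space N"
      using that by (auto intro!: in_space)
    from bound[OF this] mean_le[OF this(1)] show ?thesis by (auto simp: \<phi>_def F_restrict)
  qed
  have law: "(\<integral>\<omega>. G (\<lambda>i\<in>{1..k}. Y i \<omega>) \<partial>M) = (\<integral>y. G y \<partial>Pi\<^sub>M {1..k} (\<lambda>_. \<mu>))"
    if G: "G \<in> borel_measurable (Pi\<^sub>M {1..k} (\<lambda>_. N))" and "1 \<le> k" for G :: "_ \<Rightarrow> real" and k
  proof -
    have "indep_vars (\<lambda>_. N) Y {1..k}" by (rule indep_vars_subset[OF indep]) auto
    then have "distr M (Pi\<^sub>M {1..k} (\<lambda>_. N)) (\<lambda>\<omega>. \<lambda>i\<in>{1..k}. Y i \<omega>) = Pi\<^sub>M {1..k} (\<lambda>i. distr M N (Y i))"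
      using that rv by (subst (asm) indep_vars_iff_distr_eq_PiM') auto
    also have "\<dots> = Pi\<^sub>M {1..k} (\<lambda>_. \<mu>)" by (rule PiM_cong) (auto simp: ident)
    finally have d: "distr M (Pi\<^sub>M {1..k} (\<lambda>_. N)) (\<lambda>\<omega>. \<lambda>i\<in>{1..k}. Y i \<omega>) = Pi\<^sub>M {1..k} (\<lambda>_. \<mu>)" .
    show ?thesis unfolding d[symmetric]
      by (subst integral_distr) (use G rv in \<open>auto intro!: measurable_restrict\<close>)
  qed
  define D where "D n \<omega> = \<phi> n (\<lambda>i. Y i \<omega>)" for n \<omega>
  have Y_space: "Y i \<omega> \<in> space N" if "1 \<le> i" "\<omega> \<in> space M" for i \<omega>
    using measurable_space[OF rv] that by blast
  have D_restrict: "D n \<omega> = \<phi> n (\<lambda>i\<in>{1..k}. Y i \<omega>)" if "Suc n \<le> k" for n k \<omega>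
    using \<phi>_restrict[OF that, of "\<lambda>i. Y i \<omega>"] by (simp add: D_def restrict_def)
  interpret D: bounded_martingale_differences M D "2 * C"
  proof
    fix n
    have 1: "(\<lambda>\<omega>. \<lambda>i\<in>{1..Suc n}. Y i \<omega>) \<in> measurable M (Pi\<^sub>M {1..Suc n} (\<lambda>_. N))"
      using rv by (intro measurable_restrict) auto
    have "D n = (\<lambda>\<omega>. \<phi> n (\<lambda>i\<in>{1..Suc n}. Y i \<omega>))" by (rule ext, rule D_restrict) simp
    then show "D n \<in> borel_measurable M"
      using measurable_compose[OF 1 \<phi>_meas[of n "Suc n"]] by simp
  next
    fix n \<omega> assume "\<omega> \<in> space M"
    then have Y_in: "Y i \<omega> \<in> space N" if "1 \<le> i" for i using Y_space that by blast
    show "\<bar>D n \<omega>\<bar> \<le> 2 * C" unfolding D_def by (rule \<phi>_le) (rule Y_in)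
  next
    fix n b and g :: "(nat \<Rightarrow> real) \<Rightarrow> real"
    assume g [measurable]: "g \<in> borel_measurable (Pi\<^sub>M {..<n} (\<lambda>_. borel))" and gb: "\<And>x. \<bar>g x\<bar> \<le> b"
    \<comment> \<open>Rewriting the test function in terms of the observations turns the whole
      integrand into a function of the first \<open>Suc n\<close> coordinates, to which the product
      law applies.\<close>
    define \<zeta> where "\<zeta> y = g (\<lambda>i\<in>{..<n}. \<phi> i y)" for y
    have \<zeta>_meas: "\<zeta> \<in> borel_measurable (Pi\<^sub>M {1..k} (\<lambda>_. N))" if "n \<le> k" for k
      unfolding \<zeta>_def
      by (rule measurable_compose[OF measurable_restrict g], rule \<phi>_meas) (use that in auto)
    have \<zeta>_restrict: "\<zeta> (restrict y {1..k}) = \<zeta> y" if "n \<le> k" for k y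
      unfolding \<zeta>_def by (rule arg_cong[where f=g], rule restrict_ext, rule \<phi>_restrict) (use that in auto)
    define G where "G y = \<zeta> y * \<phi> n y" for y
    have Gm: "G \<in> borel_measurable (Pi\<^sub>M {1..Suc n} (\<lambda>_. N))"
      unfolding G_def by (rule borel_measurable_times[OF \<zeta>_meas \<phi>_meas]) auto
    have ins: "insert (Suc n) {1..n} = {1..Suc n}" by auto
    have G_int: "integrable (Pi\<^sub>M (insert (Suc n) {1..n}) (\<lambda>_. \<mu>)) G"
    proof -
      interpret Q: prob_space "Pi\<^sub>M {1..Suc n} (\<lambda>_. \<mu>)" by (rule prob_space_PiM) unfold_locales
      have b0: "0 \<le> b" using gb abs_ge_zero order_trans by blast
      show ?thesis unfolding ins
      proof (rule Q.integrable_const_bound[where B="b * (2 * C)"])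
        show "AE y in Pi\<^sub>M {1..Suc n} (\<lambda>_. \<mu>). norm (G y) \<le> b * (2 * C)"
        proof (rule AE_I2)
          fix y assume "y \<in> space (Pi\<^sub>M {1..Suc n} (\<lambda>_. \<mu>))"
          then have "\<bar>\<phi> n y\<bar> \<le> 2 * C" by (intro \<phi>_le) (auto simp: space_PiM space_\<mu> PiE_iff)
          then show "norm (G y) \<le> b * (2 * C)"
            using gb b0 by (auto simp: G_def \<zeta>_def abs_mult intro!: mult_mono)
        qed
        show "G \<in> borel_measurable (Pi\<^sub>M {1..Suc n} (\<lambda>_. \<mu>))"
          using Gm by (simp cong: measurable_cong_sets add: sets_P)
      qed
    qed
    have "(\<integral>\<omega>. g (\<lambda>i\<in>{..<n}. D i \<omega>) * D n \<omega> \<partial>M) = (\<integral>\<omega>. G (\<lambda>i\<in>{1..Suc n}. Y i \<omega>) \<partial>M)"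
    proof (rule Bochner_Integration.integral_cong[OF refl])
      fix \<omega>
      have "(\<lambda>i\<in>{..<n}. D i \<omega>) = (\<lambda>i\<in>{..<n}. \<phi> i (\<lambda>i\<in>{1..Suc n}. Y i \<omega>))"
        by (rule restrict_ext) (rule D_restrict, auto)
      then show "g (\<lambda>i\<in>{..<n}. D i \<omega>) * D n \<omega> = G (\<lambda>i\<in>{1..Suc n}. Y i \<omega>)"
        by (simp add: G_def \<zeta>_def D_restrict[of n "Suc n"])
    qed
    also have "\<dots> = (\<integral>y. G y \<partial>Pi\<^sub>M (insert (Suc n) {1..n}) (\<lambda>_. \<mu>))"
      unfolding ins by (rule law[OF Gm]) simp
    \<comment> \<open>Fubini with the newest coordinate innermost: the past factor and the state are
      constant there, and the centred increment has mean zero.\<close>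
    also have "\<dots> = (\<integral>y. (\<integral>z. G (y(Suc n := z)) \<partial>\<mu>) \<partial>Pi\<^sub>M {1..n} (\<lambda>_. \<mu>))"
      by (rule P.product_integral_insert) (use G_int in auto)
    also have "\<dots> = (\<integral>y. 0 \<partial>Pi\<^sub>M {1..n} (\<lambda>_. \<mu>))"
    proof (rule Bochner_Integration.integral_cong[OF refl])
      fix y assume y: "y \<in> space (Pi\<^sub>M {1..n} (\<lambda>_. \<mu>))"
      have r: "restrict (y(Suc n := z)) {1..n} = restrict y {1..n}" for z
        by (rule restrict_ext) auto
      have z: "\<zeta> (y(Suc n := z)) = \<zeta> y" for z
        using \<zeta>_restrict[of n "y(Suc n := z)"] \<zeta>_restrict[of n y] r by simp
      have f: "F n (y(Suc n := z)) = F n y" for z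
        using F_restrict[of n "y(Suc n := z)"] F_restrict[of n y] r by simp
      have yN: "y \<in> space (Pi\<^sub>M {1..n} (\<lambda>_. N))" using y by (simp add: space_P)
      have Fy: "F n y \<in> space S" using measurable_space[OF F yN] .
      have [measurable]: "\<psi> (F n y) \<in> borel_measurable \<mu>"
        using measurable_compose[OF measurable_Pair1'[OF Fy] \<psi>]
        by (simp cong: measurable_cong_sets add: sets_\<mu>)
      have "integrable \<mu> (\<psi> (F n y))"
        by (rule \<mu>.integrable_const_bound[where B=C]) (use bound[OF yN] space_\<mu> in auto)
      then show "(\<integral>z. G (y(Suc n := z)) \<partial>\<mu>) = 0"
        by (simp add: G_def \<phi>_def z f \<mu>.prob_space)
    qed
    finally show "(\<integral>\<omega>. g (\<lambda>i\<in>{..<n}. D i \<omega>) * D n \<omega> \<partial>M) = 0" by simp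
  qed
  show ?thesis using D.AE_summable[OF a] by (simp add: D_def \<phi>_def)
qed


section \<open>Mixtures near an interior optimum\<close>

lemma simplex_densities_le_1:
  assumes "f \<in> simplex_densities" shows "f u \<le> 1"
proof -
  have "f u \<le> (\<Sum>u\<in>UNIV. f u)" using assms by (intro member_le_sum) (auto simp: simplex_densities_def)
  then show ?thesis using assms by (simp add: simplex_densities_def)
qed

lemma mixture_diff: "mixture p (\<lambda>u. f u - g u) y = mixture p f y - mixture p g y"
  by (simp add: mixture_def algebra_simps sum_subtractf)

lemma mixture_nonneg: "(\<And>u. 0 \<le> p u y) \<Longrightarrow> (\<And>u. 0 \<le> f u) \<Longrightarrow> 0 \<le> mixture p f y"
  unfolding mixture_def by (intro sum_nonneg mult_nonneg_nonneg) auto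

lemma mixture_pos: "(\<And>u. 0 < p u y) \<Longrightarrow> (\<And>u. 0 < f u) \<Longrightarrow> 0 < mixture p f y"
  unfolding mixture_def by (intro sum_pos mult_pos_pos) auto

text \<open>The numerator is one of the nonnegative summands of the denominator. Where the mixture
  vanishes the quotient is 0 by the convention for division, so the bounds hold at every point and
  not just almost everywhere.\<close>

lemma posterior_bounds:
  assumes "\<And>u. 0 \<le> p u y" "\<And>u. 0 \<le> f u"
  shows "0 \<le> p u y * f u / mixture p f y" "p u y * f u / mixture p f y \<le> 1"
proof -
  have "p u y * f u \<le> mixture p f y"
    unfolding mixture_def using assms by (intro member_le_sum) auto
  then show "p u y * f u / mixture p f y \<le> 1" using mixture_nonneg[of p y f] assms
    by (cases "mixture p f y = 0") (simp_all add: divide_le_eq_1)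
  show "0 \<le> p u y * f u / mixture p f y"
    using mixture_nonneg[of p y f] assms by (intro divide_nonneg_nonneg) auto
qed

text \<open>Passing to square roots \<open>a\<close>, \<open>b\<close> and using
  \<open>ln x \<le> x - 1\<close> bounds each entropy term, corrected by \<open>f u - q u\<close>,
  from below by the Hellinger term \<open>(a - b)\<^sup>2\<close>; then
  \<open>a\<^sup>2 - b\<^sup>2\<close> factors with \<open>a + b \<le> 2\<close>. The corrections
  sum to zero.\<close>

lemma kullback_divergence_ge:
  fixes q f :: "'u::finite \<Rightarrow> real"
  assumes q: "q \<in> simplex_densities" "\<And>u. 0 < q u" and f: "f \<in> simplex_densities" "\<And>u. 0 < f u"
  shows "(\<Sum>u\<in>UNIV. (f u - q u)\<^sup>2) \<le> 4 * (\<Sum>u\<in>UNIV. q u * ln (q u / f u))"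
proof -
  have "(f u - q u)\<^sup>2 \<le> 4 * (q u * ln (q u / f u) + (f u - q u))" for u
  proof -
    define a b where "a = sqrt (f u)" and "b = sqrt (q u)"
    have ab: "0 < a" "0 < b" "f u = a\<^sup>2" "q u = b\<^sup>2"
      using q f by (auto simp: a_def b_def less_imp_le)
    have "a\<^sup>2 \<le> 1" "b\<^sup>2 \<le> 1" using simplex_densities_le_1 q(1) f(1) ab by metis+
    then have ab1: "a \<le> 1" "b \<le> 1" using ab by (auto simp: power_le_one_iff)
    have "ln (a / b) \<le> a / b - 1" using ab by (intro ln_le_minus_one) auto
    then have "b\<^sup>2 * (2 * (1 - a / b)) \<le> b\<^sup>2 * (- 2 * ln (a / b))" by (intro mult_left_mono) auto
    also have "- 2 * ln (a / b) = ln (q u / f u)"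
      using ab by (simp add: ln_div ln_realpow)
    also have "b\<^sup>2 * (2 * (1 - a / b)) = 2 * b\<^sup>2 - 2 * (a * b)"
      using ab by (simp add: power2_eq_square field_simps)
    finally have "(a - b)\<^sup>2 \<le> q u * ln (q u / f u) + (f u - q u)"
      unfolding ab(4)[symmetric] using ab(3,4) by (simp add: power2_eq_square algebra_simps)
    moreover have "(f u - q u)\<^sup>2 = (a + b)\<^sup>2 * (a - b)\<^sup>2"
      by (simp add: ab power2_eq_square algebra_simps)
    moreover have "(a + b)\<^sup>2 * (a - b)\<^sup>2 \<le> 2\<^sup>2 * (a - b)\<^sup>2"
      using ab ab1 by (intro mult_right_mono power_mono) auto
    ultimately show ?thesis by simp
  qed
  then have "(\<Sum>u\<in>UNIV. (f u - q u)\<^sup>2) \<le> (\<Sum>u\<in>UNIV. 4 * (q u * ln (q u / f u) + (f u - q u)))"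
    by (intro sum_mono) auto
  also have "\<dots> = 4 * (\<Sum>u\<in>UNIV. q u * ln (q u / f u))"
    using q f by (simp add: sum.distrib sum_subtractf simplex_densities_def flip: sum_distrib_left)
  finally show ?thesis .
qed

text \<open>Comparison with the chi-square distance, by \<open>ln x \<le> x - 1\<close> in each
  coordinate; the terms \<open>q u - f u\<close> cancel in the sum.\<close>

lemma kullback_divergence_le:
  fixes q f :: "'u::finite \<Rightarrow> real"
  assumes q: "q \<in> simplex_densities" "\<And>u. 0 < q u" and f: "f \<in> simplex_densities" "\<And>u. 0 < f u"
  shows "(\<Sum>u\<in>UNIV. q u * ln (q u / f u)) \<le> (\<Sum>u\<in>UNIV. (f u - q u)\<^sup>2 / f u)"
proof -
  have "q u * ln (q u / f u) \<le> (f u - q u)\<^sup>2 / f u + (q u - f u)" for u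
  proof -
    have "q u * ln (q u / f u) \<le> q u * (q u / f u - 1)"
      using q(2)[of u] f(2)[of u] by (intro mult_left_mono ln_le_minus_one) auto
    also have "\<dots> = (f u - q u)\<^sup>2 / f u + (q u - f u)"
      using f(2)[of u] by (simp add: power2_eq_square field_simps)
    finally show ?thesis .
  qed
  then have "(\<Sum>u\<in>UNIV. q u * ln (q u / f u)) \<le> (\<Sum>u\<in>UNIV. (f u - q u)\<^sup>2 / f u + (q u - f u))"
    by (intro sum_mono) auto
  also have "\<dots> = (\<Sum>u\<in>UNIV. (f u - q u)\<^sup>2 / f u)"
    using q f by (simp add: sum.distrib sum_subtractf simplex_densities_def)
  finally show ?thesis .
qed

text \<open>This collects what the analysis of the recursion takes from optimality:
  \<open>stationary\<close> is the first-order condition at an interior minimizer and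
  \<open>nondegenerate\<close> reflects its uniqueness. Extended-real divergences do not occur at
  this level.\<close>

locale mixture_model = prob_space \<mu> for \<mu> :: "'y measure" +
  fixes p :: "'u::finite \<Rightarrow> 'y \<Rightarrow> real" and q :: "'u \<Rightarrow> real"
  assumes p_measurable [measurable]: "\<And>u. p u \<in> borel_measurable \<mu>"
    and p_nonneg: "\<And>u y. y \<in> space \<mu> \<Longrightarrow> 0 \<le> p u y"
    and p_pos: "\<And>u. AE y in \<mu>. 0 < p u y"
    and q_simplex: "q \<in> simplex_densities"
    and q_pos: "\<And>u. 0 < q u"
    and stationary: "\<And>u. (\<integral>y. p u y / mixture p q y \<partial>\<mu>) = 1"
    and nondegenerate: "\<And>v. (\<Sum>u\<in>UNIV. v u) = 0 \<Longrightarrow> AE y in \<mu>. mixture p v y = 0 \<Longrightarrow> v = (\<lambda>_. 0)"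
begin

definition B :: real where "B = Max (range (\<lambda>u. 1 / q u))"

definition ratio :: "('u \<Rightarrow> real) \<Rightarrow> 'y \<Rightarrow> real" where
  "ratio v y = mixture p v y / mixture p q y"

definition Q :: "('u \<Rightarrow> real) \<Rightarrow> real" where "Q v = (\<integral>y. (ratio v y)\<^sup>2 \<partial>\<mu>)"

definition drift :: "('u \<Rightarrow> real) \<Rightarrow> 'u \<Rightarrow> real" where
  "drift f u = (\<integral>y. p u y * f u / mixture p f y \<partial>\<mu>) - f u"

definition V :: "('u \<Rightarrow> real) \<Rightarrow> real" where "V f = (\<Sum>u\<in>UNIV. q u * ln (q u / f u))"

lemma inverse_q_le_B: "1 / q u \<le> B" unfolding B_def by (rule Max_ge) auto

lemma q_le_1: "q u \<le> 1" by (rule simplex_densities_le_1[OF q_simplex])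

lemma sum_q: "(\<Sum>u\<in>UNIV. q u) = 1" using q_simplex by (simp add: simplex_densities_def)

lemma B_ge_1: "1 \<le> B"
proof -
  have "1 \<le> 1 / q undefined" using q_pos[of undefined] q_le_1[of undefined] by simp
  then show ?thesis using inverse_q_le_B order_trans by blast
qed

lemma one_le_Bq: "1 \<le> B * q u"
  using inverse_q_le_B[of u] q_pos[of u] by (simp add: field_simps)

lemma measurable_mixture [measurable]: "mixture p v \<in> borel_measurable \<mu>"
  unfolding mixture_def[abs_def] by measurable

lemma measurable_ratio [measurable]: "ratio v \<in> borel_measurable \<mu>"
  unfolding ratio_def[abs_def] by measurable

lemma component_ratio_bounds:
  assumes "y \<in> space \<mu>"
  shows "0 \<le> p u y / mixture p q y" "p u y / mixture p q y \<le> B"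
proof -
  have m: "0 \<le> mixture p q y" using p_nonneg[OF assms] q_pos by (intro mixture_nonneg) (auto simp: less_imp_le)
  then show "0 \<le> p u y / mixture p q y" using p_nonneg[OF assms] by simp
  have "p u y \<le> B * mixture p q y"
  proof -
    have "p u y * 1 \<le> p u y * (B * q u)"
      using p_nonneg[OF assms] one_le_Bq by (intro mult_left_mono) auto
    also have "\<dots> = B * (p u y * q u)" by simp
    also have "p u y * q u \<le> mixture p q y"
      unfolding mixture_def using p_nonneg[OF assms] q_pos by (intro member_le_sum) (auto simp: less_imp_le)
    finally show ?thesis using B_ge_1 by (simp add: mult_left_mono)
  qed
  then show "p u y / mixture p q y \<le> B"
    using m B_ge_1 by (cases "mixture p q y = 0") (auto simp: field_simps)
qed

lemma ratio_sum: "ratio v y = (\<Sum>u\<in>UNIV. v u * (p u y / mixture p q y))"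
  by (simp add: ratio_def mixture_def sum_divide_distrib mult.commute)

lemma abs_ratio_le:
  assumes "y \<in> space \<mu>" shows "\<bar>ratio v y\<bar> \<le> B * (\<Sum>u\<in>UNIV. \<bar>v u\<bar>)"
proof -
  have "\<bar>ratio v y\<bar> \<le> (\<Sum>u\<in>UNIV. \<bar>v u * (p u y / mixture p q y)\<bar>)"
    unfolding ratio_sum by (rule sum_abs)
  also have "\<dots> \<le> (\<Sum>u\<in>UNIV. \<bar>v u\<bar> * B)"
    unfolding abs_mult
    using component_ratio_bounds[OF assms] by (intro sum_mono mult_left_mono) (auto simp: abs_of_nonneg simp del: abs_divide)
  finally show ?thesis by (simp add: sum_distrib_left mult.commute)
qed

lemma ratio_le_B:
  assumes "y \<in> space \<mu>" "\<And>u. 0 \<le> f u" "(\<Sum>u\<in>UNIV. f u) \<le> 1"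
  shows "0 \<le> ratio f y" "ratio f y \<le> B"
proof -
  show "0 \<le> ratio f y" unfolding ratio_sum
    using component_ratio_bounds[OF assms(1)] assms(2) by (intro sum_nonneg mult_nonneg_nonneg) auto
  have "ratio f y \<le> B * (\<Sum>u\<in>UNIV. \<bar>f u\<bar>)" using abs_ratio_le[OF assms(1), of f] by simp
  also have "\<dots> \<le> B * 1" using assms B_ge_1 by (intro mult_left_mono) auto
  finally show "ratio f y \<le> B" by simp
qed

lemma integrable_bounded:
  assumes "g \<in> borel_measurable \<mu>" "\<And>y. y \<in> space \<mu> \<Longrightarrow> \<bar>g y\<bar> \<le> (c::real)"
  shows "integrable \<mu> g"
  using assms by (intro integrable_const_bound[where B=c]) auto

lemma integrable_component_ratio: "integrable \<mu> (\<lambda>y. p u y / mixture p q y)"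
  using component_ratio_bounds
  by (intro integrable_bounded[where c=B]) (auto simp: abs_of_nonneg simp del: abs_divide)

lemma integrable_ratio: "integrable \<mu> (ratio v)"
  using abs_ratio_le by (intro integrable_bounded) auto

lemma integral_ratio: "(\<integral>y. ratio v y \<partial>\<mu>) = (\<Sum>u\<in>UNIV. v u)"
  unfolding ratio_sum using integrable_component_ratio stationary
  by (simp del: times_divide_eq_right)

lemma integrable_ratio_mult: "integrable \<mu> (\<lambda>y. ratio v y * ratio v' y)"
proof (rule integrable_bounded)
  fix y assume "y \<in> space \<mu>"
  then show "\<bar>ratio v y * ratio v' y\<bar> \<le> (B * (\<Sum>u\<in>UNIV. \<bar>v u\<bar>)) * (B * (\<Sum>u\<in>UNIV. \<bar>v' u\<bar>))"
    unfolding abs_mult by (intro mult_mono abs_ratio_le mult_nonneg_nonneg sum_nonneg) (use B_ge_1 in auto)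
qed measurable

lemma integrable_ratio_sq: "integrable \<mu> (\<lambda>y. (ratio v y)\<^sup>2)"
  using integrable_ratio_mult[of v v] by (simp add: power2_eq_square)

section \<open>Positive definiteness of the quadratic form\<close>

lemma Q_nonneg: "0 \<le> Q v" unfolding Q_def by simp

lemma AE_pos: "AE y in \<mu>. y \<in> space \<mu> \<and> (\<forall>u. 0 < p u y)"
proof -
  have "AE y in \<mu>. \<forall>u\<in>UNIV. 0 < p u y" by (rule AE_finite_allI) (auto simp: p_pos)
  with AE_space show ?thesis by eventually_elim auto
qed

lemma Q_zero_imp:
  assumes "(\<Sum>u\<in>UNIV. v u) = 0" "Q v = 0" shows "v = (\<lambda>_. 0)"
proof (rule nondegenerate[OF assms(1)])
  have "AE y in \<mu>. (ratio v y)\<^sup>2 = 0"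
    using assms(2) integral_nonneg_eq_0_iff_AE[OF integrable_ratio_sq[of v]] by (simp add: Q_def)
  with AE_pos show "AE y in \<mu>. mixture p v y = 0"
  proof eventually_elim
    case (elim y)
    have "0 < mixture p q y" using elim q_pos by (intro mixture_pos) auto
    then show ?case using elim by (simp add: ratio_def)
  qed
qed

lemma ratio_scale: "ratio (\<lambda>u. c * v u) y = c * ratio v y"
  by (simp add: ratio_sum sum_distrib_left mult.assoc)

lemma Q_scale: "Q (\<lambda>u. c * v u) = c\<^sup>2 * Q v"
  by (simp add: Q_def ratio_scale power_mult_distrib)

text \<open>Displaying \<open>Q\<close> as a polynomial in the coordinates with constant
  coefficients makes its continuity immediate.\<close>

lemma Q_expand:
  "Q v = (\<Sum>i\<in>UNIV. \<Sum>j\<in>UNIV. v i * v j * (\<integral>y. (p i y / mixture p q y) * (p j y / mixture p q y) \<partial>\<mu>))"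
proof -
  have int: "integrable \<mu> (\<lambda>y. (p i y / mixture p q y) * (p j y / mixture p q y))" for i j
  proof (rule integrable_bounded)
    fix y assume "y \<in> space \<mu>"
    then show "\<bar>(p i y / mixture p q y) * (p j y / mixture p q y)\<bar> \<le> B * B"
      unfolding abs_mult using component_ratio_bounds B_ge_1
      by (intro mult_mono) (auto simp: abs_of_nonneg simp del: abs_divide)
  qed measurable
  have "(ratio v y)\<^sup>2 = (\<Sum>i\<in>UNIV. \<Sum>j\<in>UNIV. v i * v j * ((p i y / mixture p q y) * (p j y / mixture p q y)))" for y
    unfolding ratio_sum power2_eq_square sum_product by (intro sum.cong) (auto simp: ac_simps)
  then show ?thesis unfolding Q_def using int
    by (simp del: times_divide_eq_left times_divide_eq_right)
qed

text \<open>On the unit sphere of the hyperplane of sum-zero vectors the continuous form attains its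
  minimum, which is positive by nondegeneracy; homogeneity extends the bound to all such
  vectors.\<close>

lemma Q_coercive: "\<exists>c>0. \<forall>v. (\<Sum>u\<in>UNIV. v u) = 0 \<longrightarrow> c * (\<Sum>u\<in>UNIV. (v u)\<^sup>2) \<le> Q v"
proof -
  define K where "K = sphere (0 :: real ^ 'u) 1 \<inter> {z. (\<Sum>u\<in>UNIV. z $ u) = 0}"
  have "closed {z :: real ^ 'u. (\<Sum>u\<in>UNIV. z $ u) = 0}"
    by (intro closed_Collect_eq continuous_intros)
  then have K: "compact K" unfolding K_def by (intro compact_Int_closed compact_sphere)
  have cont: "continuous_on K (\<lambda>z. Q (($) z))"
    unfolding Q_expand by (intro continuous_intros)
  have "\<exists>c>0. \<forall>z\<in>K. c \<le> Q (($) z)"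
  \<comment> \<open>The sphere is empty exactly when there is a single parameter; the zero vector is
    then the only one of sum zero, and any constant works.\<close>
  proof (cases "K = {}")
    case True then show ?thesis by (intro exI[of _ 1]) auto
  next
    case False
    from continuous_attains_inf[OF K False cont] obtain z where
      z: "z \<in> K" "\<And>z'. z' \<in> K \<Longrightarrow> Q (($) z) \<le> Q (($) z')" by auto
    have "Q (($) z) \<noteq> 0"
    proof
      assume "Q (($) z) = 0"
      with z(1) have "($) z = (\<lambda>_. 0)" by (intro Q_zero_imp) (auto simp: K_def)
      then have "z = 0" by (simp add: vec_eq_iff fun_eq_iff)
      then show False using z(1) by (simp add: K_def)
    qed
    then show ?thesis using z Q_nonneg[of "($) z"] by (intro exI[of _ "Q (($) z)"]) auto
  qed
  then obtain c where c: "0 < c" "\<And>z. z \<in> K \<Longrightarrow> c \<le> Q (($) z)" by blast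
  have "c * (\<Sum>u\<in>UNIV. (v u)\<^sup>2) \<le> Q v" if v: "(\<Sum>u\<in>UNIV. v u) = 0" for v
  proof -
    define z :: "real ^ 'u" where "z = (\<chi> u. v u)"
    have n2: "(norm z)\<^sup>2 = (\<Sum>u\<in>UNIV. (v u)\<^sup>2)"
      by (simp add: norm_vec_def L2_set_def sum_nonneg z_def)
    show ?thesis
    proof (cases "z = 0")
      case True
      then show ?thesis using n2 Q_nonneg[of v] by simp
    next
      case False
      define t where "t = 1 / norm z"
      have t: "0 < t" "t * norm z = 1" using False by (auto simp: t_def)
      have zK: "t *\<^sub>R z \<in> K"
        using t v by (auto simp: K_def z_def sum_distrib_left[symmetric])
      have "($) (t *\<^sub>R z) = (\<lambda>u. t * v u)" by (auto simp: z_def)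
      then have le: "c \<le> t\<^sup>2 * Q v" using c(2)[OF zK] by (simp add: Q_scale)
      have "c * (norm z)\<^sup>2 \<le> t\<^sup>2 * Q v * (norm z)\<^sup>2" using le by (rule mult_right_mono) simp
      also have "\<dots> = (t * norm z)\<^sup>2 * Q v" by (simp add: power_mult_distrib)
      finally show ?thesis using n2 t by simp
    qed
  qed
  then show ?thesis using c(1) by blast
qed

section \<open>The mean drift of the recursion and its linearisation\<close>

lemma ratio_q:
  assumes "\<forall>u. 0 < p u y" shows "ratio q y = 1"
proof -
  have "0 < mixture p q y" using assms q_pos by (intro mixture_pos) auto
  then show ?thesis by (simp add: ratio_def)
qed

lemma ratio_diff: "ratio (\<lambda>u. f u - g u) y = ratio f y - ratio g y"
  by (simp add: ratio_def mixture_diff diff_divide_distrib)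

text \<open>Stationarity allows \<open>f u\<close> to be written as the integral of
  \<open>f u * (p u y / mixture p q y)\<close>. The difference of the two integrands then factors
  and exhibits the dependence on \<open>f - q\<close>.\<close>

lemma drift_eq:
  assumes f: "f \<in> simplex_densities" "\<And>u. 0 < f u"
  shows "drift f u = - (\<integral>y. (p u y * f u / mixture p f y) * ratio (\<lambda>u. f u - q u) y \<partial>\<mu>)"
proof -
  have f0: "\<And>u. 0 \<le> f u" using f(2) less_imp_le by blast
  have i1: "integrable \<mu> (\<lambda>y. p u y * f u / mixture p f y)"
    using posterior_bounds[of p _ f u] p_nonneg f0
    by (intro integrable_bounded[where c=1]) (auto simp: abs_of_nonneg simp del: abs_divide)
  have i2: "integrable \<mu> (\<lambda>y. f u * (p u y / mixture p q y))"
    by (rule integrable_mult_right) (rule integrable_component_ratio)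
  have "drift f u = (\<integral>y. p u y * f u / mixture p f y \<partial>\<mu>) - (\<integral>y. f u * (p u y / mixture p q y) \<partial>\<mu>)"
    by (simp add: drift_def stationary del: times_divide_eq_right)
  also have "\<dots> = (\<integral>y. p u y * f u / mixture p f y - f u * (p u y / mixture p q y) \<partial>\<mu>)"
    using i1 i2 by simp
  also have "\<dots> = (\<integral>y. - ((p u y * f u / mixture p f y) * ratio (\<lambda>u. f u - q u) y) \<partial>\<mu>)"
  proof (rule integral_cong_AE)
    show "AE y in \<mu>. p u y * f u / mixture p f y - f u * (p u y / mixture p q y) =
      - ((p u y * f u / mixture p f y) * ratio (\<lambda>u. f u - q u) y)"
      using AE_pos
    proof eventually_elim
      case (elim y)
      have "0 < mixture p f y" "0 < mixture p q y" using elim f q_pos by (auto intro: mixture_pos)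
      then show ?case by (simp add: ratio_def mixture_diff field_simps)
    qed
  qed measurable
  finally show ?thesis by simp
qed

lemma integrable_posterior_ratio:
  assumes f: "\<And>u. 0 \<le> f u"
  shows "integrable \<mu> (\<lambda>y. (p u y * f u / mixture p f y) * ratio v y)"
proof (rule integrable_bounded)
  fix y assume y: "y \<in> space \<mu>"
  show "\<bar>(p u y * f u / mixture p f y) * ratio v y\<bar> \<le> 1 * (B * (\<Sum>u\<in>UNIV. \<bar>v u\<bar>))"
    unfolding abs_mult using posterior_bounds[of p y f u] p_nonneg[OF y] f
    by (intro mult_mono abs_ratio_le y) auto
qed measurable

lemma abs_drift_le:
  assumes f: "f \<in> simplex_densities" "\<And>u. 0 < f u"
  shows "\<bar>drift f u\<bar> \<le> B * (\<Sum>u\<in>UNIV. \<bar>f u - q u\<bar>)"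
proof -
  let ?g = "\<lambda>y. (p u y * f u / mixture p f y) * ratio (\<lambda>u. f u - q u) y"
  have f0: "\<And>u. 0 \<le> f u" using f(2) less_imp_le by blast
  have le: "\<bar>?g y\<bar> \<le> B * (\<Sum>u\<in>UNIV. \<bar>f u - q u\<bar>)" if y: "y \<in> space \<mu>" for y
  proof -
    have "\<bar>?g y\<bar> \<le> 1 * (B * (\<Sum>u\<in>UNIV. \<bar>f u - q u\<bar>))"
      unfolding abs_mult using posterior_bounds[of p y f u] p_nonneg[OF y] f0
      by (intro mult_mono abs_ratio_le y) auto
    then show ?thesis by simp
  qed
  have "norm (\<integral>y. ?g y \<partial>\<mu>) \<le> (\<integral>y. norm (?g y) \<partial>\<mu>)" by (rule integral_norm_bound)
  also have "\<dots> \<le> (\<integral>y. B * (\<Sum>u\<in>UNIV. \<bar>f u - q u\<bar>) \<partial>\<mu>)"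
  proof (rule integral_mono)
    show "integrable \<mu> (\<lambda>y. norm (?g y))"
      by (rule integrable_norm[OF integrable_posterior_ratio[OF f0]])
    show "norm (?g y) \<le> B * (\<Sum>u\<in>UNIV. \<bar>f u - q u\<bar>)" if "y \<in> space \<mu>" for y
      using le[OF that] by (simp only: real_norm_def)
  qed simp
  also have "\<dots> = B * (\<Sum>u\<in>UNIV. \<bar>f u - q u\<bar>)" by (simp add: prob_space)
  finally show ?thesis unfolding drift_eq[OF f] by simp
qed

text \<open>With weights \<open>1 / q u\<close> the integrand becomes
  \<open>(r + e) * r / x\<close>, where \<open>r\<close> is the ratio of \<open>d\<close>,
  \<open>x = 1 + r\<close>, and \<open>e\<close> is quadratic in \<open>d\<close>. The part
  \<open>r\<^sup>2 / x\<close> is at least \<open>r\<^sup>2 / B\<close> and yields the quadratic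
  form. The rest is cubic: \<open>e\<close> contributes \<open>B\<^sup>2\<close> times the squared
  norm, \<open>r\<close> contributes \<open>B\<close> times the absolute sum, and
  \<open>x \<ge> 1 / 2\<close> the factor 2.\<close>

lemma drift_inner_le:
  fixes f
  defines "d \<equiv> \<lambda>u. f u - q u"
  assumes f: "f \<in> simplex_densities" "\<And>u. 0 < f u" and near: "B * (\<Sum>u\<in>UNIV. \<bar>d u\<bar>) \<le> 1 / 2"
  shows "(\<Sum>u\<in>UNIV. d u * drift f u / q u) \<le>
    - Q d / B + 2 * B ^ 3 * (\<Sum>u\<in>UNIV. \<bar>d u\<bar>) * (\<Sum>u\<in>UNIV. (d u)\<^sup>2)"
proof -
  define L S where "L = (\<Sum>u\<in>UNIV. \<bar>d u\<bar>)" and "S = (\<Sum>u\<in>UNIV. (d u)\<^sup>2)"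
  have f0: "\<And>u. 0 \<le> f u" using f(2) less_imp_le by blast
  have L0: "0 \<le> L" and S0: "0 \<le> S" unfolding L_def S_def by (auto intro: sum_nonneg)
  define G where "G y = (\<Sum>u\<in>UNIV. d u / q u * ((p u y * f u / mixture p f y) * ratio d y))" for y
  have Gi: "integrable \<mu> G" unfolding G_def
    by (intro Bochner_Integration.integrable_sum integrable_mult_right integrable_posterior_ratio[OF f0])
  have "(\<Sum>u\<in>UNIV. d u * drift f u / q u) =
     - (\<Sum>u\<in>UNIV. d u / q u * (\<integral>y. (p u y * f u / mixture p f y) * ratio d y \<partial>\<mu>))"
    unfolding drift_eq[OF f] d_def[symmetric] by (simp add: sum_negf)
  also have "\<dots> = - (\<integral>y. G y \<partial>\<mu>)"
    unfolding G_def integral_mult_right_zero[symmetric]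
    by (subst Bochner_Integration.integral_sum)
       (auto intro!: integrable_mult_right integrable_posterior_ratio[OF f0] simp del: times_divide_eq_left times_divide_eq_right)
  finally have eq: "(\<Sum>u\<in>UNIV. d u * drift f u / q u) = - (\<integral>y. G y \<partial>\<mu>)" .
  have "(\<integral>y. (ratio d y)\<^sup>2 / B - 2 * B ^ 3 * L * S \<partial>\<mu>) \<le> (\<integral>y. G y \<partial>\<mu>)"
  proof (rule integral_mono_AE)
    show "AE y in \<mu>. (ratio d y)\<^sup>2 / B - 2 * B ^ 3 * L * S \<le> G y"
      using AE_pos
    proof eventually_elim
      case (elim y)
      have m: "0 < mixture p f y" "0 < mixture p q y" using elim f q_pos by (auto intro: mixture_pos)
      define r e where "r = ratio d y" and "e = (\<Sum>u\<in>UNIV. (d u)\<^sup>2 / q u * (p u y / mixture p q y))"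
      define x where "x = ratio f y"
      have x: "x = 1 + r" unfolding x_def r_def d_def ratio_diff using ratio_q elim by simp
      have rB: "\<bar>r\<bar> \<le> B * L" unfolding r_def L_def using abs_ratio_le elim by blast
      have x_half: "1 / 2 \<le> x" using rB near x by (simp add: L_def)
      have xB: "x \<le> B" unfolding x_def using elim f f0 by (intro ratio_le_B) (auto simp: simplex_densities_def)
      have e0: "0 \<le> e" unfolding e_def
      proof (rule sum_nonneg)
        fix u show "0 \<le> (d u)\<^sup>2 / q u * (p u y / mixture p q y)"
          using q_pos[of u] component_ratio_bounds(1)[of y u] elim by (intro mult_nonneg_nonneg) simp_all
      qed
      have eS: "e \<le> B\<^sup>2 * S"
      proof -
        have "e \<le> (\<Sum>u\<in>UNIV. ((d u)\<^sup>2 * B) * B)"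
          unfolding e_def
        proof (rule sum_mono, rule mult_mono)
          fix u
          show "(d u)\<^sup>2 / q u \<le> (d u)\<^sup>2 * B"
            using mult_left_mono[OF inverse_q_le_B[of u], of "(d u)\<^sup>2"] by simp
          show "p u y / mixture p q y \<le> B" "0 \<le> p u y / mixture p q y" "0 \<le> (d u)\<^sup>2 * B"
            using component_ratio_bounds elim B_ge_1 by auto
        qed
        then show ?thesis by (simp add: S_def power2_eq_square sum_distrib_left mult.assoc mult.commute mult.left_commute)
      qed
      have "G y = (\<Sum>u\<in>UNIV. (d u + (d u)\<^sup>2 / q u) * (p u y / mixture p q y)) / x * r"
        unfolding sum_divide_distrib sum_distrib_right G_def r_def[symmetric]
      proof (rule sum.cong[OF refl])
        fix u
        have "f u = q u + d u" by (simp add: d_def)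
        then have "d u / q u * f u = d u + (d u)\<^sup>2 / q u"
          using q_pos[of u] by (simp add: power2_eq_square field_simps)
        moreover have "p u y / mixture p f y = (p u y / mixture p q y) / x"
          using m by (simp add: x_def ratio_def)
        moreover have "d u / q u * (p u y * f u / mixture p f y * r) =
            (d u / q u * f u) * (p u y / mixture p f y) * r" by simp
        ultimately show "d u / q u * (p u y * f u / mixture p f y * r) =
          (d u + (d u)\<^sup>2 / q u) * (p u y / mixture p q y) / x * r"
          by (simp only: times_divide_eq_right)
      qed
      also have "(\<Sum>u\<in>UNIV. (d u + (d u)\<^sup>2 / q u) * (p u y / mixture p q y)) = r + e"
        by (simp only: r_def e_def ratio_sum distrib_right sum.distrib)
      finally have G: "G y = r\<^sup>2 / x + e * r / x" by (simp add: power2_eq_square add_divide_distrib algebra_simps)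
      have "r\<^sup>2 / B \<le> r\<^sup>2 / x" using xB x_half by (intro divide_left_mono mult_pos_pos) auto
      moreover have "\<bar>e * r / x\<bar> \<le> (B\<^sup>2 * S) * (B * L) / (1 / 2)"
      proof -
        have "\<bar>e * r\<bar> \<le> (B\<^sup>2 * S) * (B * L)"
          unfolding abs_mult using e0 eS rB S0 by (intro mult_mono) auto
        then have "\<bar>e * r\<bar> / x \<le> (B\<^sup>2 * S) * (B * L) / (1 / 2)"
          using x_half by (intro frac_le) auto
        then show ?thesis using x_half by (simp add: abs_divide)
      qed
      moreover have "(B\<^sup>2 * S) * (B * L) / (1 / 2) = 2 * B ^ 3 * L * S"
        by (simp add: power2_eq_square power3_eq_cube)
      ultimately show ?case unfolding G r_def[symmetric] by linarith
    qed
  qed (use Gi integrable_ratio_sq in auto)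
  moreover have "(\<integral>y. (ratio d y)\<^sup>2 / B - 2 * B ^ 3 * L * S \<partial>\<mu>) = Q d / B - 2 * B ^ 3 * L * S"
    using integrable_ratio_sq by (simp add: Q_def prob_space)
  ultimately show ?thesis unfolding eq L_def[symmetric] S_def[symmetric] by simp
qed

lemma drift_contracts:
  "\<exists>c>0. \<exists>r>0. \<forall>f. f \<in> simplex_densities \<longrightarrow> (\<forall>u. 0 < f u) \<longrightarrow> (\<Sum>u\<in>UNIV. \<bar>f u - q u\<bar>) < r \<longrightarrow>
    (\<Sum>u\<in>UNIV. (f u - q u) * drift f u / q u) \<le> - c * (\<Sum>u\<in>UNIV. (f u - q u)\<^sup>2)"
proof -
  obtain c where c: "0 < c" "\<And>v. (\<Sum>u\<in>UNIV. v u) = 0 \<Longrightarrow> c * (\<Sum>u\<in>UNIV. (v u)\<^sup>2) \<le> Q v"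
    using Q_coercive by blast
  have B: "0 < B" using B_ge_1 by simp
  \<comment> \<open>The first bound gives \<open>B * L \<le> 1 / 2\<close>, as the linearisation
    requires; the second makes the cubic remainder at most half of the quadratic term, since
    \<open>2 * B ^ 3 * (c / (4 * B ^ 4)) = c / (2 * B)\<close>.\<close>
  define r where "r = min (1 / (2 * B)) (c / (4 * B ^ 4))"
  have r: "0 < r" using c B by (simp add: r_def)
  have main: "(\<Sum>u\<in>UNIV. (f u - q u) * drift f u / q u) \<le> - (c / (2 * B)) * (\<Sum>u\<in>UNIV. (f u - q u)\<^sup>2)"
    if f: "f \<in> simplex_densities" "\<And>u. 0 < f u" and L: "(\<Sum>u\<in>UNIV. \<bar>f u - q u\<bar>) < r" for f
  proof -
    define L S where "L = (\<Sum>u\<in>UNIV. \<bar>f u - q u\<bar>)" and "S = (\<Sum>u\<in>UNIV. (f u - q u)\<^sup>2)"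
    have S0: "0 \<le> S" unfolding S_def by (auto intro: sum_nonneg)
    have "B * L \<le> B * (1 / (2 * B))"
      using that B by (intro mult_left_mono) (auto simp: L_def r_def)
    then have near: "B * L \<le> 1 / 2" using B by simp
    have s0: "(\<Sum>u\<in>UNIV. f u - q u) = 0"
      using f(1) sum_q by (simp add: sum_subtractf simplex_densities_def)
    have Q: "c * S / B \<le> Q (\<lambda>u. f u - q u) / B"
      using c(2)[OF s0] B by (intro divide_right_mono) (auto simp: S_def)
    have "2 * B ^ 3 * L \<le> 2 * B ^ 3 * (c / (4 * B ^ 4))"
      using L B by (intro mult_left_mono) (auto simp: L_def r_def)
    also have "\<dots> = c / (2 * B)" using B by (simp add: field_simps power3_eq_cube power4_eq_xxxx)
    finally have "2 * B ^ 3 * L * S \<le> c / (2 * B) * S" using S0 by (intro mult_right_mono)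
    moreover have "(\<Sum>u\<in>UNIV. (f u - q u) * drift f u / q u) \<le> - Q (\<lambda>u. f u - q u) / B + 2 * B ^ 3 * L * S"
      unfolding L_def S_def by (rule drift_inner_le[OF f]) (use near in \<open>simp add: L_def\<close>)
    moreover have "c * S / B = 2 * (c / (2 * B) * S)" by simp
    ultimately show ?thesis using Q unfolding S_def[symmetric] by linarith
  qed
  show ?thesis using main r c B by (intro exI[of _ "c / (2 * B)"] conjI exI[of _ r]) auto
qed

section \<open>Relative entropy as a Lyapunov function\<close>

lemma V_small:
  assumes e: "0 < e"
  shows "\<exists>\<eta>>0. \<forall>f. f \<in> simplex_densities \<longrightarrow> (\<forall>u. 0 < f u) \<longrightarrow> Q (\<lambda>u. f u - q u) < \<eta> \<longrightarrow> V f < e"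
proof -
  obtain c where c: "0 < c" "\<And>v. (\<Sum>u\<in>UNIV. v u) = 0 \<Longrightarrow> c * (\<Sum>u\<in>UNIV. (v u)\<^sup>2) \<le> Q v"
    using Q_coercive by blast
  have B: "0 < B" using B_ge_1 by simp
  \<comment> \<open>By coercivity \<open>Q < \<eta>\<close> bounds the squared distance by both
    entries of the minimum. The first keeps every coordinate of \<open>f\<close> above
    \<open>1 / (2 * B)\<close>, half the lower bound for \<open>q\<close>; the second then makes the
    chi-square bound smaller than \<open>e\<close>.\<close>
  define \<eta> where "\<eta> = c * min ((1 / (2 * B))\<^sup>2) (e / (2 * B))"
  have "V f < e" if f: "f \<in> simplex_densities" "\<And>u. 0 < f u" and Q: "Q (\<lambda>u. f u - q u) < \<eta>" for f
  proof -
    define S where "S = (\<Sum>u\<in>UNIV. (f u - q u)\<^sup>2)"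
    have s0: "(\<Sum>u\<in>UNIV. f u - q u) = 0"
      using f(1) sum_q by (simp add: sum_subtractf simplex_densities_def)
    have "c * S < c * min ((1 / (2 * B))\<^sup>2) (e / (2 * B))"
      using c(2)[OF s0] Q unfolding S_def \<eta>_def by linarith
    then have S: "S < (1 / (2 * B))\<^sup>2" "S < e / (2 * B)" using c(1) by auto
    have inv: "1 / f u \<le> 2 * B" for u
    proof -
      have "(f u - q u)\<^sup>2 \<le> S" unfolding S_def by (rule member_le_sum) auto
      then have "\<bar>f u - q u\<bar>\<^sup>2 \<le> (1 / (2 * B))\<^sup>2" using S by simp
      then have "\<bar>f u - q u\<bar> \<le> 1 / (2 * B)" using B by (simp add: abs_le_square_iff[symmetric])
      moreover have "1 / B \<le> q u" using one_le_Bq[of u] B by (simp add: field_simps)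
      ultimately have "1 / (2 * B) \<le> f u" using B by (simp add: field_simps abs_le_iff)
      then show ?thesis using f(2)[of u] B by (simp add: field_simps)
    qed
    have "V f \<le> (\<Sum>u\<in>UNIV. (f u - q u)\<^sup>2 / f u)"
      unfolding V_def by (rule kullback_divergence_le[OF q_simplex q_pos f])
    also have "\<dots> \<le> (\<Sum>u\<in>UNIV. (f u - q u)\<^sup>2 * (2 * B))"
    proof (rule sum_mono)
      fix u show "(f u - q u)\<^sup>2 / f u \<le> (f u - q u)\<^sup>2 * (2 * B)"
        using mult_left_mono[OF inv[of u], of "(f u - q u)\<^sup>2"] by simp
    qed
    also have "\<dots> = S * (2 * B)" by (simp add: S_def sum_distrib_right)
    also have "\<dots> < e" using S(2) B by (simp add: field_simps)
    finally show ?thesis .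
  qed
  moreover have "0 < \<eta>" using c B e by (simp add: \<eta>_def)
  ultimately show ?thesis by blast
qed

text \<open>Near the boundary of the simplex \<open>p u y / mixture p f y\<close> is unbounded, possibly without second
  moments; truncating it at \<open>3 * B\<close> keeps the lower bound for the mean decrease of \<open>V\<close>, since
  \<open>min (1 / x) 3 \<ge> 2 - x + (x - 1)\<^sup>2 / B\<close> for \<open>0 < x \<le> B\<close>.\<close>

lemma truncated_gain:
  assumes f: "f \<in> simplex_densities" "\<And>u. 0 < f u" and y: "y \<in> space \<mu>" "\<And>u. 0 < p u y"
  shows "1 - ratio f y + (ratio f y - 1)\<^sup>2 / B \<le> (\<Sum>u\<in>UNIV. q u * (min (p u y / mixture p f y) (3 * B) - 1))"
proof -
  define x where "x = ratio f y"
  define t where "t u = p u y / mixture p q y" for u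
  have m: "0 < mixture p f y" "0 < mixture p q y" using y f q_pos by (auto intro: mixture_pos)
  have x0: "0 < x" using m by (simp add: x_def ratio_def)
  have xB: "x \<le> B" unfolding x_def using y(1) f
    by (intro ratio_le_B) (auto simp: simplex_densities_def)
  have r: "p u y / mixture p f y = t u / x" for u using m by (simp add: t_def x_def ratio_def)
  have t0: "0 \<le> t u" "t u \<le> B" for u using component_ratio_bounds[OF y(1)] by (auto simp: t_def)
  have qt: "(\<Sum>u\<in>UNIV. q u * t u) = 1"
    using ratio_q[of y] y(2) by (simp add: ratio_sum t_def)
  \<comment> \<open>For \<open>x \<ge> 1 / 3\<close> the cap \<open>3 * B\<close> is never reached,
    because \<open>t u \<le> B\<close>. Below that, every truncated term is still at least
    \<open>3 * t u\<close>, and these average to 3.\<close>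
  have "2 - x + (x - 1)\<^sup>2 / B \<le> (\<Sum>u\<in>UNIV. q u * min (t u / x) (3 * B))"
  proof (cases "1 / 3 \<le> x")
    case True
    have "min (t u / x) (3 * B) = t u / x" for u
    proof -
      have "t u / x \<le> B / (1 / 3)" using True t0[of u] B_ge_1 by (intro frac_le) auto
      then show ?thesis by simp
    qed
    then have "(\<Sum>u\<in>UNIV. q u * min (t u / x) (3 * B)) = (\<Sum>u\<in>UNIV. q u * t u) / x"
      by (simp add: sum_divide_distrib)
    \<comment> \<open>The identity \<open>1 / x = 2 - x + (x - 1)\<^sup>2 / x\<close> is the source
      of the gain expression; replacing the last denominator by \<open>B\<close> makes its mean a
      multiple of the quadratic form.\<close>
    also have "\<dots> = 2 - x + (x - 1)\<^sup>2 / x" unfolding qt using x0 by (simp add: power2_eq_square field_simps)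
    finally show ?thesis using divide_left_mono[OF xB, of "(x - 1)\<^sup>2"] x0 B_ge_1 by simp
  next
    case False
    have "3 * t u \<le> min (t u / x) (3 * B)" for u
    proof -
      have "3 * t u = t u / (1 / 3)" by simp
      also have "\<dots> \<le> t u / x" using False x0 t0[of u] by (intro divide_left_mono) auto
      finally show ?thesis using t0[of u] by simp
    qed
    then have "(\<Sum>u\<in>UNIV. q u * (3 * t u)) \<le> (\<Sum>u\<in>UNIV. q u * min (t u / x) (3 * B))"
      using q_pos by (intro sum_mono mult_left_mono) (auto simp: less_imp_le)
    moreover have "(\<Sum>u\<in>UNIV. q u * (3 * t u)) = 3"
      using qt by (simp add: sum_distrib_left[symmetric] mult.left_commute[of _ 3])
    moreover have "(x - 1)\<^sup>2 / B \<le> 1"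
    proof -
      have "\<bar>x - 1\<bar> \<le> 1" using False x0 by auto
      then have "(x - 1)\<^sup>2 \<le> 1" by (simp add: abs_square_le_1)
      then show ?thesis using B_ge_1 by (simp add: divide_le_eq)
    qed
    ultimately show ?thesis using x0 by simp
  qed
  then show ?thesis unfolding r x_def[symmetric] by (simp add: right_diff_distrib sum_subtractf sum_q)
qed

text \<open>The update multiplies \<open>f u\<close> by \<open>1 + w * (r u - 1)\<close>. Truncating
  \<open>r u\<close> only lowers the logarithm of this factor, which enters \<open>V\<close> with a
  minus sign, and afterwards the expansion of \<open>ln\<close> to second order is legitimate. Its
  error \<open>2 * (w * (3 * B))\<^sup>2\<close> is the term with 18.\<close>

lemma V_step:
  assumes f: "f \<in> simplex_densities" "\<And>u. 0 < f u" and y: "y \<in> space \<mu>" "\<And>u. 0 < p u y"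
    and w: "0 < w" "w < 1" "w * (3 * B) \<le> 1 / 2"
  shows "V (\<lambda>u. (1 - w) * f u + w * (p u y * f u / mixture p f y)) \<le>
    V f - w * (1 - ratio f y + (ratio f y - 1)\<^sup>2 / B) + 18 * B\<^sup>2 * w\<^sup>2"
proof -
  define r where "r u = p u y / mixture p f y" for u
  define s where "s u = min (r u) (3 * B) - 1" for u
  have m: "0 < mixture p f y" using y f by (auto intro: mixture_pos)
  have r0: "0 < r u" for u using m y by (simp add: r_def)
  have f': "(1 - w) * f u + w * (p u y * f u / mixture p f y) = f u * (1 + w * (r u - 1))" for u
    by (simp add: r_def algebra_simps)
  have s: "\<bar>s u\<bar> \<le> 3 * B" for u using r0[of u] B_ge_1 by (auto simp: s_def)
  have sr: "s u \<le> r u - 1" for u by (simp add: s_def)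
  have step: "q u * ln (q u / (f u * (1 + w * (r u - 1)))) \<le>
      q u * ln (q u / f u) - w * (q u * s u) + q u * (18 * B\<^sup>2 * w\<^sup>2)" for u
  proof -
    have ws: "\<bar>w * s u\<bar> \<le> w * (3 * B)" using s[of u] w by (simp add: abs_mult)
    then have ws2: "\<bar>w * s u\<bar> \<le> 1 / 2" using w by linarith
    have "\<bar>ln (1 + w * s u) - w * s u\<bar> \<le> 2 * (w * s u)\<^sup>2"
      by (rule abs_ln_one_plus_x_minus_x_bound[OF ws2])
    moreover have "(w * s u)\<^sup>2 \<le> (w * (3 * B))\<^sup>2"
      using power_mono[OF ws, of 2] by (simp only: power2_abs)
    moreover have "2 * (w * (3 * B))\<^sup>2 = 18 * B\<^sup>2 * w\<^sup>2" by (simp add: power2_eq_square)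
    ultimately have 1: "w * s u - 18 * B\<^sup>2 * w\<^sup>2 \<le> ln (1 + w * s u)" by linarith
    have "1 + w * s u \<le> 1 + w * (r u - 1)" using sr w by simp
    moreover have "0 < 1 + w * s u" using ws2 by auto
    ultimately have 2: "ln (1 + w * s u) \<le> ln (1 + w * (r u - 1))" and pos: "0 < 1 + w * (r u - 1)"
      by auto
    have "ln (q u / (f u * (1 + w * (r u - 1)))) = ln (q u / f u) - ln (1 + w * (r u - 1))"
      using q_pos[of u] f(2)[of u] pos by (simp add: ln_div ln_mult)
    also have "\<dots> \<le> ln (q u / f u) - w * s u + 18 * B\<^sup>2 * w\<^sup>2" using 1 2 by simp
    finally have "q u * ln (q u / (f u * (1 + w * (r u - 1)))) \<le> q u * (ln (q u / f u) - w * s u + 18 * B\<^sup>2 * w\<^sup>2)"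
      using q_pos[of u] by (intro mult_left_mono) auto
    then show ?thesis by (simp add: algebra_simps)
  qed
  have "V (\<lambda>u. (1 - w) * f u + w * (p u y * f u / mixture p f y)) \<le>
      (\<Sum>u\<in>UNIV. q u * ln (q u / f u) - w * (q u * s u) + q u * (18 * B\<^sup>2 * w\<^sup>2))"
    unfolding V_def f' by (rule sum_mono) (rule step)
  also have "\<dots> = V f - w * (\<Sum>u\<in>UNIV. q u * s u) + 18 * B\<^sup>2 * w\<^sup>2"
    by (simp add: V_def sum.distrib sum_subtractf sum_distrib_left sum_q flip: sum_distrib_right)
  also have "\<dots> \<le> V f - w * (1 - ratio f y + (ratio f y - 1)\<^sup>2 / B) + 18 * B\<^sup>2 * w\<^sup>2"
    using mult_left_mono[OF truncated_gain[OF f y], of w] w by (simp add: s_def r_def)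
  finally show ?thesis .
qed

lemma integral_gain:
  assumes f: "f \<in> simplex_densities"
  shows "(\<integral>y. 1 - ratio f y + (ratio f y - 1)\<^sup>2 / B \<partial>\<mu>) = Q (\<lambda>u. f u - q u) / B"
proof -
  have "(\<integral>y. 1 - ratio f y + (ratio f y - 1)\<^sup>2 / B \<partial>\<mu>) =
      (\<integral>y. 1 - ratio f y + (ratio (\<lambda>u. f u - q u) y)\<^sup>2 / B \<partial>\<mu>)"
  proof (rule integral_cong_AE)
    show "AE y in \<mu>. 1 - ratio f y + (ratio f y - 1)\<^sup>2 / B = 1 - ratio f y + (ratio (\<lambda>u. f u - q u) y)\<^sup>2 / B"
      using AE_pos by eventually_elim (simp add: ratio_diff ratio_q)
  qed measurable
  also have "\<dots> = 1 - (\<integral>y. ratio f y \<partial>\<mu>) + Q (\<lambda>u. f u - q u) / B"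
    using integrable_ratio integrable_ratio_sq by (simp add: Q_def prob_space)
  finally show ?thesis using f by (simp add: integral_ratio simplex_densities_def)
qed

text \<open>The linear term of the logarithm is \<open>- ratio d\<close>, whose integral is minus
  the sum of \<open>d\<close> and hence zero by stationarity. Only the quadratic error
  remains.\<close>

lemma log_ratio_le:
  fixes f
  defines "L \<equiv> \<Sum>u\<in>UNIV. \<bar>f u - q u\<bar>"
  assumes f: "f \<in> simplex_densities" "\<And>u. 0 < f u" and near: "B * L \<le> 1 / 2"
  shows "(\<integral>y. ln (mixture p q y / mixture p f y) \<partial>\<mu>) \<le> 2 * B\<^sup>2 * L\<^sup>2"
proof -
  define d where "d = (\<lambda>u. f u - q u)"
  have pt: "AE y in \<mu>. \<bar>ln (mixture p q y / mixture p f y)\<bar> \<le> 1 \<and>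
     ln (mixture p q y / mixture p f y) \<le> - ratio d y + 2 * B\<^sup>2 * L\<^sup>2"
    using AE_pos
  proof eventually_elim
    case (elim y)
    have m: "0 < mixture p f y" "0 < mixture p q y" using elim f q_pos by (auto intro: mixture_pos)
    define r where "r = ratio d y"
    have x: "mixture p f y / mixture p q y = 1 + r"
      using ratio_q elim unfolding r_def d_def ratio_diff by (simp add: ratio_def)
    have rB: "\<bar>r\<bar> \<le> B * L" unfolding r_def L_def d_def using abs_ratio_le elim by blast
    have r2: "\<bar>r\<bar> \<le> 1 / 2" using rB near by linarith
    have "mixture p q y / mixture p f y = 1 / (1 + r)" unfolding x[symmetric] by simp
    then have ln: "ln (mixture p q y / mixture p f y) = - ln (1 + r)"
      using r2 by (simp add: ln_div)
    have b: "\<bar>ln (1 + r) - r\<bar> \<le> 2 * r\<^sup>2" by (rule abs_ln_one_plus_x_minus_x_bound[OF r2])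
    have "r\<^sup>2 \<le> (B * L)\<^sup>2" using power_mono[OF rB, of 2] by simp
    moreover have "r\<^sup>2 \<le> (1 / 2)\<^sup>2" using power_mono[OF r2, of 2] by simp
    moreover have "2 * (B * L)\<^sup>2 = 2 * B\<^sup>2 * L\<^sup>2" by (simp add: power_mult_distrib)
    moreover have "2 * (1 / 2 :: real)\<^sup>2 = 1 / 2" by (simp add: power2_eq_square)
    ultimately show ?case unfolding ln r_def[symmetric] using b r2 by linarith
  qed
  have "(\<integral>y. ln (mixture p q y / mixture p f y) \<partial>\<mu>) \<le> (\<integral>y. - ratio d y + 2 * B\<^sup>2 * L\<^sup>2 \<partial>\<mu>)"
  proof (rule integral_mono_AE)
    show "integrable \<mu> (\<lambda>y. ln (mixture p q y / mixture p f y))"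
      by (rule integrable_const_bound[where B=1]) (use pt in auto)
    show "AE y in \<mu>. ln (mixture p q y / mixture p f y) \<le> - ratio d y + 2 * B\<^sup>2 * L\<^sup>2"
      using pt by eventually_elim simp
  qed (use integrable_ratio in auto)
  also have "\<dots> = - (\<integral>y. ratio d y \<partial>\<mu>) + 2 * B\<^sup>2 * L\<^sup>2"
    using integrable_ratio by (simp add: prob_space)
  also have "(\<integral>y. ratio d y \<partial>\<mu>) = 0"
    unfolding integral_ratio d_def using f sum_q by (simp add: sum_subtractf simplex_densities_def)
  finally show ?thesis by simp
qed

end


section \<open>Predictive recursion\<close>

lemma pred_recursion_Suc_apply:
  "pred_recursion p f0 w y (Suc n) u = (1 - w (Suc n)) * pred_recursion p f0 w y n u +
    w (Suc n) * (p u (y (Suc n)) * pred_recursion p f0 w y n u / mixture p (pred_recursion p f0 w y n) (y (Suc n)))"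
  by (simp add: Let_def)

declare pred_recursion.simps(2) [simp del]

lemma pred_recursion_cong:
  assumes "\<And>i. 1 \<le> i \<Longrightarrow> i \<le> n \<Longrightarrow> y i = y' i"
  shows "pred_recursion p f0 w y n = pred_recursion p f0 w y' n"
  using assms
proof (induction n)
  case (Suc n)
  then have "pred_recursion p f0 w y n = pred_recursion p f0 w y' n" "y (Suc n) = y' (Suc n)" by auto
  then show ?case by (intro ext) (simp only: pred_recursion_Suc_apply)
qed simp

text \<open>An observation with vanishing mixture makes all posterior quotients 0, so mass may be
  lost and the sum is only bounded by 1. In return nothing is assumed about null sets, and the
  bounds on the martingale differences become valid at every data sequence.\<close>

lemma pred_recursion_subprob:
  assumes f0: "f0 \<in> simplex_densities" and w: "\<And>n. 1 \<le> n \<Longrightarrow> 0 < w n \<and> w n < 1"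
    and p: "\<And>u i. 1 \<le> i \<Longrightarrow> i \<le> n \<Longrightarrow> 0 \<le> p u (y i)"
  shows "(\<forall>u. 0 \<le> pred_recursion p f0 w y n u) \<and> (\<Sum>u\<in>UNIV. pred_recursion p f0 w y n u) \<le> 1"
  using p
proof (induction n)
  case 0
  then show ?case using f0 by (simp add: simplex_densities_def)
next
  case (Suc n)
  define f where "f = pred_recursion p f0 w y n"
  define v where "v = w (Suc n)"
  have v: "0 < v" "v < 1" using w[of "Suc n"] by (auto simp: v_def)
  have f: "\<And>u. 0 \<le> f u" "(\<Sum>u\<in>UNIV. f u) \<le> 1" using Suc by (auto simp: f_def)
  have pn: "\<And>u. 0 \<le> p u (y (Suc n))" using Suc.prems by auto
  have eq: "pred_recursion p f0 w y (Suc n) u = (1 - v) * f u + v * (p u (y (Suc n)) * f u / mixture p f (y (Suc n)))" for u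
    by (simp add: pred_recursion_Suc_apply f_def v_def)
  have "(\<Sum>u\<in>UNIV. p u (y (Suc n)) * f u / mixture p f (y (Suc n))) \<le> 1"
    by (simp add: sum_divide_distrib[symmetric] mixture_def[symmetric])
  then have "(1 - v) * (\<Sum>u\<in>UNIV. f u) + v * (\<Sum>u\<in>UNIV. p u (y (Suc n)) * f u / mixture p f (y (Suc n))) \<le> (1 - v) * 1 + v * 1"
    using f v by (intro add_mono mult_left_mono) auto
  moreover have "0 \<le> (1 - v) * f u + v * (p u (y (Suc n)) * f u / mixture p f (y (Suc n)))" for u
    using v f posterior_bounds(1)[of p "y (Suc n)" f u, OF pn f(1)] by (intro add_nonneg_nonneg mult_nonneg_nonneg) auto
  ultimately show ?case unfolding eq by (simp add: sum.distrib sum_distrib_left)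
qed

text \<open>Positivity has to start with \<open>f0\<close>: each update is multiplicative in
  \<open>f u\<close>, so a coordinate that is zero would remain zero.\<close>

lemma pred_recursion_simplex:
  assumes f0: "f0 \<in> simplex_densities" "\<And>u. 0 < f0 u" and w: "\<And>n. 1 \<le> n \<Longrightarrow> 0 < w n \<and> w n < 1"
    and p: "\<And>u i. 1 \<le> i \<Longrightarrow> 0 < p u (y i)"
  shows "pred_recursion p f0 w y n \<in> simplex_densities \<and> (\<forall>u. 0 < pred_recursion p f0 w y n u)"
proof (induction n)
  case 0
  then show ?case using f0 by simp
next
  case (Suc n)
  define f where "f = pred_recursion p f0 w y n"
  define v where "v = w (Suc n)"
  have v: "0 < v" "v < 1" using w[of "Suc n"] by (auto simp: v_def)
  have f: "\<And>u. 0 < f u" "(\<Sum>u\<in>UNIV. f u) = 1" using Suc by (auto simp: f_def simplex_densities_def)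
  have pn: "\<And>u. 0 < p u (y (Suc n))" using p by auto
  have m: "0 < mixture p f (y (Suc n))" using pn f by (intro mixture_pos)
  have eq: "pred_recursion p f0 w y (Suc n) u = (1 - v) * f u + v * (p u (y (Suc n)) * f u / mixture p f (y (Suc n)))" for u
    by (simp add: pred_recursion_Suc_apply f_def v_def)
  have "(\<Sum>u\<in>UNIV. p u (y (Suc n)) * f u / mixture p f (y (Suc n))) = 1"
    using m by (simp add: sum_divide_distrib[symmetric] mixture_def[symmetric])
  then have "(\<Sum>u\<in>UNIV. pred_recursion p f0 w y (Suc n) u) = 1"
    unfolding eq sum.distrib sum_distrib_left[symmetric] using f by simp
  moreover have "0 < pred_recursion p f0 w y (Suc n) u" for u
    unfolding eq using v f pn m by (intro add_pos_pos mult_pos_pos divide_pos_pos) auto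
  ultimately show ?case by (auto simp: simplex_densities_def less_imp_le)
qed

section \<open>Joint measurability in parameter and data\<close>

lemma measurable_mixture_pair:
  assumes p: "\<And>u. p u \<in> borel_measurable N"
  shows "(\<lambda>(f, y). mixture p f y) \<in> borel_measurable (Pi\<^sub>M UNIV (\<lambda>_::'u::finite. borel) \<Otimes>\<^sub>M N)"
proof -
  have [measurable]: "(\<lambda>x. p u (snd x)) \<in> borel_measurable (Pi\<^sub>M UNIV (\<lambda>_::'u. borel) \<Otimes>\<^sub>M N)" for u
    by (rule measurable_compose[OF measurable_snd p])
  show ?thesis unfolding mixture_def case_prod_beta by measurable
qed

lemma measurable_posterior_pair:
  assumes p: "\<And>u. p u \<in> borel_measurable N"
  shows "(\<lambda>(f, y). p u y * f u / mixture p f y) \<in> borel_measurable (Pi\<^sub>M UNIV (\<lambda>_::'u::finite. borel) \<Otimes>\<^sub>M N)"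
proof -
  have [measurable]: "(\<lambda>x. p u (snd x)) \<in> borel_measurable (Pi\<^sub>M UNIV (\<lambda>_::'u. borel) \<Otimes>\<^sub>M N)" for u
    by (rule measurable_compose[OF measurable_snd p])
  note [measurable] = measurable_mixture_pair[OF p, unfolded case_prod_beta]
  show ?thesis unfolding case_prod_beta by measurable
qed

lemma measurable_pred_recursion:
  fixes p :: "'u::finite \<Rightarrow> 'y \<Rightarrow> real"
  assumes p: "\<And>u. p u \<in> borel_measurable N" and "n \<le> k"
  shows "(\<lambda>y. pred_recursion p f0 w y n) \<in> measurable (Pi\<^sub>M {1..k} (\<lambda>_. N)) (Pi\<^sub>M UNIV (\<lambda>_. borel))"
  using \<open>n \<le> k\<close>
proof (induction n)
  case 0
  show ?case by (simp add: space_PiM)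
next
  case (Suc n)
  have F [measurable]: "(\<lambda>y. pred_recursion p f0 w y n) \<in> measurable (Pi\<^sub>M {1..k} (\<lambda>_. N)) (Pi\<^sub>M UNIV (\<lambda>_. borel))"
    using Suc by simp
  have Y: "(\<lambda>y. y (Suc n)) \<in> measurable (Pi\<^sub>M {1..k} (\<lambda>_. N)) N"
    by (rule measurable_component_singleton) (use Suc in auto)
  have [measurable]: "(\<lambda>y. pred_recursion p f0 w y n u) \<in> borel_measurable (Pi\<^sub>M {1..k} (\<lambda>_. N))" for u
    by (rule measurable_compose[OF F measurable_component_singleton]) simp
  have [measurable]: "(\<lambda>y. p u (y (Suc n)) * pred_recursion p f0 w y n u / mixture p (pred_recursion p f0 w y n) (y (Suc n)))
      \<in> borel_measurable (Pi\<^sub>M {1..k} (\<lambda>_. N))" for u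
    using measurable_compose[OF measurable_Pair[OF F Y] measurable_posterior_pair[where u=u, OF p]] by simp
  have "(\<lambda>y. \<lambda>u\<in>UNIV. pred_recursion p f0 w y (Suc n) u) \<in> measurable (Pi\<^sub>M {1..k} (\<lambda>_. N)) (Pi\<^sub>M UNIV (\<lambda>_. borel))"
    unfolding pred_recursion_Suc_apply by (rule measurable_restrict) measurable
  then show ?case by (simp add: restrict_def)
qed

lemma sum_abs_le_sqrt_card:
  fixes v :: "'u::finite \<Rightarrow> real"
  shows "(\<Sum>u\<in>UNIV. \<bar>v u\<bar>) \<le> real CARD('u) * sqrt (\<Sum>u\<in>UNIV. (v u)\<^sup>2)"
proof -
  have "\<bar>v u\<bar> \<le> sqrt (\<Sum>u\<in>UNIV. (v u)\<^sup>2)" for u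
  proof (rule real_le_rsqrt)
    show "\<bar>v u\<bar>\<^sup>2 \<le> (\<Sum>u\<in>UNIV. (v u)\<^sup>2)" unfolding power2_abs by (rule member_le_sum) auto
  qed
  then have "(\<Sum>u\<in>UNIV. \<bar>v u\<bar>) \<le> (\<Sum>u\<in>(UNIV::'u set). sqrt (\<Sum>u\<in>UNIV. (v u)\<^sup>2))"
    by (intro sum_mono) auto
  then show ?thesis by simp
qed

section \<open>Consistency and rate along a path, then almost surely\<close>

context mixture_model
begin

text \<open>A statement about one fixed data sequence: all randomness is confined to the hypothesis
  \<open>noise\<close>.\<close>

lemma pred_recursion_converges:
  fixes y :: "nat \<Rightarrow> 'y" and f0 w
  defines "f \<equiv> pred_recursion p f0 w y"
  assumes f0: "f0 \<in> simplex_densities" "\<And>u. 0 < f0 u" and w: "\<And>n. 1 \<le> n \<Longrightarrow> 0 < w n \<and> w n < 1"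
    and w0: "w \<longlonglongrightarrow> 0" and div: "filterlim (\<lambda>n. \<Sum>i<n. w (Suc i)) at_top sequentially"
    and w2: "summable (\<lambda>n. (w (Suc n))\<^sup>2)"
    and y: "\<And>i. 1 \<le> i \<Longrightarrow> y i \<in> space \<mu>" "\<And>i u. 1 \<le> i \<Longrightarrow> 0 < p u (y i)"
    and noise: "summable (\<lambda>n. w (Suc n) *
      ((1 - ratio (f n) (y (Suc n)) + (ratio (f n) (y (Suc n)) - 1)\<^sup>2 / B)
       - (\<integral>z. 1 - ratio (f n) z + (ratio (f n) z - 1)\<^sup>2 / B \<partial>\<mu>)))"
  shows "(\<lambda>n. \<Sum>u\<in>UNIV. \<bar>f n u - q u\<bar>) \<longlonglongrightarrow> 0"
proof -
  have f: "f n \<in> simplex_densities" "\<And>u. 0 < f n u" for n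
    using pred_recursion_simplex[where p=p and y=y and n=n, OF f0 w y(2)] by (auto simp: f_def)
  have V4: "(\<Sum>u\<in>UNIV. (f n u - q u)\<^sup>2) \<le> 4 * V (f n)" for n
    unfolding V_def by (rule kullback_divergence_ge[OF q_simplex q_pos f])
  have V0: "0 \<le> V (f n)" for n
    using V4[of n] sum_nonneg[of UNIV "\<lambda>u. (f n u - q u)\<^sup>2"] by simp
  \<comment> \<open>The perturbation consists of the absolutely summable second-order term and the
    centred gain; after centring, what is left of the gain is exactly \<open>Q / B\<close>.\<close>
  define e where "e n = 18 * B\<^sup>2 * (w (Suc n))\<^sup>2 - w (Suc n) *
      ((1 - ratio (f n) (y (Suc n)) + (ratio (f n) (y (Suc n)) - 1)\<^sup>2 / B)
       - (\<integral>z. 1 - ratio (f n) z + (ratio (f n) z - 1)\<^sup>2 / B \<partial>\<mu>))" for n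
  have e: "summable e" unfolding e_def by (intro summable_diff summable_mult w2 noise)
  have "(\<lambda>n. V (f n)) \<longlonglongrightarrow> 0"
  proof (rule lyapunov_tendsto_0[OF V0 _ _ div e, where Q="\<lambda>n. Q (\<lambda>u. f n u - q u) / B"])
    show "0 \<le> Q (\<lambda>u. f n u - q u) / B" for n using Q_nonneg B_ge_1 by simp
    show "0 \<le> w (Suc n)" for n using w[of "Suc n"] by simp
    have "(\<lambda>n. w (Suc n) * (3 * B)) \<longlonglongrightarrow> 0" using LIMSEQ_Suc[OF w0] by (rule tendsto_mult_left_zero)
    then have "\<forall>\<^sub>F n in sequentially. w (Suc n) * (3 * B) < 1 / 2" by (rule order_tendstoD(2)) simp
    then show "\<forall>\<^sub>F n in sequentially. V (f (Suc n)) \<le> V (f n) - w (Suc n) * (Q (\<lambda>u. f n u - q u) / B) + e n"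
    proof eventually_elim
      case (elim n)
      define g where "g = 1 - ratio (f n) (y (Suc n)) + (ratio (f n) (y (Suc n)) - 1)\<^sup>2 / B"
      have "f (Suc n) = (\<lambda>u. (1 - w (Suc n)) * f n u + w (Suc n) * (p u (y (Suc n)) * f n u / mixture p (f n) (y (Suc n))))"
        unfolding f_def by (rule ext) (rule pred_recursion_Suc_apply)
      moreover have "V (\<lambda>u. (1 - w (Suc n)) * f n u + w (Suc n) * (p u (y (Suc n)) * f n u / mixture p (f n) (y (Suc n))))
          \<le> V (f n) - w (Suc n) * g + 18 * B\<^sup>2 * (w (Suc n))\<^sup>2"
        unfolding g_def
      proof (rule V_step)
        show "f n \<in> simplex_densities" by (rule f)
        show "0 < f n u" for u by (rule f)
        show "y (Suc n) \<in> space \<mu>" "0 < p u (y (Suc n))" for u using y by auto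
        show "0 < w (Suc n)" "w (Suc n) < 1" using w[of "Suc n"] by auto
        show "w (Suc n) * (3 * B) \<le> 1 / 2" using elim by simp
      qed
      moreover have "e n = 18 * B\<^sup>2 * (w (Suc n))\<^sup>2 - w (Suc n) * g + w (Suc n) * (Q (\<lambda>u. f n u - q u) / B)"
      proof -
        have "e n = 18 * B\<^sup>2 * (w (Suc n))\<^sup>2 - w (Suc n) * (g - Q (\<lambda>u. f n u - q u) / B)"
          unfolding e_def g_def integral_gain[OF f(1)] by (rule refl)
        then show ?thesis by (simp only: right_diff_distrib)
      qed
      ultimately show ?case by simp
    qed
    show "\<exists>\<eta>>0. \<forall>n. Q (\<lambda>u. f n u - q u) / B < \<eta> \<longrightarrow> V (f n) < r" if r: "0 < r" for r
    proof -
      from V_small[OF r] obtain \<eta> where \<eta>: "0 < \<eta>"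
        "\<And>f. f \<in> simplex_densities \<Longrightarrow> (\<forall>u. 0 < f u) \<Longrightarrow> Q (\<lambda>u. f u - q u) < \<eta> \<Longrightarrow> V f < r" by blast
      have "V (f n) < r" if "Q (\<lambda>u. f n u - q u) / B < \<eta> / B" for n
      proof (rule \<eta>(2))
        show "f n \<in> simplex_densities" by (rule f)
        show "\<forall>u. 0 < f n u" using f(2) by blast
        show "Q (\<lambda>u. f n u - q u) < \<eta>" using that B_ge_1 by (simp add: divide_less_cancel)
      qed
      then show ?thesis using \<eta>(1) B_ge_1 by (intro exI[of _ "\<eta> / B"]) auto
    qed
  qed
  then have "(\<lambda>n. real CARD('u) * sqrt (4 * V (f n))) \<longlonglongrightarrow> real CARD('u) * sqrt (4 * 0)"
    by (intro tendsto_intros)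
  then have lim: "(\<lambda>n. real CARD('u) * sqrt (4 * V (f n))) \<longlonglongrightarrow> 0" by simp
  show ?thesis
  proof (rule tendsto_sandwich[OF _ _ tendsto_const lim])
    show "\<forall>\<^sub>F n in sequentially. 0 \<le> (\<Sum>u\<in>UNIV. \<bar>f n u - q u\<bar>)" by (auto intro: sum_nonneg)
    have "(\<Sum>u\<in>UNIV. \<bar>f n u - q u\<bar>) \<le> real CARD('u) * sqrt (4 * V (f n))" for n
    proof -
      have "(\<Sum>u\<in>UNIV. \<bar>f n u - q u\<bar>) \<le> real CARD('u) * sqrt (\<Sum>u\<in>UNIV. (f n u - q u)\<^sup>2)"
        by (rule sum_abs_le_sqrt_card)
      also have "\<dots> \<le> real CARD('u) * sqrt (4 * V (f n))"
        using V4 by (intro mult_left_mono) auto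
      finally show ?thesis .
    qed
    then show "\<forall>\<^sub>F n in sequentially. (\<Sum>u\<in>UNIV. \<bar>f n u - q u\<bar>) \<le> real CARD('u) * sqrt (4 * V (f n))" by simp
  qed
qed

text \<open>The coordinates \<open>(f u - q u) / sqrt (q u)\<close> are those in which the linearised drift is
  symmetric and negative definite.\<close>

lemma pred_recursion_path_rate:
  fixes y :: "nat \<Rightarrow> 'y" and f0 w
  defines "f \<equiv> pred_recursion p f0 w y"
  assumes f0: "f0 \<in> simplex_densities" "\<And>u. 0 < f0 u" and w: "\<And>n. 1 \<le> n \<Longrightarrow> 0 < w n \<and> w n < 1"
    and w0: "w \<longlonglongrightarrow> 0" and div: "filterlim (\<lambda>n. \<Sum>i<n. w (Suc i)) at_top sequentially"
    and reg: "(\<lambda>n. inverse (w (Suc n)) - inverse (w n)) \<longlonglongrightarrow> 0"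
    and \<delta>: "0 \<le> \<delta>" "\<delta> \<le> 1"
    and y: "\<And>i u. 1 \<le> i \<Longrightarrow> 0 < p u (y i)"
    and conv: "(\<lambda>n. \<Sum>u\<in>UNIV. \<bar>f n u - q u\<bar>) \<longlonglongrightarrow> 0"
    and noise: "\<And>u. summable (\<lambda>n. w (Suc n) powr (1 - \<delta>) *
      (p u (y (Suc n)) * f n u / mixture p (f n) (y (Suc n)) - (\<integral>z. p u z * f n u / mixture p (f n) z \<partial>\<mu>)))"
  shows "(\<lambda>n. (\<Sum>u\<in>UNIV. \<bar>f n u - q u\<bar>) / w n powr \<delta>) \<longlonglongrightarrow> 0"
proof -
  have f: "f n \<in> simplex_densities" "\<And>u. 0 < f n u" for n
    using pred_recursion_simplex[where p=p and y=y and n=n, OF f0 w y] by (auto simp: f_def)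
  define b where "b u = 1 / sqrt (q u)" for u
  define d :: "nat \<Rightarrow> real ^ 'u" where "d n = (\<chi> u. b u * (f n u - q u))" for n
  define h :: "nat \<Rightarrow> real ^ 'u" where "h n = (\<chi> u. b u * drift (f n) u)" for n
  define D where "D n u = p u (y (Suc n)) * f n u / mixture p (f n) (y (Suc n))
      - (\<integral>z. p u z * f n u / mixture p (f n) z \<partial>\<mu>)" for n u
  define e :: "nat \<Rightarrow> real ^ 'u" where "e n = (\<chi> u. b u * D n u)" for n
  define L where "L n = (\<Sum>u\<in>UNIV. \<bar>f n u - q u\<bar>)" for n
  have B: "0 < B" "1 \<le> B" using B_ge_1 by auto
  have b2: "b u * b u = 1 / q u" for u using q_pos[of u] by (simp add: b_def)
  have b: "0 < b u" "b u \<le> B" for u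
  proof -
    show "0 < b u" using q_pos[of u] by (simp add: b_def)
    have "q u * q u \<le> q u * 1" using q_le_1[of u] q_pos[of u] by (intro mult_left_mono) auto
    then have "q u \<le> sqrt (q u)" by (intro real_le_rsqrt) (simp add: power2_eq_square)
    then have "b u \<le> 1 / q u" unfolding b_def using q_pos[of u] by (intro divide_left_mono) auto
    then show "b u \<le> B" using inverse_q_le_B order_trans by blast
  qed
  have rec: "d (Suc n) = d n + w (Suc n) *\<^sub>R (h n + e n)" for n
  proof -
    have "f (Suc n) u = f n u + w (Suc n) * (drift (f n) u + D n u)" for u
      unfolding f_def pred_recursion_Suc_apply by (simp add: drift_def D_def f_def algebra_simps)
    then show ?thesis by (simp add: vec_eq_iff d_def h_def e_def algebra_simps)
  qed
  have L_le: "L n \<le> real CARD('u) * norm (d n)" for n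
  proof -
    have "\<bar>f n u - q u\<bar> \<le> norm (d n)" for u
    proof -
      have "1 \<le> b u" unfolding b_def using q_pos[of u] q_le_1[of u] by simp
      then have "1 * \<bar>f n u - q u\<bar> \<le> b u * \<bar>f n u - q u\<bar>" by (intro mult_right_mono) auto
      also have "\<dots> = \<bar>d n $ u\<bar>" using b(1)[of u] by (simp add: d_def abs_mult)
      also have "\<dots> \<le> norm (d n)" by (rule component_le_norm_cart)
      finally show ?thesis by simp
    qed
    then have "L n \<le> (\<Sum>u\<in>(UNIV::'u set). norm (d n))" unfolding L_def by (intro sum_mono) auto
    then show ?thesis by simp
  qed
  have d2: "(norm (d n))\<^sup>2 \<le> B * (\<Sum>u\<in>UNIV. (f n u - q u)\<^sup>2)" for n
  proof -
    have "(norm (d n))\<^sup>2 = (\<Sum>u\<in>UNIV. (b u * (f n u - q u))\<^sup>2)"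
      by (simp add: norm_vec_def L2_set_def sum_nonneg d_def)
    also have "\<dots> = (\<Sum>u\<in>UNIV. (f n u - q u)\<^sup>2 * (1 / q u))"
      unfolding b2[symmetric] by (simp add: power2_eq_square ac_simps)
    also have "\<dots> \<le> (\<Sum>u\<in>UNIV. (f n u - q u)\<^sup>2 * B)"
      using inverse_q_le_B by (intro sum_mono mult_left_mono) auto
    finally show ?thesis by (simp add: sum_distrib_left mult.commute)
  qed
  obtain c r where c: "0 < c" "0 < r" and contracts: "\<And>f. f \<in> simplex_densities \<Longrightarrow> (\<And>u. 0 < f u) \<Longrightarrow>
      (\<Sum>u\<in>UNIV. \<bar>f u - q u\<bar>) < r \<Longrightarrow>
      (\<Sum>u\<in>UNIV. (f u - q u) * drift f u / q u) \<le> - c * (\<Sum>u\<in>UNIV. (f u - q u)\<^sup>2)"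
    using drift_contracts by blast
  have "(\<lambda>n. norm (d n) / w n powr \<delta>) \<longlonglongrightarrow> 0"
  \<comment> \<open>In the scaled coordinates the squared norm grows by a factor of at most
    \<open>B\<close>, hence the contraction constant \<open>c / B\<close>. In \<open>C\<close>, one
    factor \<open>B\<close> bounds the scaling \<open>b u\<close> and one comes from the drift
    estimate; the two cardinalities come from summing coordinates and from comparing
    \<open>L n\<close> with \<open>norm (d n)\<close>.\<close>
  proof (rule stochastic_approximation_rate[where c="c / B" and C="real CARD('u) * (B * (B * real CARD('u)))", OF _ w0 div reg \<delta> _ _ rec])
    show "0 < w n" if "1 \<le> n" for n using w that by blast
    show "0 < c / B" using c B by simp
    show "0 \<le> real CARD('u) * (B * (B * real CARD('u)))" using B by simp
    have "\<forall>\<^sub>F n in sequentially. L n < r" unfolding L_def by (rule order_tendstoD(2)[OF conv c(2)])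
    then show "\<forall>\<^sub>F n in sequentially. d n \<bullet> h n \<le> - (c / B) * (norm (d n))\<^sup>2"
    proof eventually_elim
      case (elim n)
      have "d n \<bullet> h n = (\<Sum>u\<in>UNIV. (f n u - q u) * drift (f n) u * (b u * b u))"
        by (simp add: inner_vec_def d_def h_def ac_simps)
      also have "\<dots> = (\<Sum>u\<in>UNIV. (f n u - q u) * drift (f n) u / q u)" unfolding b2 by simp
      also have "\<dots> \<le> - c * (\<Sum>u\<in>UNIV. (f n u - q u)\<^sup>2)"
        by (rule contracts[OF f]) (use elim in \<open>simp add: L_def\<close>)
      also have "\<dots> \<le> - (c / B) * (norm (d n))\<^sup>2"
        using mult_left_mono[OF d2[of n], of "c / B"] c B by simp
      finally show ?case .
    qed
    have "norm (h n) \<le> real CARD('u) * (B * (B * real CARD('u))) * norm (d n)" for n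
    proof -
      have "norm (h n) \<le> (\<Sum>u\<in>UNIV. \<bar>h n $ u\<bar>)" by (rule norm_le_l1_cart)
      also have "\<dots> \<le> (\<Sum>u\<in>(UNIV::'u set). B * (B * L n))"
      proof (rule sum_mono)
        fix u
        have "\<bar>h n $ u\<bar> = b u * \<bar>drift (f n) u\<bar>" using b(1)[of u] by (simp add: h_def abs_mult)
        also have "\<dots> \<le> B * (B * L n)"
          unfolding L_def using abs_drift_le[OF f] b[of u] B by (intro mult_mono) auto
        finally show "\<bar>h n $ u\<bar> \<le> B * (B * L n)" .
      qed
      also have "\<dots> = real CARD('u) * (B * (B * L n))" by simp
      also have "\<dots> \<le> real CARD('u) * (B * (B * (real CARD('u) * norm (d n))))"
        using L_le B by (intro mult_left_mono) auto
      finally show ?thesis by (simp add: mult.assoc)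
    qed
    then show "\<forall>\<^sub>F n in sequentially. norm (h n) \<le> real CARD('u) * (B * (B * real CARD('u))) * norm (d n)" by simp
    \<comment> \<open>Splitting the vector series along the coordinate axes reduces its convergence
      to finitely many scalar series.\<close>
    have "(\<lambda>n. w (Suc n) powr (1 - \<delta>) *\<^sub>R e n) =
      (\<lambda>n. \<Sum>u\<in>UNIV. (w (Suc n) powr (1 - \<delta>) * D n u) *\<^sub>R (b u *\<^sub>R axis u 1))"
      by (rule ext) (simp add: vec_eq_iff e_def axis_def if_distrib sum.delta cong: if_cong)
    then show "summable (\<lambda>n. w (Suc n) powr (1 - \<delta>) *\<^sub>R e n)"
      using noise by (auto simp: D_def intro!: summable_sum summable_scaleR_left summable_mult2)
  qed
  then have lim: "(\<lambda>n. real CARD('u) * (norm (d n) / w n powr \<delta>)) \<longlonglongrightarrow> 0"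
    by (rule tendsto_mult_right_zero)
  show ?thesis
  proof (rule tendsto_sandwich[OF _ _ tendsto_const lim])
    show "\<forall>\<^sub>F n in sequentially. 0 \<le> (\<Sum>u\<in>UNIV. \<bar>f n u - q u\<bar>) / w n powr \<delta>"
      by (auto intro: sum_nonneg)
    have "L n / w n powr \<delta> \<le> real CARD('u) * (norm (d n) / w n powr \<delta>)" for n
      using divide_right_mono[OF L_le[of n], of "w n powr \<delta>"] by simp
    then show "\<forall>\<^sub>F n in sequentially. (\<Sum>u\<in>UNIV. \<bar>f n u - q u\<bar>) / w n powr \<delta> \<le> real CARD('u) * (norm (d n) / w n powr \<delta>)"
      by (simp add: L_def)
  qed
qed

theorem pred_recursion_rate:
  fixes M :: "'a measure" and N :: "'y measure" and Y :: "nat \<Rightarrow> 'a \<Rightarrow> 'y"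
  assumes M: "prob_space M"
    and indep: "prob_space.indep_vars M (\<lambda>_. N) Y {1..}"
    and ident: "\<And>i. 1 \<le> i \<Longrightarrow> distr M N (Y i) = \<mu>"
    and f0: "f0 \<in> simplex_densities" "\<And>u. 0 < f0 u"
    and w: "\<And>n. 1 \<le> n \<Longrightarrow> 0 < w n \<and> w n < 1"
    and div: "filterlim (\<lambda>n. \<Sum>i<n. w (Suc i)) at_top sequentially"
    and \<epsilon>: "0 < \<epsilon>" "\<epsilon> \<le> 1" and summable: "summable (\<lambda>n. w (Suc n) powr (1 + \<epsilon>))"
    and reg: "(\<lambda>n. inverse (w (Suc n)) - inverse (w n)) \<longlonglongrightarrow> 0"
    and \<delta>: "0 \<le> \<delta>" "\<delta> \<le> (1 - \<epsilon>) / 2"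
  shows "AE \<omega> in M. (\<forall>n. pred_recursion p f0 w (\<lambda>i. Y i \<omega>) n \<in> simplex_densities \<and>
      (\<forall>u. 0 < pred_recursion p f0 w (\<lambda>i. Y i \<omega>) n u)) \<and>
    (\<lambda>n. \<Sum>u\<in>UNIV. \<bar>pred_recursion p f0 w (\<lambda>i. Y i \<omega>) n u - q u\<bar>) \<longlonglongrightarrow> 0 \<and>
    (\<lambda>n. (\<Sum>u\<in>UNIV. \<bar>pred_recursion p f0 w (\<lambda>i. Y i \<omega>) n u - q u\<bar>) / w n powr \<delta>) \<longlonglongrightarrow> 0"
proof -
  interpret M: prob_space M by (rule M)
  have rv: "Y i \<in> measurable M N" if "1 \<le> i" for i
    using indep that by (auto simp: M.indep_vars_def)
  have sets_\<mu>: "sets \<mu> = sets N"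
    using sets_distr[of M N "Y 1"] unfolding ident[OF order_refl] .
  have space_\<mu>: "space \<mu> = space N" using sets_\<mu> by (rule sets_eq_imp_space_eq)
  have pN: "p u \<in> borel_measurable N" for u
    using p_measurable[of u] by (simp cong: measurable_cong_sets add: measurable_cong_sets[OF sets_\<mu>])
  have ws: "0 < w (Suc n)" "w (Suc n) < 1" for n using w[of "Suc n"] by auto
  have w0: "w \<longlonglongrightarrow> 0"
  proof -
    \<comment> \<open>The terms of the convergent series vanish; taking the root of order
      \<open>1 + \<epsilon>\<close> transfers this to the weights.\<close>
    have "(\<lambda>n. (w (Suc n) powr (1 + \<epsilon>)) powr (1 / (1 + \<epsilon>))) \<longlonglongrightarrow> 0"
      by (rule tendsto_zero_powrI[OF summable_LIMSEQ_zero[OF summable] tendsto_const])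
         (use \<epsilon> in auto)
    then have "(\<lambda>n. w (Suc n)) \<longlonglongrightarrow> 0" using \<epsilon> ws by (simp add: powr_powr less_imp_le)
    then show ?thesis by (rule LIMSEQ_imp_Suc)
  qed
  have square_summable: "summable (\<lambda>n. (w (Suc n) powr a)\<^sup>2)" if a: "1 + \<epsilon> \<le> 2 * a" for a
  proof (rule summable_comparison_test[OF _ summable], intro exI allI impI)
    fix n
    have "(w (Suc n) powr a)\<^sup>2 = w (Suc n) powr (2 * a)"
      using ws[of n] by (simp add: powr_power mult.commute)
    also have "\<dots> \<le> w (Suc n) powr (1 + \<epsilon>)" using ws[of n] a by (intro powr_mono') auto
    finally show "norm ((w (Suc n) powr a)\<^sup>2) \<le> w (Suc n) powr (1 + \<epsilon>)" by simp
  qed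
  let ?S = "Pi\<^sub>M UNIV (\<lambda>_::'u. borel :: real measure)"
  let ?F = "\<lambda>n y. pred_recursion p f0 w y n"
  have F: "?F n \<in> measurable (Pi\<^sub>M {1..n} (\<lambda>_. N)) ?S" for n
    by (rule measurable_pred_recursion[OF pN order_refl])
  have F_restrict: "?F n (restrict y {1..n}) = ?F n y" for n y
    by (rule pred_recursion_cong) auto
  have sub: "\<And>u. 0 \<le> ?F n y u" "(\<Sum>u\<in>UNIV. ?F n y u) \<le> 1" if "y \<in> space (Pi\<^sub>M {1..n} (\<lambda>_. N))" for n y
  proof -
    have "(\<forall>u. 0 \<le> ?F n y u) \<and> (\<Sum>u\<in>UNIV. ?F n y u) \<le> 1"
    proof (rule pred_recursion_subprob[OF f0(1) w])
      show "0 \<le> p u (y i)" if "1 \<le> i" "i \<le> n" for u i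
        using \<open>y \<in> _\<close> that by (intro p_nonneg) (auto simp: space_\<mu> space_PiM PiE_iff)
    qed auto
    then show "\<And>u. 0 \<le> ?F n y u" "(\<Sum>u\<in>UNIV. ?F n y u) \<le> 1" by auto
  qed
  have noise1: "AE \<omega> in M. summable (\<lambda>n. w (Suc n) *
      ((1 - ratio (?F n (\<lambda>i. Y i \<omega>)) (Y (Suc n) \<omega>) + (ratio (?F n (\<lambda>i. Y i \<omega>)) (Y (Suc n) \<omega>) - 1)\<^sup>2 / B)
       - (\<integral>z. 1 - ratio (?F n (\<lambda>i. Y i \<omega>)) z + (ratio (?F n (\<lambda>i. Y i \<omega>)) z - 1)\<^sup>2 / B \<partial>\<mu>)))"
  proof (rule M.iid_martingale_series[where S="?S" and C="1 + B + (B + 1)\<^sup>2"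
        and \<psi>="\<lambda>f y. 1 - ratio f y + (ratio f y - 1)\<^sup>2 / B", OF indep ident F F_restrict])
    note [measurable] = measurable_mixture_pair[OF pN, unfolded case_prod_beta]
    have [measurable]: "(\<lambda>x. mixture p q (snd x)) \<in> borel_measurable (?S \<Otimes>\<^sub>M N)"
    proof (rule measurable_compose[OF measurable_snd])
      show "mixture p q \<in> borel_measurable N"
        unfolding mixture_def[abs_def] using pN by measurable
    qed
    show "(\<lambda>(f, y). 1 - ratio f y + (ratio f y - 1)\<^sup>2 / B) \<in> borel_measurable (?S \<Otimes>\<^sub>M N)"
      unfolding ratio_def case_prod_beta by measurable
    show "\<bar>1 - ratio (?F n y) z + (ratio (?F n y) z - 1)\<^sup>2 / B\<bar> \<le> 1 + B + (B + 1)\<^sup>2"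
      if "y \<in> space (Pi\<^sub>M {1..n} (\<lambda>_. N))" "z \<in> space N" for n y z
    proof -
      define r where "r = ratio (?F n y) z"
      have r: "0 \<le> r" "r \<le> B" unfolding r_def using sub[OF that(1)] that(2)
        by (auto intro!: ratio_le_B simp: space_\<mu>)
      have "\<bar>r - 1\<bar> \<le> B + 1" using r by auto
      then have "(r - 1)\<^sup>2 \<le> (B + 1)\<^sup>2" using power_mono[of "\<bar>r - 1\<bar>" "B + 1" 2] by simp
      moreover have "(r - 1)\<^sup>2 / B \<le> (r - 1)\<^sup>2 / 1" using B_ge_1 by (intro divide_left_mono) auto
      moreover have "0 \<le> (r - 1)\<^sup>2 / B" using B_ge_1 by simp
      ultimately show ?thesis unfolding r_def[symmetric] using r by linarith
    qed
    show "summable (\<lambda>n. (w (Suc n))\<^sup>2)" using square_summable[of 1] \<epsilon> ws by (simp add: less_imp_le)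
  qed
  have noise2: "AE \<omega> in M. \<forall>u. summable (\<lambda>n. w (Suc n) powr (1 - \<delta>) *
      (p u (Y (Suc n) \<omega>) * ?F n (\<lambda>i. Y i \<omega>) u / mixture p (?F n (\<lambda>i. Y i \<omega>)) (Y (Suc n) \<omega>)
       - (\<integral>z. p u z * ?F n (\<lambda>i. Y i \<omega>) u / mixture p (?F n (\<lambda>i. Y i \<omega>)) z \<partial>\<mu>)))"
  proof -
    have "AE \<omega> in M. summable (\<lambda>n. w (Suc n) powr (1 - \<delta>) *
      (p u (Y (Suc n) \<omega>) * ?F n (\<lambda>i. Y i \<omega>) u / mixture p (?F n (\<lambda>i. Y i \<omega>)) (Y (Suc n) \<omega>)
       - (\<integral>z. p u z * ?F n (\<lambda>i. Y i \<omega>) u / mixture p (?F n (\<lambda>i. Y i \<omega>)) z \<partial>\<mu>)))" for u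
    proof (rule M.iid_martingale_series[where S="?S" and C=1
        and \<psi>="\<lambda>f y. p u y * f u / mixture p f y", OF indep ident F F_restrict measurable_posterior_pair[OF pN]])
      show "\<bar>p u z * ?F n y u / mixture p (?F n y) z\<bar> \<le> 1"
        if "y \<in> space (Pi\<^sub>M {1..n} (\<lambda>_. N))" "z \<in> space N" for n y z
      proof -
        have pz: "\<And>u. 0 \<le> p u z" using p_nonneg that(2) by (simp add: space_\<mu>)
        show ?thesis using posterior_bounds[of p z "?F n y" u, OF pz sub(1)[OF that(1)]] by (simp only: abs_of_nonneg)
      qed
      \<comment> \<open>The requirement \<open>1 + \<epsilon> \<le> 2 * (1 - \<delta>)\<close> is
        the upper bound on \<open>\<delta>\<close> rearranged.\<close>
      show "summable (\<lambda>n. (w (Suc n) powr (1 - \<delta>))\<^sup>2)"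
        by (rule square_summable) (use \<delta> in \<open>simp add: field_simps\<close>)
    qed
    then have "AE \<omega> in M. \<forall>u\<in>UNIV. summable (\<lambda>n. w (Suc n) powr (1 - \<delta>) *
      (p u (Y (Suc n) \<omega>) * ?F n (\<lambda>i. Y i \<omega>) u / mixture p (?F n (\<lambda>i. Y i \<omega>)) (Y (Suc n) \<omega>)
       - (\<integral>z. p u z * ?F n (\<lambda>i. Y i \<omega>) u / mixture p (?F n (\<lambda>i. Y i \<omega>)) z \<partial>\<mu>)))"
      by (intro AE_finite_allI) auto
    then show ?thesis by simp
  qed
  have pos: "AE \<omega> in M. \<forall>i. 1 \<le> i \<longrightarrow> (\<forall>u. 0 < p u (Y i \<omega>))"
  proof -
    have "AE \<omega> in M. 1 \<le> i \<longrightarrow> (\<forall>u. 0 < p u (Y i \<omega>))" for i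
    proof (cases "1 \<le> i")
      case True
      have "AE y in distr M N (Y i). \<forall>u. 0 < p u y" unfolding ident[OF True] using AE_pos by eventually_elim simp
      from AE_distrD[OF rv[OF True] this] show ?thesis by eventually_elim simp
    qed simp
    then show ?thesis by (simp add: AE_all_countable)
  qed
  show ?thesis using AE_space noise1 noise2 pos
  proof eventually_elim
    case (elim \<omega>)
    have y: "Y i \<omega> \<in> space \<mu>" if "1 \<le> i" for i
      using measurable_space[OF rv[OF that] elim(1)] by (simp add: space_\<mu>)
    have p: "0 < p u (Y i \<omega>)" if "1 \<le> i" for i u using elim(4) that by blast
    have w2: "summable (\<lambda>n. (w (Suc n))\<^sup>2)" using square_summable[of 1] \<epsilon> ws by (simp add: less_imp_le)
    have conv: "(\<lambda>n. \<Sum>u\<in>UNIV. \<bar>pred_recursion p f0 w (\<lambda>i. Y i \<omega>) n u - q u\<bar>) \<longlonglongrightarrow> 0"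
      by (rule pred_recursion_converges[OF f0 w w0 div w2 y p elim(2)]) auto
    moreover have "(\<lambda>n. (\<Sum>u\<in>UNIV. \<bar>pred_recursion p f0 w (\<lambda>i. Y i \<omega>) n u - q u\<bar>) / w n powr \<delta>) \<longlonglongrightarrow> 0"
    proof (rule pred_recursion_path_rate[OF f0 w w0 div reg \<delta>(1) _ p conv])
      show "\<delta> \<le> 1" using \<delta> \<epsilon> by simp
      show "summable (\<lambda>n. w (Suc n) powr (1 - \<delta>) *
        (p u (Y (Suc n) \<omega>) * ?F n (\<lambda>i. Y i \<omega>) u / mixture p (?F n (\<lambda>i. Y i \<omega>)) (Y (Suc n) \<omega>)
         - (\<integral>z. p u z * ?F n (\<lambda>i. Y i \<omega>) u / mixture p (?F n (\<lambda>i. Y i \<omega>)) z \<partial>\<mu>)))" for u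
        using elim(3) by blast
    qed auto
    moreover have "pred_recursion p f0 w (\<lambda>i. Y i \<omega>) n \<in> simplex_densities \<and>
        (\<forall>u. 0 < pred_recursion p f0 w (\<lambda>i. Y i \<omega>) n u)" for n
      by (rule pred_recursion_simplex) (fact f0 w p)+
    ultimately show ?case by blast
  qed
qed

end


section \<open>Kullback--Leibler divergence\<close>

lemma prob_densityD:
  assumes "prob_density N g"
  shows "g \<in> borel_measurable N" "\<And>y. y \<in> space N \<Longrightarrow> 0 \<le> g y" "integrable N g" "(\<integral>y. g y \<partial>N) = 1"
  using assms by (auto simp: prob_density_def has_bochner_integral_iff)

lemma mixture_prob_density:
  fixes p :: "'u::finite \<Rightarrow> 'y \<Rightarrow> real"
  assumes p: "\<And>u. prob_density N (p u)" and f: "f \<in> simplex_densities"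
  shows "prob_density N (mixture p f)"
proof -
  have "has_bochner_integral N (\<lambda>y. \<Sum>u\<in>UNIV. p u y * f u) (\<Sum>u\<in>UNIV. 1 * f u)"
    using p by (intro has_bochner_integral_sum has_bochner_integral_mult_left) (auto simp: prob_density_def)
  then show ?thesis
    using p f by (auto simp: prob_density_def mixture_def[abs_def] simplex_densities_def intro!: sum_nonneg)
qed

text \<open>Since \<open>\<infinity> - \<infinity> = \<infinity>\<close> in the extended reals, finiteness of the divergence bounds the positive part;
  the negative part is at most \<open>\<integral> g\<close> because \<open>m ln (g / m) \<le> g - m\<close>.\<close>

lemma kullback_leibler_finiteD:
  assumes m: "prob_density N m" and g: "prob_density N g"
    and fin: "kullback_leibler N m g < \<infinity>"
  shows "AE y in N. m y = 0 \<or> 0 < g y"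
    and "integrable N (\<lambda>y. ln (m y / g y) * m y)"
    and "kullback_leibler N m g = ereal (\<integral>y. ln (m y / g y) * m y \<partial>N)"
proof -
  note m = prob_densityD[OF m] and g = prob_densityD[OF g]
  note [measurable] = m(1) g(1)
  let ?k = "\<lambda>y. ln (m y / g y) * m y"
  have meas_k: "kl_integrand m g \<in> borel_measurable N"
    unfolding kl_integrand_def[abs_def] by measurable
  have neg_le: "e2ennreal (- kl_integrand m g y) \<le> ennreal (g y)" if y: "y \<in> space N" for y
  proof (cases "m y = 0 \<or> g y = 0")
    case True
    then show ?thesis by (auto simp: kl_integrand_def e2ennreal_neg)
  next
    case False
    then have pos: "0 < m y" "0 < g y" using m(2)[OF y] g(2)[OF y] by auto
    have "- (ln (m y / g y) * m y) = m y * ln (g y / m y)" using pos by (simp add: ln_div algebra_simps)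
    also have "\<dots> \<le> m y * (g y / m y - 1)" using pos by (intro mult_left_mono ln_le_minus_one) auto
    also have "\<dots> \<le> g y" using pos by (simp add: algebra_simps)
    finally show ?thesis using False by (simp add: kl_integrand_def ennreal_leI)
  qed
  have "(\<integral>\<^sup>+y. e2ennreal (- kl_integrand m g y) \<partial>N) \<le> (\<integral>\<^sup>+y. ennreal (g y) \<partial>N)"
    by (rule nn_integral_mono) (rule neg_le)
  also have "\<dots> = ennreal 1" using g by (subst nn_integral_eq_integral) auto
  finally have neg: "(\<integral>\<^sup>+y. e2ennreal (- kl_integrand m g y) \<partial>N) < \<infinity>"
    by (rule le_less_trans) simp
  have pos: "(\<integral>\<^sup>+y. e2ennreal (kl_integrand m g y) \<partial>N) < \<infinity>"
  proof (rule ccontr)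
    assume "\<not> ?thesis"
    then have "(\<integral>\<^sup>+y. e2ennreal (kl_integrand m g y) \<partial>N) = \<infinity>" by (simp add: less_top[symmetric])
    then show False using fin by (simp add: kullback_leibler_def)
  qed
  have "AE y in N. e2ennreal (kl_integrand m g y) \<noteq> \<infinity>"
    by (rule nn_integral_noteq_infinite) (use meas_k pos in auto)
  with AE_space show AE: "AE y in N. m y = 0 \<or> 0 < g y"
  proof eventually_elim
    case (elim y)
    then show ?case using g(2)[of y] by (auto simp: kl_integrand_def less_le split: if_splits)
  qed
  have k: "AE y in N. kl_integrand m g y = ereal (?k y)"
    using AE by eventually_elim (auto simp: kl_integrand_def)
  have pos_eq: "(\<integral>\<^sup>+y. e2ennreal (kl_integrand m g y) \<partial>N) = (\<integral>\<^sup>+y. ennreal (?k y) \<partial>N)"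
    using k by (intro nn_integral_cong_AE) auto
  have neg_eq: "(\<integral>\<^sup>+y. e2ennreal (- kl_integrand m g y) \<partial>N) = (\<integral>\<^sup>+y. ennreal (- ?k y) \<partial>N)"
    using k by (intro nn_integral_cong_AE) auto
  show int: "integrable N ?k"
    using pos neg unfolding pos_eq neg_eq by (auto simp: real_integrable_def)
  have "enn2ereal (\<integral>\<^sup>+y. ennreal (?k y) \<partial>N) = ereal (enn2real (\<integral>\<^sup>+y. ennreal (?k y) \<partial>N))"
    "enn2ereal (\<integral>\<^sup>+y. ennreal (- ?k y) \<partial>N) = ereal (enn2real (\<integral>\<^sup>+y. ennreal (- ?k y) \<partial>N))"
    using pos neg unfolding pos_eq neg_eq
    by (auto simp: less_top enn2ereal_ennreal[symmetric] ennreal_enn2real simp del: enn2ereal_ennreal)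
  then show "kullback_leibler N m g = ereal (\<integral>y. ?k y \<partial>N)"
    unfolding kullback_leibler_def pos_eq neg_eq real_lebesgue_integral_def[OF int] by simp
qed

text \<open>Both divergences are finite, so the subtraction is genuine. The logarithm of
  \<open>m\<close> cancels wherever \<open>m\<close> is positive, and the rest of the space carries
  no mass of the data law.\<close>

lemma kullback_leibler_diff:
  assumes m: "prob_density N m" and g: "prob_density N g" "kullback_leibler N m g < \<infinity>"
    and h: "prob_density N h" "kullback_leibler N m h < \<infinity>"
  shows "integrable (density N (\<lambda>y. ennreal (m y))) (\<lambda>y. ln (h y / g y))"
    and "kullback_leibler N m g - kullback_leibler N m h =
      ereal (\<integral>y. ln (h y / g y) \<partial>density N (\<lambda>y. ennreal (m y)))"
proof -
  note md = prob_densityD[OF m] and gd = prob_densityD[OF g(1)] and hd = prob_densityD[OF h(1)]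
  note G = kullback_leibler_finiteD[OF m g] and H = kullback_leibler_finiteD[OF m h]
  note [measurable] = md(1) gd(1) hd(1)
  have m0: "AE y in N. 0 \<le> m y" using md(2) by auto
  have eq: "AE y in N. ln (m y / g y) * m y - ln (m y / h y) * m y = m y *\<^sub>R ln (h y / g y)"
    using G(1) H(1) AE_space
  proof eventually_elim
    case (elim y)
    show ?case
    proof (cases "m y = 0")
      case False
      then have "0 < m y" "0 < g y" "0 < h y" using elim md(2)[of y] by auto
      then show ?thesis by (simp add: ln_div algebra_simps)
    qed simp
  qed
  have int: "integrable N (\<lambda>y. ln (m y / g y) * m y - ln (m y / h y) * m y)"
    using G(2) H(2) by (rule Bochner_Integration.integrable_diff)
  have "integrable N (\<lambda>y. m y *\<^sub>R ln (h y / g y))"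
    by (rule integrable_cong_AE_imp[OF int]) (use eq in auto)
  then show "integrable (density N (\<lambda>y. ennreal (m y))) (\<lambda>y. ln (h y / g y))"
    using m0 by (subst integrable_density) auto
  have "(\<integral>y. ln (h y / g y) \<partial>density N (\<lambda>y. ennreal (m y))) = (\<integral>y. m y *\<^sub>R ln (h y / g y) \<partial>N)"
    using m0 by (subst integral_density) auto
  also have "\<dots> = (\<integral>y. ln (m y / g y) * m y - ln (m y / h y) * m y \<partial>N)"
    by (rule integral_cong_AE) (use eq in auto)
  also have "\<dots> = (\<integral>y. ln (m y / g y) * m y \<partial>N) - (\<integral>y. ln (m y / h y) * m y \<partial>N)"
    using G(2) H(2) by (rule Bochner_Integration.integral_diff)
  finally show "kullback_leibler N m g - kullback_leibler N m h =
      ereal (\<integral>y. ln (h y / g y) \<partial>density N (\<lambda>y. ennreal (m y)))"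
    by (simp add: G(3) H(3))
qed

section \<open>Optimality conditions at the minimizer\<close>

lemma vertex_in_simplex: "(\<lambda>v. if v = u then 1 else 0) \<in> simplex_densities"
  by (simp add: simplex_densities_def)

lemma mixture_vertex: "mixture p (\<lambda>v. if v = u then 1 else 0) y = p u y"
  by (simp add: mixture_def if_distrib cong: if_cong)

lemma mixture_add_scale: "mixture p (\<lambda>u. f u + t * v u) y = mixture p f y + t * mixture p v y"
  by (simp add: mixture_def algebra_simps sum.distrib sum_distrib_left)

text \<open>Moving from the minimizer towards the vertices gives stationarity, and uniqueness rules out
  directions along which the mixture does not change almost everywhere.\<close>

lemma mixture_model_minimizer:
  fixes N :: "'y measure" and p :: "'u::finite \<Rightarrow> 'y \<Rightarrow> real" and m :: "'y \<Rightarrow> real"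
  defines "\<mu> \<equiv> density N (\<lambda>y. ennreal (m y))"
  assumes kernel: "\<And>u. prob_density N (p u)" and m: "prob_density N m"
    and finite_KL: "\<And>f. f \<in> simplex_densities \<Longrightarrow> kullback_leibler N m (mixture p f) < \<infinity>"
    and q: "q \<in> simplex_densities" "\<And>u. 0 < q u"
    and min: "\<And>f. f \<in> simplex_densities \<Longrightarrow> kullback_leibler N m (mixture p q) \<le> kullback_leibler N m (mixture p f)"
    and unique: "\<And>f. f \<in> simplex_densities \<Longrightarrow>
      kullback_leibler N m (mixture p f) = kullback_leibler N m (mixture p q) \<Longrightarrow> f = q"
  shows "mixture_model \<mu> p q"
proof -
  note md = prob_densityD[OF m]
  note kd = prob_densityD[OF kernel]
  have [measurable]: "m \<in> borel_measurable N" "p u \<in> borel_measurable N" for u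
    using md(1) kd(1) by auto
  have mixm [measurable]: "mixture p f \<in> borel_measurable N" for f
    unfolding mixture_def[abs_def] by measurable
  have space: "space \<mu> = space N" by (simp add: \<mu>_def)
  have "emeasure \<mu> (space \<mu>) = (\<integral>\<^sup>+y. ennreal (m y) \<partial>N)"
    unfolding \<mu>_def by (simp add: emeasure_density cong: nn_integral_cong)
  also have "\<dots> = 1" using md by (subst nn_integral_eq_integral) auto
  finally interpret prob_space \<mu> by (rule prob_spaceI)
  have AE_\<mu>: "(AE y in \<mu>. P y) \<longleftrightarrow> (AE y in N. m y \<noteq> 0 \<longrightarrow> P y)" for P
  proof -
    have "(AE y in \<mu>. P y) \<longleftrightarrow> (AE y in N. 0 < ennreal (m y) \<longrightarrow> P y)"
      unfolding \<mu>_def by (subst AE_density) auto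
    also have "\<dots> \<longleftrightarrow> (AE y in N. m y \<noteq> 0 \<longrightarrow> P y)"
      by (rule AE_cong) (use md(2) in \<open>auto simp: ennreal_less_zero_iff less_le\<close>)
    finally show ?thesis .
  qed
  have p_pos: "AE y in \<mu>. 0 < p u y" for u
  proof -
    have "kullback_leibler N m (p u) < \<infinity>"
      using finite_KL[OF vertex_in_simplex[of u]] by (simp add: mixture_vertex[abs_def])
    from kullback_leibler_finiteD(1)[OF m kernel this] show ?thesis unfolding AE_\<mu> by eventually_elim auto
  qed
  have AE_pos: "AE y in \<mu>. y \<in> space \<mu> \<and> (\<forall>u. 0 < p u y)"
  proof -
    have "AE y in \<mu>. \<forall>u\<in>UNIV. 0 < p u y" by (rule AE_finite_allI) (auto simp: p_pos)
    with AE_space show ?thesis by eventually_elim auto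
  qed
  have gap: "integrable \<mu> (\<lambda>y. ln (mixture p f y / mixture p q y))"
    "kullback_leibler N m (mixture p q) - kullback_leibler N m (mixture p f) =
      ereal (\<integral>y. ln (mixture p f y / mixture p q y) \<partial>\<mu>)" if f: "f \<in> simplex_densities" for f
    using kullback_leibler_diff[OF m mixture_prob_density[OF kernel q(1)] finite_KL[OF q(1)]
        mixture_prob_density[OF kernel f] finite_KL[OF f]] by (simp_all add: \<mu>_def)
  have gap_le: "(\<integral>y. ln (mixture p f y / mixture p q y) \<partial>\<mu>) \<le> 0" if f: "f \<in> simplex_densities" for f
  proof -
    have "kullback_leibler N m (mixture p q) - kullback_leibler N m (mixture p f) \<le> 0"
      using min[OF f] kullback_leibler_finiteD(3)[OF m mixture_prob_density[OF kernel f] finite_KL[OF f]]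
        kullback_leibler_finiteD(3)[OF m mixture_prob_density[OF kernel q(1)] finite_KL[OF q(1)]] by simp
    then show ?thesis using gap(2)[OF f] by simp
  qed
  have cr: "0 \<le> p u y / mixture p q y" "p u y / mixture p q y \<le> 1 / q u" if "y \<in> space \<mu>" for u y
  proof -
    have pn: "\<And>u. 0 \<le> p u y" using kd(2) that space by auto
    have qn: "\<And>u. 0 \<le> q u" using q(2) less_imp_le by blast
    show "0 \<le> p u y / mixture p q y" using mixture_nonneg[of p y q] pn qn by simp
    show "p u y / mixture p q y \<le> 1 / q u"
      using posterior_bounds(2)[of p y q u] pn qn q(2)[of u] by (simp add: field_simps)
  qed
  have cr_int: "integrable \<mu> (\<lambda>y. p u y / mixture p q y)" for u
    by (rule integrable_const_bound[where B="1 / q u"])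
       (use cr in \<open>auto simp: \<mu>_def abs_of_nonneg simp del: abs_divide\<close>)
  have le1: "(\<integral>y. p u y / mixture p q y \<partial>\<mu>) \<le> 1" for u
  proof -
    define b where "b = 1 / q u"
    define a where "a = (\<integral>y. p u y / mixture p q y \<partial>\<mu>)"
    have b: "1 \<le> b" using simplex_densities_le_1[OF q(1), of u] q(2)[of u] by (simp add: b_def)
    \<comment> \<open>Moving a fraction \<open>t\<close> towards the vertex \<open>u\<close> changes
      the mixture ratio by \<open>t * (g y - 1)\<close>. Optimality forbids a positive mean of its
      logarithm, so the linear term cannot exceed the second-order error.\<close>
    have step: "t * (a - 1) \<le> 2 * (t * b)\<^sup>2" if t: "0 < t" "t * b \<le> 1 / 2" for t
    proof -
      define f where "f v = q v + t * ((if v = u then 1 else 0) - q v)" for v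
      have t1: "t \<le> 1" using t mult_left_mono[OF b, of t] by linarith
      have "f v = (1 - t) * q v + t * (if v = u then 1 else 0)" for v by (simp add: f_def algebra_simps)
      then have f: "f \<in> simplex_densities"
        using t t1 q by (auto simp: simplex_densities_def sum.distrib sum_distrib_left[symmetric] intro!: add_nonneg_nonneg)
      define g where "g y = p u y / mixture p q y" for y
      have "(\<integral>y. t * (g y - 1) - 2 * (t * b)\<^sup>2 \<partial>\<mu>) \<le> (\<integral>y. ln (mixture p f y / mixture p q y) \<partial>\<mu>)"
      proof (rule integral_mono_AE)
        show "AE y in \<mu>. t * (g y - 1) - 2 * (t * b)\<^sup>2 \<le> ln (mixture p f y / mixture p q y)"
          using AE_pos
        proof eventually_elim
          case (elim y)
          have mq: "0 < mixture p q y" using elim q(2) by (intro mixture_pos) auto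
          have "mixture p f y = mixture p q y + t * (p u y - mixture p q y)"
            unfolding f_def mixture_add_scale mixture_diff mixture_vertex by simp
          then have x: "mixture p f y / mixture p q y = 1 + t * (g y - 1)"
            using mq by (simp add: g_def field_simps)
          have "\<bar>g y - 1\<bar> \<le> b" using cr[of y u] elim b by (auto simp: g_def b_def abs_le_iff simp del: zero_le_divide_iff)
          then have z: "\<bar>t * (g y - 1)\<bar> \<le> t * b" using t by (simp add: abs_mult)
          then have "\<bar>ln (1 + t * (g y - 1)) - t * (g y - 1)\<bar> \<le> 2 * (t * (g y - 1))\<^sup>2"
            by (intro abs_ln_one_plus_x_minus_x_bound) (use t in linarith)
          moreover have "(t * (g y - 1))\<^sup>2 \<le> (t * b)\<^sup>2" using power_mono[OF z, of 2] by (simp only: power2_abs)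
          ultimately show ?case unfolding x by linarith
        qed
      qed (use gap(1)[OF f] cr_int in \<open>auto simp: g_def\<close>)
      also have "(\<integral>y. t * (g y - 1) - 2 * (t * b)\<^sup>2 \<partial>\<mu>) = t * (a - 1) - 2 * (t * b)\<^sup>2"
        using cr_int[of u] by (simp add: g_def a_def prob_space)
      finally show ?thesis using gap_le[OF f] by simp
    qed
    show ?thesis unfolding a_def[symmetric]
    proof (rule ccontr)
      assume "\<not> a \<le> 1"
      then have a: "0 < a - 1" by simp
      \<comment> \<open>The first entry keeps the expansion of the logarithm valid, the second makes
        the quadratic error at most half of the linear gain; a mean above 1 is thereby
        contradicted.\<close>
      define t where "t = min (1 / (2 * b)) ((a - 1) / (4 * b\<^sup>2))"
      have t: "0 < t" "t * b \<le> 1 / 2" "t * (4 * b\<^sup>2) \<le> a - 1"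
      proof -
        show "0 < t" using a b by (simp add: t_def)
        have "t * b \<le> 1 / (2 * b) * b" using b by (intro mult_right_mono) (auto simp: t_def)
        then show "t * b \<le> 1 / 2" using b by simp
        have "t * (4 * b\<^sup>2) \<le> (a - 1) / (4 * b\<^sup>2) * (4 * b\<^sup>2)" by (intro mult_right_mono) (auto simp: t_def)
        then show "t * (4 * b\<^sup>2) \<le> a - 1" using b by simp
      qed
      have "t * (a - 1) \<le> 2 * (t * b)\<^sup>2" by (rule step[OF t(1,2)])
      also have "\<dots> = t * (t * (4 * b\<^sup>2)) / 2" by (simp add: power2_eq_square)
      also have "\<dots> \<le> t * (a - 1) / 2" using t by (intro divide_right_mono mult_left_mono) auto
      finally show False using mult_pos_pos[OF t(1) a] by simp
    qed
  qed
  have stationary: "(\<integral>y. p u y / mixture p q y \<partial>\<mu>) = 1" for u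
  proof -
    \<comment> \<open>The deficits \<open>1 - \<integral> p u / m\<^sub>q\<close> are nonnegative
      and average to zero under the strictly positive \<open>q\<close>, so each of them
      vanishes.\<close>
    have "(\<Sum>u\<in>UNIV. q u * (1 - (\<integral>y. p u y / mixture p q y \<partial>\<mu>))) = 0"
    proof -
      have "(\<Sum>u\<in>UNIV. q u * (\<integral>y. p u y / mixture p q y \<partial>\<mu>)) = (\<integral>y. (\<Sum>u\<in>UNIV. q u * (p u y / mixture p q y)) \<partial>\<mu>)"
        using cr_int by (simp del: times_divide_eq_right)
      also have "\<dots> = (\<integral>y. 1 \<partial>\<mu>)"
      proof (rule integral_cong_AE)
        show "AE y in \<mu>. (\<Sum>u\<in>UNIV. q u * (p u y / mixture p q y)) = 1"
          using AE_pos
        proof eventually_elim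
          case (elim y)
          have "0 < mixture p q y" using elim q(2) by (intro mixture_pos) auto
          then have "mixture p q y / mixture p q y = 1" by simp
          then show ?case by (subst (asm) (1) mixture_def) (simp add: sum_divide_distrib mult.commute)
        qed
      qed (auto simp: \<mu>_def)
      finally show ?thesis using q(1) by (simp add: right_diff_distrib sum_subtractf prob_space simplex_densities_def)
    qed
    then have "q u * (1 - (\<integral>y. p u y / mixture p q y \<partial>\<mu>)) = 0"
      using le1 q(2) by (subst (asm) sum_nonneg_eq_0_iff) (auto simp: less_imp_le intro!: mult_nonneg_nonneg)
    then show ?thesis using q(2)[of u] by simp
  qed
  have nondegenerate: "v = (\<lambda>_. 0)" if v: "(\<Sum>u\<in>UNIV. v u) = 0" and AE0: "AE y in \<mu>. mixture p v y = 0" for v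
  proof -
    \<comment> \<open>Dividing \<open>v\<close> by \<open>s\<close> makes it small enough relative
      to \<open>q\<close> for \<open>f\<close> to stay in the simplex; the added 1 guarantees that
      \<open>s\<close> is positive.\<close>
    define s where "s = Max (range (\<lambda>u. \<bar>v u\<bar> / q u)) + 1"
    have s: "\<bar>v u\<bar> / q u \<le> s - 1" for u unfolding s_def by (simp add: Max_ge)
    have s0: "0 < s" using s[of undefined] q(2)[of undefined] by (smt (verit) divide_nonneg_pos)
    define f where "f u = q u + (1 / s) * v u" for u
    have "0 \<le> f u" for u
    proof -
      have "\<bar>v u\<bar> \<le> s * q u" using s[of u] q(2)[of u] by (simp add: field_simps)
      then show ?thesis unfolding f_def using s0 by (simp add: field_simps)
    qed
    moreover have "(\<Sum>u\<in>UNIV. f u) = 1"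
      using v q(1) by (simp add: f_def sum.distrib sum_divide_distrib[symmetric] simplex_densities_def)
    ultimately have f: "f \<in> simplex_densities" by (simp add: simplex_densities_def)
    have "(\<integral>y. ln (mixture p f y / mixture p q y) \<partial>\<mu>) = (\<integral>y. 0 \<partial>\<mu>)"
    proof (rule integral_cong_AE)
      show "AE y in \<mu>. ln (mixture p f y / mixture p q y) = 0"
        using AE_pos AE0
      proof eventually_elim
        case (elim y)
        have "0 < mixture p q y" using elim q(2) by (intro mixture_pos) auto
        moreover have "mixture p f y = mixture p q y"
          unfolding f_def mixture_add_scale using elim by simp
        ultimately show ?case by simp
      qed
    qed (auto simp: \<mu>_def)
    then have "kullback_leibler N m (mixture p q) - kullback_leibler N m (mixture p f) = 0"
      unfolding gap(2)[OF f] by simp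
    then have "kullback_leibler N m (mixture p f) = kullback_leibler N m (mixture p q)"
      using kullback_leibler_finiteD(3)[OF m mixture_prob_density[OF kernel f] finite_KL[OF f]]
        kullback_leibler_finiteD(3)[OF m mixture_prob_density[OF kernel q(1)] finite_KL[OF q(1)]] by simp
    then have "f = q" by (rule unique[OF f])
    then show ?thesis using s0 by (auto simp: f_def fun_eq_iff)
  qed
  show ?thesis
    by unfold_locales
       (use kd p_pos q stationary nondegenerate in \<open>auto simp: \<mu>_def\<close>)
qed

section \<open>Transfer to mixture distance and excess divergence\<close>

lemma integral_abs_mixture_diff_le:
  fixes p :: "'u::finite \<Rightarrow> 'y \<Rightarrow> real"
  assumes p: "\<And>u. prob_density N (p u)"
  shows "(\<integral>y. \<bar>mixture p f y - mixture p g y\<bar> \<partial>N) \<le> (\<Sum>u\<in>UNIV. \<bar>f u - g u\<bar>)"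
proof -
  note pd = prob_densityD[OF p]
  have int: "integrable N (mixture p f)" for f
    unfolding mixture_def[abs_def] using pd(3) by auto
  have "(\<integral>y. \<bar>mixture p f y - mixture p g y\<bar> \<partial>N) \<le> (\<integral>y. (\<Sum>u\<in>UNIV. p u y * \<bar>f u - g u\<bar>) \<partial>N)"
  proof (rule integral_mono)
    fix y assume y: "y \<in> space N"
    have "\<bar>mixture p f y - mixture p g y\<bar> \<le> (\<Sum>u\<in>UNIV. \<bar>p u y * (f u - g u)\<bar>)"
    proof -
      have "mixture p f y - mixture p g y = (\<Sum>u\<in>UNIV. p u y * (f u - g u))"
        by (simp add: mixture_diff[symmetric]) (simp add: mixture_def)
      then show ?thesis by (simp only: sum_abs)
    qed
    then show "\<bar>mixture p f y - mixture p g y\<bar> \<le> (\<Sum>u\<in>UNIV. p u y * \<bar>f u - g u\<bar>)"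
      using pd(2)[OF y] by (simp add: abs_mult)
  qed (use int pd(3) in auto)
  also have "\<dots> = (\<Sum>u\<in>UNIV. \<bar>f u - g u\<bar>)" using pd(3,4) by simp
  finally show ?thesis .
qed

theorem corollary1:
  fixes M :: "'a measure"
    and N :: "'y measure"
    and p :: "'u::finite \<Rightarrow> 'y \<Rightarrow> real"
    and m :: "'y \<Rightarrow> real"
    and Y :: "nat \<Rightarrow> 'a \<Rightarrow> 'y"
    and f0 fstar :: "'u \<Rightarrow> real"
    and w :: "nat \<Rightarrow> real"
    and \<epsilon> \<delta> :: real
    and Kstar :: ereal
  assumes kernel: "\<forall>u. prob_density N (p u)"
    and true_density: "prob_density N m"
    and M: "prob_space M"
    and indep: "prob_space.indep_vars M (\<lambda>_. N) Y {1..}"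
    and ident: "\<forall>i\<ge>1. distributed M N (Y i) (\<lambda>y. ennreal (m y))"
    and weights: "\<forall>n\<ge>1. 0 < w n \<and> w n < 1"
    and initial: "f0 \<in> simplex_densities" "\<forall>u. 0 < f0 u"
    and continuous:
      "\<forall>y\<in>space N. continuous_map (discrete_topology UNIV) euclideanreal (\<lambda>u. p u y)"
    and identifiable: "inj_on (mixture p) simplex_densities"
    and eps: "0 < \<epsilon>" "\<epsilon> \<le> 1"
    and divergent: "filterlim (\<lambda>n. \<Sum>i=1..n. w i) at_top sequentially"
    and summable: "summable (\<lambda>n. w (Suc n) powr (1 + \<epsilon>))"
    and regular: "(\<lambda>n. inverse (w (Suc n)) - inverse (w n)) \<longlonglongrightarrow> 0"
    and finite_KL: "\<forall>f\<in>simplex_densities. kullback_leibler N m (mixture p f) < \<infinity>"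
    and minimizer:
      "\<forall>f. is_arg_min (\<lambda>g. kullback_leibler N m (mixture p g)) (\<lambda>g. g \<in> simplex_densities) f
        \<longleftrightarrow> f = fstar"
    and interior: "\<forall>u. 0 < fstar u"
    and Kstar: "Kstar = (INF f\<in>simplex_densities. kullback_leibler N m (mixture p f))"
    and delta: "0 < \<delta>" "\<delta> \<le> (1 - \<epsilon>) / 2"
  shows "AE \<omega> in M.
    (\<lambda>n. LINT y|N. \<bar>mixture p (pred_recursion p f0 w (\<lambda>i. Y i \<omega>) n) y - mixture p fstar y\<bar>)
      \<in> o(\<lambda>n. w n powr \<delta>)
    \<and> (\<lambda>n. real_of_ereal
          (kullback_leibler N m (mixture p (pred_recursion p f0 w (\<lambda>i. Y i \<omega>) n)) - Kstar))
      \<in> o(\<lambda>n. w n powr (2 * \<delta>))"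
proof -
  define \<mu> where "\<mu> = density N (\<lambda>y. ennreal (m y))"
  let ?K = "\<lambda>f. kullback_leibler N m (mixture p f)"
  have fin: "?K f < \<infinity>" if "f \<in> simplex_densities" for f using finite_KL that by blast
  have kern: "prob_density N (p u)" for u using kernel by blast
  have star: "is_arg_min ?K (\<lambda>g. g \<in> simplex_densities) fstar" using minimizer by blast
  then have fs: "fstar \<in> simplex_densities" and min: "?K fstar \<le> ?K f" if "f \<in> simplex_densities" for f
    using that by (auto simp: is_arg_min_def not_less)
  have fs: "fstar \<in> simplex_densities" using star by (auto simp: is_arg_min_def)
  have pos: "0 < fstar u" "0 < f0 u" for u using interior initial by auto
  have w: "0 < w n \<and> w n < 1" if "1 \<le> n" for n using weights that by blast
  have unique: "f = fstar" if f: "f \<in> simplex_densities" and eq: "?K f = ?K fstar" for f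
  proof -
    have "is_arg_min ?K (\<lambda>g. g \<in> simplex_densities) f"
      unfolding is_arg_min_def eq using f min by (auto simp: not_less)
    then show ?thesis using minimizer by blast
  qed
  have Kstar_eq: "Kstar = ?K fstar"
    unfolding Kstar by (rule antisym) (auto intro: INF_lower fs INF_greatest min)
  interpret mixture_model \<mu> p fstar
    unfolding \<mu>_def
    by (rule mixture_model_minimizer[OF kern true_density fin fs pos(1) min unique])
  have ident': "distr M N (Y i) = \<mu>" if "1 \<le> i" for i
    using ident that by (auto simp: distributed_def \<mu>_def)
  have div: "filterlim (\<lambda>n. \<Sum>i<n. w (Suc i)) at_top sequentially"
    using divergent by (simp add: sum.atLeast1_atMost_eq atLeast0LessThan)
  \<comment> \<open>\<open>real_of_ereal\<close> would send infinities to 0, but both divergences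
    are finite, so it is faithful here. The gap is nonnegative by minimality, and the upper bound
    for the log ratio thus controls its absolute value.\<close>
  have KL_gap: "\<bar>real_of_ereal (?K f - Kstar)\<bar> \<le> 2 * B\<^sup>2 * (\<Sum>u\<in>UNIV. \<bar>f u - fstar u\<bar>)\<^sup>2"
    if f: "f \<in> simplex_densities" "\<And>u. 0 < f u" and near: "B * (\<Sum>u\<in>UNIV. \<bar>f u - fstar u\<bar>) \<le> 1 / 2" for f
  proof -
    have eq: "?K f - Kstar = ereal (\<integral>y. ln (mixture p fstar y / mixture p f y) \<partial>\<mu>)"
      unfolding Kstar_eq \<mu>_def
      by (rule kullback_leibler_diff(2)[OF true_density mixture_prob_density[OF kern f(1)] fin[OF f(1)]
            mixture_prob_density[OF kern fs] fin[OF fs]])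
    have "0 \<le> ?K f - Kstar"
      unfolding Kstar_eq using min[OF f(1)] 
        kullback_leibler_finiteD(3)[OF true_density mixture_prob_density[OF kern f(1)] fin[OF f(1)]]
        kullback_leibler_finiteD(3)[OF true_density mixture_prob_density[OF kern fs] fin[OF fs]] by simp
    then show ?thesis using log_ratio_le[OF f near] unfolding eq by simp
  qed
  have "AE \<omega> in M. (\<forall>n. pred_recursion p f0 w (\<lambda>i. Y i \<omega>) n \<in> simplex_densities \<and>
      (\<forall>u. 0 < pred_recursion p f0 w (\<lambda>i. Y i \<omega>) n u)) \<and>
    (\<lambda>n. \<Sum>u\<in>UNIV. \<bar>pred_recursion p f0 w (\<lambda>i. Y i \<omega>) n u - fstar u\<bar>) \<longlonglongrightarrow> 0 \<and>
    (\<lambda>n. (\<Sum>u\<in>UNIV. \<bar>pred_recursion p f0 w (\<lambda>i. Y i \<omega>) n u - fstar u\<bar>) / w n powr \<delta>) \<longlonglongrightarrow> 0"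
    by (rule pred_recursion_rate)
       (fact M indep ident' initial(1) pos(2) w div eps summable regular less_imp_le[OF delta(1)] delta(2))+
  then show ?thesis
  proof eventually_elim
    case (elim \<omega>)
    define f where "f = pred_recursion p f0 w (\<lambda>i. Y i \<omega>)"
    define L where "L n = (\<Sum>u\<in>UNIV. \<bar>f n u - fstar u\<bar>)" for n
    have f: "f n \<in> simplex_densities" "\<And>u. 0 < f n u" for n using elim by (auto simp: f_def)
    have L0: "L \<longlonglongrightarrow> 0" "(\<lambda>n. L n / w n powr \<delta>) \<longlonglongrightarrow> 0" using elim by (auto simp: L_def[abs_def] f_def)
    have Lnn: "0 \<le> L n" for n by (auto simp: L_def intro: sum_nonneg)
    \<comment> \<open>The value \<open>w 0\<close> is unconstrained, so positivity of the comparison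
      functions holds only eventually.\<close>
    have wev: "\<forall>\<^sub>F n in sequentially. 0 < w n"
      using eventually_ge_at_top[of 1] by eventually_elim (use w in auto)
    then have wne: "\<forall>\<^sub>F n in sequentially. w n powr a \<noteq> 0" for a
      by eventually_elim simp
    have L: "L \<in> o(\<lambda>n. w n powr \<delta>)"
      by (rule smalloI_tendsto[OF L0(2) wne])
    have "(\<lambda>n. L n * L n) \<in> o(\<lambda>n. w n powr \<delta> * w n powr \<delta>)" using L L by (rule landau_o.small_mult)
    then have L2: "(\<lambda>n. (L n)\<^sup>2) \<in> o(\<lambda>n. w n powr (2 * \<delta>))"
      by (simp add: power2_eq_square powr_add[symmetric] flip: mult_2)
    have "(\<lambda>n. LINT y|N. \<bar>mixture p (f n) y - mixture p fstar y\<bar>) \<in> O(L)"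
    proof (rule bigoI[where c=1], rule always_eventually, rule allI)
      fix n
      have "0 \<le> (LINT y|N. \<bar>mixture p (f n) y - mixture p fstar y\<bar>)" by simp
      then show "norm (LINT y|N. \<bar>mixture p (f n) y - mixture p fstar y\<bar>) \<le> 1 * norm (L n)"
        using integral_abs_mixture_diff_le[where p=p and f="f n" and g=fstar, OF kern] Lnn[of n] by (simp add: L_def)
    qed
    then have 1: "(\<lambda>n. LINT y|N. \<bar>mixture p (f n) y - mixture p fstar y\<bar>) \<in> o(\<lambda>n. w n powr \<delta>)"
      using L by (rule landau_o.big_small_trans)
    have "(\<lambda>n. real_of_ereal (?K (f n) - Kstar)) \<in> O(\<lambda>n. (L n)\<^sup>2)"
    proof (rule bigoI[where c="2 * B\<^sup>2"])
      have "(\<lambda>n. B * L n) \<longlonglongrightarrow> 0" using L0(1) by (rule tendsto_mult_right_zero)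
      then have "\<forall>\<^sub>F n in sequentially. B * L n < 1 / 2" by (rule order_tendstoD(2)) simp
      then show "\<forall>\<^sub>F n in sequentially. norm (real_of_ereal (?K (f n) - Kstar)) \<le> 2 * B\<^sup>2 * norm ((L n)\<^sup>2)"
        by eventually_elim (use KL_gap[OF f] in \<open>simp add: L_def\<close>)
    qed
    then have 2: "(\<lambda>n. real_of_ereal (?K (f n) - Kstar)) \<in> o(\<lambda>n. w n powr (2 * \<delta>))"
      using L2 by (rule landau_o.big_small_trans)
    show ?case using 1 2 by (simp add: f_def)
  qed
qed

end
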